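(* Let $\mathcal{H}$ be a maximal regular unitarily invariant complete Nevanlinna--Pick space on $\mathbb{B}_d$. Let $\mathfrak{a}\subset \mathcal{M}(\mathcal{H})$ be a proper weak-$*$ closed homogeneous ideal such that $\mathcal{H}_{\mathfrak{a}}$ has dimension greater than one. If $\mathcal{A}_{\mathfrak{a}}$ is not completely isometrically isomorphic to the disc algebra $A(\mathbb{D})$, then the Gelfand transform of $\mathcal{A}_{\mathfrak{a}}$ is not completely isometric.
   Context: Let $d\ge 1$ and let $\mathbb{B}_d\subset\mathbb{C}^d$ be the open unit ball. A regular unitarily invariant complete Nevanlinna--Pick space on $\mathbb{B}_d$ is the reproducing kernel Hilbert space $\mathcal{H}$ of analytic functions on $\mathbb{B}_d$ with a kernel of the form $k(z,w)=\sum_{n=0}^\infty a_n\langle z,w\rangle^n$, where $a_0=1$, $a_n>0$ for all $n$, $\lim_{n\to\infty} a_n/a_{n+1}=1$, and such that $1-\frac{1}{k(z,w)}=\sum_{n=1}^\infty b_n\langle z,w\rangle^n$ on $\mathbb{B}_d\times\mathbb{B}_d$ with all $b_n\ge 0$ (then automatically $\sum_n b_n\le 1$). It is called maximal if $\sum_{n=1}^\infty b_n=1$. $\mathcal{M}(\mathcal{H})$ is the algebra of multipliers of $\mathcal{H}$ (functions $\psi:\mathbb{B}_d\to\mathbb{C}$ with $\psi\mathcal{H}\subset\mathcal{H}$), identified with the algebra of multiplication operators $M_\psi$; it is a weak-$*$ closed subalgebra of $B(\mathcal{H})$ and contains the polynomials. $\mathcal{A}(\mathcal{H})$ is the norm closure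 of the polynomials in $\mathcal{M}(\mathcal{H})$. For a weak-$*$ closed ideal $\mathfrak{a}\subset\mathcal{M}(\mathcal{H})$, put $[\mathfrak{a}\mathcal{H}]=\overline{\mathrm{span}}\{M_\phi f:\phi\in\mathfrak{a},f\in\mathcal{H}\}$, $\mathcal{H}_{\mathfrak{a}}=\mathcal{H}\ominus[\mathfrak{a}\mathcal{H}]$, $\psi(Z_{\mathfrak{a}})=P_{\mathcal{H}_{\mathfrak{a}}}M_\psi|_{\mathcal{H}_{\mathfrak{a}}}$ for $\psi\in\mathcal{M}(\mathcal{H})$. Then $\mathcal{A}_{\mathfrak{a}}\subset B(\mathcal{H}_{\mathfrak{a}})$ is the norm closure of $\{\phi(Z_{\mathfrak{a}}):\phi\in\mathcal{A}(\mathcal{H})\}$, a commutative unital operator algebra. A weak-$*$ closed ideal $\mathfrak{a}\subset\mathcal{M}(\mathcal{H})$ is homogeneous if it is the weak-$*$ closure of an ideal of polynomials generated by some collection of homogeneous polynomials. The disc algebra $A(\mathbb{D})\subset C(\overline{\mathbb{D}})$ is the algebra of continuous functions on $\overline{\mathbb{D}}$ that are holomorphic on $\mathbb{D}$, with the supremum norm (and the matrix norms inherited from $C(\overline{\mathbb{D}})$). For a commutative unital Banach algebra $\mathfrak{B}$, $\Delta(\mathfrak{B})$ is its space of characters and the Gelfand transform is $g:\mathfrak{B}\to C(\Delta(\mathfrak{B}))$, $g(b)(\chi)=\chi(b)$. For an operator algebra $\mathfrak{B}$, it is completely isometric if $\|[b_{ij}]\|_{\mathbb{M}_n(\mathfrak{B})}=\max_{\chi\in\Delta(\mathfrak{B})}\|[\chi(b_{ij})]\|_{\mathbb{M}_n}$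 for all $n\ge1$ and $[b_{ij}]\in\mathbb{M}_n(\mathfrak{B})$. *)

theory Defs
  imports "HOL-Analysis.Analysis"
begin

text \<open>
  A function on the open unit ball of \<open>\<complex>\<^sup>d\<close> (with \<open>d = CARD('n)\<close>) is represented by a function on all
  of \<open>complex ^ 'n\<close> that vanishes off the ball, so that equality of functions on the ball is
  equality in HOL.
\<close>

type_synonym 'n fn = "complex ^ 'n \<Rightarrow> complex"

definition vinner :: "complex ^ 'n \<Rightarrow> complex ^ 'n \<Rightarrow> complex" where
  "vinner z w = (\<Sum>i\<in>UNIV. z $ i * cnj (w $ i))"

definition on_ball :: "('n::finite) fn \<Rightarrow> 'n fn" where
  "on_ball f = (\<lambda>z. if z \<in> ball 0 1 then f z else 0)"

definition supported_on_ball :: "('n::finite) fn \<Rightarrow> bool" where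
  "supported_on_ball f \<longleftrightarrow> (\<forall>z. z \<notin> ball 0 1 \<longrightarrow> f z = 0)"

definition analytic_on_ball :: "('n::finite) fn \<Rightarrow> bool" where
  "analytic_on_ball f \<longleftrightarrow>
     (\<forall>z\<in>ball 0 1. \<exists>D. (f has_derivative D) (at z) \<and> (\<forall>c v. D (c *s v) = c * D v))"

record 'n fn_space =
  hcarrier :: "'n fn set"
  hinner :: "'n fn \<Rightarrow> 'n fn \<Rightarrow> complex"

definition hnorm :: "'n fn_space \<Rightarrow> 'n fn \<Rightarrow> real" where
  "hnorm H f = sqrt (Re (hinner H f f))"

definition hsub :: "'n fn_space \<Rightarrow> 'n fn set \<Rightarrow> 'n fn_space" where
  "hsub H K = H\<lparr>hcarrier := K\<rparr>"

definition hilbert_fn_space :: "('n::finite) fn_space \<Rightarrow> bool" where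
  "hilbert_fn_space H \<longleftrightarrow>
     (\<forall>f\<in>hcarrier H. supported_on_ball f) \<and>
     (\<lambda>z. 0) \<in> hcarrier H \<and>
     (\<forall>f\<in>hcarrier H. \<forall>g\<in>hcarrier H. (\<lambda>z. f z + g z) \<in> hcarrier H) \<and>
     (\<forall>c. \<forall>f\<in>hcarrier H. (\<lambda>z. c * f z) \<in> hcarrier H) \<and>
     (\<forall>f\<in>hcarrier H. \<forall>g\<in>hcarrier H. \<forall>h\<in>hcarrier H.
        hinner H (\<lambda>z. f z + g z) h = hinner H f h + hinner H g h) \<and>
     (\<forall>c. \<forall>f\<in>hcarrier H. \<forall>g\<in>hcarrier H. hinner H (\<lambda>z. c * f z) g = c * hinner H f g) \<and>
     (\<forall>f\<in>hcarrier H. \<forall>g\<in>hcarrier H. hinner H g f = cnj (hinner H f g)) \<and>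
     (\<forall>f\<in>hcarrier H. 0 \<le> Re (hinner H f f)) \<and>
     (\<forall>f\<in>hcarrier H. hinner H f f = 0 \<longrightarrow> f = (\<lambda>z. 0)) \<and>
     (\<forall>f. (\<forall>n. f n \<in> hcarrier H) \<and>
          (\<forall>e>0. \<exists>N. \<forall>m\<ge>N. \<forall>n\<ge>N. hnorm H (\<lambda>z. f m z - f n z) < e) \<longrightarrow>
          (\<exists>g\<in>hcarrier H. (\<lambda>n. hnorm H (\<lambda>z. f n z - g z)) \<longlonglongrightarrow> (0::real)))"

definition rkhs :: "('n::finite) fn_space \<Rightarrow> (complex ^ 'n \<Rightarrow> complex ^ 'n \<Rightarrow> complex) \<Rightarrow> bool" where
  "rkhs H k \<longleftrightarrow> hilbert_fn_space H \<and>
     (\<forall>w\<in>ball 0 1. on_ball (\<lambda>z. k z w) \<in> hcarrier H \<and>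
        (\<forall>f\<in>hcarrier H. hinner H f (on_ball (\<lambda>z. k z w)) = f w))"

text \<open>
  The condition \<open>k z w \<noteq> 0\<close> makes \<open>1 / k z w\<close> a genuine reciprocal.  The value \<open>b 0\<close> plays no role.
\<close>

definition regular_ui_cnp_space ::
    "('n::finite) fn_space \<Rightarrow> (complex ^ 'n \<Rightarrow> complex ^ 'n \<Rightarrow> complex) \<Rightarrow>
     (nat \<Rightarrow> real) \<Rightarrow> (nat \<Rightarrow> real) \<Rightarrow> bool" where
  "regular_ui_cnp_space H k a b \<longleftrightarrow>
     rkhs H k \<and> (\<forall>f\<in>hcarrier H. analytic_on_ball f) \<and>
     (\<forall>z\<in>ball 0 1. \<forall>w\<in>ball 0 1. (\<lambda>n. of_real (a n) * vinner z w ^ n) sums k z w) \<and>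
     a 0 = 1 \<and> (\<forall>n. a n > 0) \<and> (\<lambda>n. a n / a (Suc n)) \<longlonglongrightarrow> 1 \<and>
     (\<forall>n\<ge>1. b n \<ge> 0) \<and>
     (\<forall>z\<in>ball 0 1. \<forall>w\<in>ball 0 1. k z w \<noteq> 0 \<and>
        (\<lambda>n. of_real (b (Suc n)) * vinner z w ^ Suc n) sums (1 - 1 / k z w))"

definition maximal_cnp :: "(nat \<Rightarrow> real) \<Rightarrow> bool" where
  "maximal_cnp b \<longleftrightarrow> (\<lambda>n. b (Suc n)) sums 1"

text \<open>
  Operators on a space are extensional functions (\<^const>\<open>undefined\<close> off the carrier), so that equality
  of operators is equality in HOL.
\<close>

type_synonym 'n fn_op = "'n fn \<Rightarrow> 'n fn"

definition bounded_ops :: "'n fn_space \<Rightarrow> 'n fn_op set" where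
  "bounded_ops H = {T \<in> hcarrier H \<rightarrow>\<^sub>E hcarrier H.
     (\<forall>f\<in>hcarrier H. \<forall>g\<in>hcarrier H. T (\<lambda>z. f z + g z) = (\<lambda>z. T f z + T g z)) \<and>
     (\<forall>c. \<forall>f\<in>hcarrier H. T (\<lambda>z. c * f z) = (\<lambda>z. c * T f z)) \<and>
     (\<exists>C. \<forall>f\<in>hcarrier H. hnorm H (T f) \<le> C * hnorm H f)}"

definition op_mat_norm :: "'n fn_space \<Rightarrow> nat \<Rightarrow> (nat \<Rightarrow> nat \<Rightarrow> 'n fn_op) \<Rightarrow> real" where
  "op_mat_norm H n A =
     Sup {sqrt (\<Sum>i<n. (hnorm H (\<lambda>z. \<Sum>j<n. A i j (f j) z))\<^sup>2) | f.
            (\<forall>j<n. f j \<in> hcarrier H) \<and> (\<Sum>j<n. (hnorm H (f j))\<^sup>2) \<le> 1}"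

definition op_norm :: "'n fn_space \<Rightarrow> 'n fn_op \<Rightarrow> real" where
  "op_norm H T = Sup {hnorm H (T f) | f. f \<in> hcarrier H \<and> hnorm H f \<le> 1}"

definition op_diff :: "'n fn_space \<Rightarrow> 'n fn_op \<Rightarrow> 'n fn_op \<Rightarrow> 'n fn_op" where
  "op_diff H T U = (\<lambda>f\<in>hcarrier H. \<lambda>z. T f z - U f z)"

text \<open>
  The weak-* topology of \<open>B(H)\<close> as the dual of the trace class: the weak-* continuous functionals
  are \<open>T \<mapsto> \<Sum>\<^sub>m \<langle>T x\<^sub>m, y\<^sub>m\<rangle>\<close> with \<open>(x\<^sub>m)\<close>, \<open>(y\<^sub>m)\<close> norm square summable, and the topology is the
  coarsest one making them continuous.
\<close>

definition weak_star_topology :: "'n fn_space \<Rightarrow> 'n fn_op topology" where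
  "weak_star_topology H = topology_generated_by
     {{T \<in> bounded_ops H. (\<Sum>m. hinner H (T (x m)) (y m)) \<in> U} | x y U.
        (\<forall>m. x m \<in> hcarrier H) \<and> (\<forall>m. y m \<in> hcarrier H) \<and>
        summable (\<lambda>m. (hnorm H (x m))\<^sup>2) \<and> summable (\<lambda>m. (hnorm H (y m))\<^sup>2) \<and> open U}"

definition multipliers :: "('n::finite) fn_space \<Rightarrow> 'n fn set" where
  "multipliers H = {\<psi>. supported_on_ball \<psi> \<and> (\<forall>f\<in>hcarrier H. (\<lambda>z. \<psi> z * f z) \<in> hcarrier H)}"

definition mult_op :: "'n fn_space \<Rightarrow> 'n fn \<Rightarrow> 'n fn_op" where
  "mult_op H \<psi> = (\<lambda>f\<in>hcarrier H. \<lambda>z. \<psi> z * f z)"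

definition mult_weak_star :: "('n::finite) fn_space \<Rightarrow> 'n fn topology" where
  "mult_weak_star H = pullback_topology (multipliers H) (mult_op H) (weak_star_topology H)"

definition monomial_fn :: "('n::finite \<Rightarrow> nat) \<Rightarrow> 'n fn" where
  "monomial_fn \<alpha> z = (\<Prod>i\<in>UNIV. (z $ i) ^ \<alpha> i)"

definition polynomial_fn :: "('n::finite) fn \<Rightarrow> bool" where
  "polynomial_fn p \<longleftrightarrow>
     (\<exists>F c. finite F \<and> p = (\<lambda>z. \<Sum>\<alpha>\<in>F. c \<alpha> * monomial_fn \<alpha> z))"

definition homogeneous_fn :: "('n::finite) fn \<Rightarrow> bool" where
  "homogeneous_fn p \<longleftrightarrow>
     (\<exists>m F c. finite F \<and> (\<forall>\<alpha>\<in>F. (\<Sum>i\<in>UNIV. \<alpha> i) = m) \<and>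
        p = (\<lambda>z. \<Sum>\<alpha>\<in>F. c \<alpha> * monomial_fn \<alpha> z))"

definition polynomial_ideal :: "('n::finite) fn set \<Rightarrow> 'n fn set" where
  "polynomial_ideal G = {(\<lambda>z. \<Sum>i<N. q i z * g i z) | (N::nat) q g.
     \<forall>i<N. polynomial_fn (q i) \<and> g i \<in> G}"

definition poly_closure :: "('n::finite) fn_space \<Rightarrow> 'n fn set" where
  "poly_closure H = {\<phi> \<in> multipliers H. \<forall>e>0. \<exists>p. polynomial_fn p \<and>
     op_norm H (op_diff H (mult_op H \<phi>) (mult_op H (on_ball p))) < e}"

definition multiplier_ideal :: "('n::finite) fn_space \<Rightarrow> 'n fn set \<Rightarrow> bool" where
  "multiplier_ideal H I \<longleftrightarrow> I \<subseteq> multipliers H \<and> (\<lambda>z. 0) \<in> I \<and>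
     (\<forall>\<phi>\<in>I. \<forall>\<psi>\<in>I. (\<lambda>z. \<phi> z + \<psi> z) \<in> I) \<and>
     (\<forall>\<psi>\<in>multipliers H. \<forall>\<phi>\<in>I. (\<lambda>z. \<psi> z * \<phi> z) \<in> I)"

definition weak_star_closed_ideal :: "('n::finite) fn_space \<Rightarrow> 'n fn set \<Rightarrow> bool" where
  "weak_star_closed_ideal H I \<longleftrightarrow> multiplier_ideal H I \<and> closedin (mult_weak_star H) I"

definition homogeneous_ideal :: "('n::finite) fn_space \<Rightarrow> 'n fn set \<Rightarrow> bool" where
  "homogeneous_ideal H I \<longleftrightarrow> (\<exists>G. (\<forall>g\<in>G. homogeneous_fn g) \<and>
     I = mult_weak_star H closure_of (on_ball ` polynomial_ideal G))"

definition closed_span :: "'n fn_space \<Rightarrow> 'n fn set \<Rightarrow> 'n fn set" where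
  "closed_span H G = {f \<in> hcarrier H. \<forall>e>0. \<exists>(N::nat) c g.
     (\<forall>i<N. g i \<in> G) \<and> hnorm H (\<lambda>z. f z - (\<Sum>i<N. c i * g i z)) < e}"

definition ideal_range :: "('n::finite) fn_space \<Rightarrow> 'n fn set \<Rightarrow> 'n fn set" where
  "ideal_range H I = closed_span H {mult_op H \<phi> f | \<phi> f. \<phi> \<in> I \<and> f \<in> hcarrier H}"

definition quotient_space :: "('n::finite) fn_space \<Rightarrow> 'n fn set \<Rightarrow> 'n fn_space" where
  "quotient_space H I = hsub H {f \<in> hcarrier H. \<forall>g\<in>ideal_range H I. hinner H f g = 0}"

definition dim_gt_one :: "'n fn_space \<Rightarrow> bool" where
  "dim_gt_one H \<longleftrightarrow> (\<exists>f\<in>hcarrier H. \<exists>g\<in>hcarrier H.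
     \<forall>c d. (\<lambda>z. c * f z + d * g z) = (\<lambda>z. 0) \<longrightarrow> c = 0 \<and> d = 0)"

definition proj_onto :: "'n fn_space \<Rightarrow> 'n fn set \<Rightarrow> 'n fn \<Rightarrow> 'n fn" where
  "proj_onto H K f = (THE g. g \<in> K \<and> (\<forall>h\<in>K. hinner H (\<lambda>z. f z - g z) h = 0))"

definition compression :: "('n::finite) fn_space \<Rightarrow> 'n fn set \<Rightarrow> 'n fn \<Rightarrow> 'n fn_op" where
  "compression H I \<psi> = (\<lambda>f\<in>hcarrier (quotient_space H I).
     proj_onto H (hcarrier (quotient_space H I)) (mult_op H \<psi> f))"

text \<open>
  An operator algebra is recorded as a unital algebra together with its norms on \<open>n \<times> n\<close> matrices;
  only the entries with indices below \<open>n\<close> of a matrix matter.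
\<close>

record 'a op_alg =
  acarrier :: "'a set"
  aplus :: "'a \<Rightarrow> 'a \<Rightarrow> 'a"
  ascale :: "complex \<Rightarrow> 'a \<Rightarrow> 'a"
  atimes :: "'a \<Rightarrow> 'a \<Rightarrow> 'a"
  aone :: "'a"
  amat_norm :: "nat \<Rightarrow> (nat \<Rightarrow> nat \<Rightarrow> 'a) \<Rightarrow> real"

definition mat_carrier :: "'a op_alg \<Rightarrow> nat \<Rightarrow> (nat \<Rightarrow> nat \<Rightarrow> 'a) set" where
  "mat_carrier A n = {B. \<forall>i<n. \<forall>j<n. B i j \<in> acarrier A}"

definition completely_isometrically_isomorphic :: "'a op_alg \<Rightarrow> 'b op_alg \<Rightarrow> bool" where
  "completely_isometrically_isomorphic A B \<longleftrightarrow>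
     (\<exists>\<Phi>. bij_betw \<Phi> (acarrier A) (acarrier B) \<and>
        (\<forall>x\<in>acarrier A. \<forall>y\<in>acarrier A. \<Phi> (aplus A x y) = aplus B (\<Phi> x) (\<Phi> y)) \<and>
        (\<forall>c. \<forall>x\<in>acarrier A. \<Phi> (ascale A c x) = ascale B c (\<Phi> x)) \<and>
        (\<forall>x\<in>acarrier A. \<forall>y\<in>acarrier A. \<Phi> (atimes A x y) = atimes B (\<Phi> x) (\<Phi> y)) \<and>
        \<Phi> (aone A) = aone B \<and>
        (\<forall>n\<ge>1. \<forall>X\<in>mat_carrier A n. amat_norm B n (\<lambda>i j. \<Phi> (X i j)) = amat_norm A n X))"

definition character_space :: "'a op_alg \<Rightarrow> ('a \<Rightarrow> complex) set" where
  "character_space A = {\<tau> \<in> extensional (acarrier A).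
     (\<forall>x\<in>acarrier A. \<forall>y\<in>acarrier A. \<tau> (aplus A x y) = \<tau> x + \<tau> y) \<and>
     (\<forall>c. \<forall>x\<in>acarrier A. \<tau> (ascale A c x) = c * \<tau> x) \<and>
     (\<forall>x\<in>acarrier A. \<forall>y\<in>acarrier A. \<tau> (atimes A x y) = \<tau> x * \<tau> y) \<and>
     \<tau> (aone A) = 1}"

definition gelfand :: "'a op_alg \<Rightarrow> 'a \<Rightarrow> ('a \<Rightarrow> complex) \<Rightarrow> complex" where
  "gelfand A x = (\<lambda>\<tau>\<in>character_space A. \<tau> x)"

definition cmat_norm :: "nat \<Rightarrow> (nat \<Rightarrow> nat \<Rightarrow> complex) \<Rightarrow> real" where
  "cmat_norm n M = Sup {sqrt (\<Sum>i<n. (cmod (\<Sum>j<n. M i j * v j))\<^sup>2) | v.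
     (\<Sum>j<n. (cmod (v j))\<^sup>2) \<le> 1}"

text \<open>
  The two clauses say that \<open>amat_norm A n X\<close> is the maximum (attained) of the norms of the matrices
  \<open>[\<tau>(x\<^sub>i\<^sub>j)]\<close> over the character space.
\<close>

definition gelfand_completely_isometric :: "'a op_alg \<Rightarrow> bool" where
  "gelfand_completely_isometric A \<longleftrightarrow>
     (\<forall>n\<ge>1. \<forall>X\<in>mat_carrier A n.
        (\<forall>\<tau>\<in>character_space A. cmat_norm n (\<lambda>i j. gelfand A (X i j) \<tau>) \<le> amat_norm A n X) \<and>
        (\<exists>\<tau>\<in>character_space A. cmat_norm n (\<lambda>i j. gelfand A (X i j) \<tau>) = amat_norm A n X))"

definition quotient_alg :: "('n::finite) fn_space \<Rightarrow> 'n fn set \<Rightarrow> 'n fn_op op_alg" where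
  "quotient_alg H I = (let K = quotient_space H I in
    \<lparr>acarrier = {T \<in> bounded_ops K. \<forall>e>0. \<exists>\<phi>\<in>poly_closure H.
                    op_norm K (op_diff K T (compression H I \<phi>)) < e},
     aplus = (\<lambda>T U. \<lambda>f\<in>hcarrier K. \<lambda>z. T f z + U f z),
     ascale = (\<lambda>c T. \<lambda>f\<in>hcarrier K. \<lambda>z. c * T f z),
     atimes = (\<lambda>T U. \<lambda>f\<in>hcarrier K. T (U f)),
     aone = (\<lambda>f\<in>hcarrier K. f),
     amat_norm = op_mat_norm K\<rparr>)"

text \<open>As for the ball, functions on the closed disc are extended by zero.\<close>

definition disc_algebra :: "(complex \<Rightarrow> complex) op_alg" where
  "disc_algebra =
    \<lparr>acarrier = {f. continuous_on (cball 0 1) f \<and> f holomorphic_on ball 0 1 \<and>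
                    (\<forall>z. z \<notin> cball 0 1 \<longrightarrow> f z = 0)},
     aplus = (\<lambda>f g z. f z + g z),
     ascale = (\<lambda>c f z. c * f z),
     atimes = (\<lambda>f g z. f z * g z),
     aone = (\<lambda>z. if z \<in> cball 0 1 then 1 else 0),
     amat_norm = (\<lambda>n F. SUP z\<in>cball 0 1. cmat_norm n (\<lambda>i j. F i j z))\<rparr>"

end

theory Submission
  imports Defs "HOL-Complex_Analysis.Complex_Analysis"
begin

text \<open>
  Suppose the Gelfand transform is completely isometric.  Then rows and columns over the algebra
  have equal norms.  The identity \<open>k (1 - \<Sum>n. b n \<langle>z,w\<rangle> ^ n) = 1\<close> makes suitable rows of multiplication
  operators contractive; so the corresponding columns of compressions are contractive, and applying
  such a column to the constant function \<open>1\<close> gives numerical constraints.  For two orthonormal linear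
  forms that are not annihilated by the ideal the constraint would be \<open>2 * b 1 / a 1 \<le> 1\<close>, which is
  impossible since \<open>b 1 = a 1\<close>; hence only one linear form \<open>\<langle>z,\<zeta>\<rangle>\<close> survives.  Its compression \<open>u\<close> is not
  nilpotent, so all its powers survive, and the constraint becomes \<open>(\<Sum>n. b n / a n) \<le> 1\<close>.  As the first
  term is \<open>1\<close>, all other \<open>b n\<close> vanish and maximality gives \<open>b 1 = 1\<close>.  Thus \<open>u\<close> is a contraction, the
  characters are the points of the closed disc, and the Gelfand transform itself identifies the
  algebra with the disc algebra.
\<close>

section \<open>Hilbert spaces of functions\<close>

text \<open>A character turns an operator row into a row of scalars, and transposing a scalar row
  keeps its norm; for multiplication operators on \<open>H\<close> a contractive row gives no
  contractive column, and the argument lives on this asymmetry. The constant function is the test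
  vector because a power of a surviving linear form lies in the quotient: the projection leaves it
  untouched and its squared norm is exactly \<open>1 / a n\<close>. Nilpotency is excluded because
  every character kills a nilpotent \<open>u\<close>, so the isometry would force
  \<open>u = 0\<close>, while \<open>u\<close> maps 1 to a nonzero linear form. It follows that the
  generators vanish on the line through \<zeta>, so the quotient contains the kernel functions at
  the points \<mu> \<zeta> of a disc. They are joint eigenvectors of the adjoints and give every
  operator a symbol on that disc. Contractivity of \<open>u\<close> confines the characters to the
  closed disc, and the Gelfand hypothesis, read backwards, turns sup norm estimates there into
  operator norm estimates: hence injectivity and surjectivity.\<close>

lemma eq_0_of_small_multiples:
  fixes x :: complex
  assumes "\<And>e. e > 0 \<Longrightarrow> cmod x \<le> e * M"
  shows "x = 0"
proof -
  have "(\<lambda>n. inverse (real (Suc n)) * M) \<longlonglongrightarrow> 0 * M"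
    by (intro tendsto_mult LIMSEQ_inverse_real_of_nat tendsto_const)
  hence "cmod x \<le> 0 * M" by (rule LIMSEQ_le_const) (use assms in auto)
  thus ?thesis by simp
qed

text \<open>The locale is instantiated twice, for \<open>H\<close> and for the quotient space
  \<open>Q\<close>, which has the same inner product on a smaller carrier.\<close>

locale fn_hilbert =
  fixes H :: "('n::finite) fn_space"
  assumes hilb: "hilbert_fn_space H"
begin

abbreviation "V \<equiv> hcarrier H"
abbreviation "ip \<equiv> hinner H"
abbreviation "nm \<equiv> hnorm H"

lemmas hilbert_facts = hilb[unfolded hilbert_fn_space_def]

lemma supported: "f \<in> V \<Longrightarrow> z \<notin> ball 0 1 \<Longrightarrow> f z = 0"
  using hilbert_facts unfolding supported_on_ball_def by blast

lemma zero_mem [simp, intro]: "(\<lambda>z. 0) \<in> V"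
  using hilbert_facts by blast

lemma add_mem [simp, intro]: "f \<in> V \<Longrightarrow> g \<in> V \<Longrightarrow> (\<lambda>z. f z + g z) \<in> V"
  using hilbert_facts by blast

lemma scale_mem [simp, intro]: "f \<in> V \<Longrightarrow> (\<lambda>z. c * f z) \<in> V"
  using hilbert_facts by blast

lemma diff_mem [simp, intro]: "f \<in> V \<Longrightarrow> g \<in> V \<Longrightarrow> (\<lambda>z. f z - g z) \<in> V"
  using add_mem[of f "\<lambda>z. (-1) * g z"] scale_mem[of g "-1"] by simp

lemma sum_mem [simp, intro]: "(\<And>i. i \<in> A \<Longrightarrow> f i \<in> V) \<Longrightarrow> (\<lambda>z. \<Sum>i\<in>A. f i z) \<in> V"
  by (induction A rule: infinite_finite_induct) auto

lemma ip_add_left: "f \<in> V \<Longrightarrow> g \<in> V \<Longrightarrow> h \<in> V \<Longrightarrow> ip (\<lambda>z. f z + g z) h = ip f h + ip g h"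
  using hilbert_facts by blast

lemma ip_scale_left: "f \<in> V \<Longrightarrow> g \<in> V \<Longrightarrow> ip (\<lambda>z. c * f z) g = c * ip f g"
  using hilbert_facts by blast

lemma ip_cnj: "f \<in> V \<Longrightarrow> g \<in> V \<Longrightarrow> cnj (ip f g) = ip g f"
  using hilbert_facts by metis

lemma ip_add_right: "f \<in> V \<Longrightarrow> g \<in> V \<Longrightarrow> h \<in> V \<Longrightarrow> ip h (\<lambda>z. f z + g z) = ip h f + ip h g"
  by (simp add: ip_add_left ip_cnj flip: ip_cnj[of "\<lambda>z. f z + g z" h])

lemma ip_scale_right: "f \<in> V \<Longrightarrow> g \<in> V \<Longrightarrow> ip g (\<lambda>z. c * f z) = cnj c * ip g f"
  by (simp add: ip_scale_left ip_cnj flip: ip_cnj[of "\<lambda>z. c * f z" g])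

lemma ip_zero_left [simp]: "f \<in> V \<Longrightarrow> ip (\<lambda>z. 0) f = 0"
  using ip_scale_left[of f f 0] by simp

lemma ip_zero_right [simp]: "f \<in> V \<Longrightarrow> ip f (\<lambda>z. 0) = 0"
  using ip_scale_right[of f f 0] by simp

lemma ip_diff_left: "f \<in> V \<Longrightarrow> g \<in> V \<Longrightarrow> h \<in> V \<Longrightarrow> ip (\<lambda>z. f z - g z) h = ip f h - ip g h"
  using ip_add_left[of f "\<lambda>z. (-1) * g z" h] ip_scale_left[of g h "-1"] scale_mem[of g "-1"] by simp

lemma ip_diff_right: "f \<in> V \<Longrightarrow> g \<in> V \<Longrightarrow> h \<in> V \<Longrightarrow> ip h (\<lambda>z. f z - g z) = ip h f - ip h g"
  using ip_add_right[of f "\<lambda>z. (-1) * g z" h] ip_scale_right[of g h "-1"] scale_mem[of g "-1"] by simp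

lemma ip_sum_left:
  "(\<And>i. i \<in> A \<Longrightarrow> f i \<in> V) \<Longrightarrow> g \<in> V \<Longrightarrow> ip (\<lambda>z. \<Sum>i\<in>A. f i z) g = (\<Sum>i\<in>A. ip (f i) g)"
  by (induction A rule: infinite_finite_induct) (auto simp: ip_add_left)

lemma ip_sum_right:
  "(\<And>i. i \<in> A \<Longrightarrow> f i \<in> V) \<Longrightarrow> g \<in> V \<Longrightarrow> ip g (\<lambda>z. \<Sum>i\<in>A. f i z) = (\<Sum>i\<in>A. ip g (f i))"
  by (induction A rule: infinite_finite_induct) (auto simp: ip_add_right)

lemma ip_self_nonneg: "f \<in> V \<Longrightarrow> 0 \<le> Re (ip f f)"
  using hilbert_facts by blast

lemma nm_nonneg [simp]: "f \<in> V \<Longrightarrow> 0 \<le> nm f"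
  using ip_self_nonneg by (simp add: hnorm_def)

lemma nm_sq: "f \<in> V \<Longrightarrow> (nm f)\<^sup>2 = Re (ip f f)"
  using ip_self_nonneg by (simp add: hnorm_def)

lemma ip_self: "f \<in> V \<Longrightarrow> ip f f = of_real ((nm f)\<^sup>2)"
  using ip_cnj[of f f] nm_sq[of f] by (simp add: complex_eq_iff)

lemma nm_eq_0: "f \<in> V \<Longrightarrow> nm f = 0 \<Longrightarrow> f = (\<lambda>z. 0)"
  using hilbert_facts ip_self[of f] by (metis of_real_0 zero_power2)

lemma nm_zero [simp]: "nm (\<lambda>z. 0) = 0"
  by (simp add: hnorm_def)

lemma nm_scale: "f \<in> V \<Longrightarrow> nm (\<lambda>z. c * f z) = cmod c * nm f"
proof -
  assume f: "f \<in> V"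
  have "(nm (\<lambda>z. c * f z))\<^sup>2 = Re (c * cnj c * ip f f)"
    using f by (simp add: nm_sq ip_scale_left ip_scale_right mult.assoc)
  also have "\<dots> = Re (of_real ((cmod c)\<^sup>2) * of_real ((nm f)\<^sup>2))"
    unfolding ip_self[OF f] complex_norm_square by simp
  also have "\<dots> = (cmod c * nm f)\<^sup>2" by (simp add: power_mult_distrib del: of_real_power)
  finally have "(nm (\<lambda>z. c * f z))\<^sup>2 = (cmod c * nm f)\<^sup>2" .
  thus ?thesis using f by (simp add: power2_eq_iff_nonneg)
qed

lemma nm_sq_add:
  "f \<in> V \<Longrightarrow> g \<in> V \<Longrightarrow> (nm (\<lambda>z. f z + g z))\<^sup>2 = (nm f)\<^sup>2 + 2 * Re (ip f g) + (nm g)\<^sup>2"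
  by (simp add: nm_sq ip_add_left ip_add_right flip: ip_cnj[of f g])

lemma nm_minus: "g \<in> V \<Longrightarrow> nm (\<lambda>z. - g z) = nm g"
  using nm_scale[of g "-1"] by simp

lemma nm_diff_sym: "f \<in> V \<Longrightarrow> g \<in> V \<Longrightarrow> nm (\<lambda>z. f z - g z) = nm (\<lambda>z. g z - f z)"
  using nm_scale[of "\<lambda>z. f z - g z" "-1"] by (simp add: minus_diff_eq)

lemma nm_sq_diff:
  "f \<in> V \<Longrightarrow> g \<in> V \<Longrightarrow> (nm (\<lambda>z. f z - g z))\<^sup>2 = (nm f)\<^sup>2 - 2 * Re (ip f g) + (nm g)\<^sup>2"
  by (simp add: nm_sq ip_diff_left ip_diff_right flip: ip_cnj[of f g])

lemma cauchy_schwarz: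
  assumes "f \<in> V" "g \<in> V"
  shows "cmod (ip f g) \<le> nm f * nm g"
proof (cases "nm g = 0")
  case True
  thus ?thesis using nm_eq_0[OF assms(2)] assms by simp
next
  case False
  \<comment> \<open>\<open>c * g\<close> is the orthogonal projection of \<open>f\<close> onto the
    line of \<open>g\<close>.\<close>
  define c where "c = ip f g / of_real ((nm g)\<^sup>2)"
  have g0: "(nm g)\<^sup>2 > 0" using False by simp
  have cc: "cmod c = cmod (ip f g) / (nm g)\<^sup>2" by (simp add: c_def norm_divide norm_power)
  have cg: "(\<lambda>z. c * g z) \<in> V" using assms by simp
  have "0 \<le> (nm (\<lambda>z. f z - c * g z))\<^sup>2" by simp
  also have "\<dots> = (nm f)\<^sup>2 - 2 * Re (cnj c * ip f g) + (cmod c)\<^sup>2 * (nm g)\<^sup>2"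
    using nm_sq_diff[OF assms(1) cg] assms by (simp add: ip_scale_right nm_scale power_mult_distrib)
  also have "cnj c * ip f g = of_real ((cmod (ip f g))\<^sup>2 / (nm g)\<^sup>2)"
    unfolding of_real_divide complex_norm_square by (simp add: c_def mult.commute)
  also have "(cmod c)\<^sup>2 * (nm g)\<^sup>2 = (cmod (ip f g))\<^sup>2 / (nm g)\<^sup>2"
    using g0 by (simp add: cc power2_eq_square field_simps)
  finally have "(cmod (ip f g))\<^sup>2 / (nm g)\<^sup>2 \<le> (nm f)\<^sup>2" by simp
  hence "(cmod (ip f g))\<^sup>2 \<le> (nm f * nm g)\<^sup>2" using g0 by (simp add: pos_divide_le_eq power_mult_distrib)
  thus ?thesis by (rule power2_le_imp_le) (use assms in auto)
qed

lemma nm_triangle: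
  assumes "f \<in> V" "g \<in> V"
  shows "nm (\<lambda>z. f z + g z) \<le> nm f + nm g"
proof -
  have "Re (ip f g) \<le> nm f * nm g"
    using cauchy_schwarz[OF assms] complex_Re_le_cmod[of "ip f g"] by linarith
  hence "(nm (\<lambda>z. f z + g z))\<^sup>2 \<le> (nm f + nm g)\<^sup>2"
    using nm_sq_add[OF assms] by (simp add: power2_sum)
  thus ?thesis by (rule power2_le_imp_le) (use assms in auto)
qed

lemma nm_triangle_diff:
  assumes "f \<in> V" "g \<in> V"
  shows "nm (\<lambda>z. f z - g z) \<le> nm f + nm g"
  using nm_triangle[of f "\<lambda>z. - g z"] assms nm_minus[of g] scale_mem[of g "-1"] by simp

lemma nm_triangle3:
  assumes "f \<in> V" "g \<in> V" "h \<in> V"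
  shows "nm (\<lambda>z. f z - h z) \<le> nm (\<lambda>z. f z - g z) + nm (\<lambda>z. g z - h z)"
  using nm_triangle[of "\<lambda>z. f z - g z" "\<lambda>z. g z - h z"] assms by simp

lemma nm_sum_le: "(\<And>i. i \<in> A \<Longrightarrow> f i \<in> V) \<Longrightarrow> nm (\<lambda>z. \<Sum>i\<in>A. f i z) \<le> (\<Sum>i\<in>A. nm (f i))"
proof (induction A rule: infinite_finite_induct)
  case (insert x F)
  have "nm (\<lambda>z. f x z + (\<Sum>i\<in>F. f i z)) \<le> nm (f x) + nm (\<lambda>z. \<Sum>i\<in>F. f i z)"
    using insert.prems by (intro nm_triangle) auto
  thus ?case using insert by auto
qed auto

lemma complete:
  assumes "\<And>n. f n \<in> V" "\<And>e. e > 0 \<Longrightarrow> \<exists>N. \<forall>m\<ge>N. \<forall>n\<ge>N. nm (\<lambda>z. f m z - f n z) < e"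
  obtains g where "g \<in> V" "(\<lambda>n. nm (\<lambda>z. f n z - g z)) \<longlonglongrightarrow> 0"
proof -
  have "\<exists>g\<in>V. (\<lambda>n. nm (\<lambda>z. f n z - g z)) \<longlonglongrightarrow> 0"
    using hilbert_facts assms by blast
  thus ?thesis using that by blast
qed

lemma ip_tendsto:
  assumes "\<And>n. f n \<in> V" "g \<in> V" "h \<in> V" "(\<lambda>n. nm (\<lambda>z. f n z - g z)) \<longlonglongrightarrow> 0"
  shows "(\<lambda>n. ip (f n) h) \<longlonglongrightarrow> ip g h"
proof -
  have "(\<lambda>n. ip (f n) h - ip g h) \<longlonglongrightarrow> 0"
  proof (rule Lim_null_comparison)
    show "\<forall>\<^sub>F n in sequentially. cmod (ip (f n) h - ip g h) \<le> nm (\<lambda>z. f n z - g z) * nm h"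
      using cauchy_schwarz[of "\<lambda>z. f _ z - g z" h] assms by (simp add: ip_diff_left)
    show "(\<lambda>n. nm (\<lambda>z. f n z - g z) * nm h) \<longlonglongrightarrow> 0"
      using tendsto_mult_left_zero[OF assms(4)] by simp
  qed
  thus ?thesis using LIM_zero_iff by blast
qed

lemma nm_tendsto:
  assumes "\<And>n. f n \<in> V" "g \<in> V" "(\<lambda>n. nm (\<lambda>z. f n z - g z)) \<longlonglongrightarrow> 0"
  shows "(\<lambda>n. nm (f n)) \<longlonglongrightarrow> nm g"
proof -
  have "(\<lambda>n. nm (f n) - nm g) \<longlonglongrightarrow> 0"
  proof (rule Lim_null_comparison[OF _ assms(3)])
    have "\<bar>nm (f n) - nm g\<bar> \<le> nm (\<lambda>z. f n z - g z)" for n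
      using nm_triangle[of "\<lambda>z. f n z - g z" g] nm_triangle[of "\<lambda>z. g z - f n z" "f n"]
        nm_diff_sym[of "f n" g] assms(1)[of n] assms(2) by simp
    thus "\<forall>\<^sub>F n in sequentially. norm (nm (f n) - nm g) \<le> nm (\<lambda>z. f n z - g z)" by simp
  qed
  thus ?thesis using LIM_zero_iff by blast
qed

text \<open>The functional is given by its graph, which is a linear relation: that the relation is
  single-valued follows from the bound.\<close>

lemma riesz_relation:
  fixes R :: "('n fn \<times> complex) set"
  assumes ne: "R \<noteq> {}" and R: "\<And>x s. (x,s) \<in> R \<Longrightarrow> x \<in> V"
    and add: "\<And>x s y t. (x,s) \<in> R \<Longrightarrow> (y,t) \<in> R \<Longrightarrow> (\<lambda>z. x z + y z, s + t) \<in> R"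
    and scale: "\<And>x s c. (x,s) \<in> R \<Longrightarrow> (\<lambda>z. c * x z, c * s) \<in> R"
    and bound: "\<And>x s. (x,s) \<in> R \<Longrightarrow> cmod s \<le> C * nm x" and C: "0 \<le> C"
  obtains g where "g \<in> V" "nm g \<le> C" "\<And>x s. (x,s) \<in> R \<Longrightarrow> s = ip x g"
proof -
  \<comment> \<open>If \<open>s = ip x g\<close>, then \<open>J\<close> is the squared distance from
    \<open>x\<close> to \<open>g\<close> up to a constant, so a minimizing sequence is the way to
    find \<open>g\<close>.\<close>
  define J where "J = (\<lambda>(x,s). (nm x)\<^sup>2 - 2 * Re s)"
  define m where "m = Inf (J ` R)"
  have Jlow: "- C\<^sup>2 \<le> J r" if "r \<in> R" for r
  proof -
    obtain x s where r: "r = (x,s)" by force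
    have "Re s \<le> C * nm x" using bound[of x s] complex_Re_le_cmod[of s] that r by force
    moreover have "0 \<le> (nm x - C)\<^sup>2" by simp
    ultimately show ?thesis unfolding J_def r by (simp add: power2_diff mult.commute)
  qed
  have bdd: "bdd_below (J ` R)" using Jlow by (meson bdd_belowI2)
  have mle: "m \<le> J r" if "r \<in> R" for r
    unfolding m_def using bdd that by (simp add: cInf_lower)
  have "\<exists>r\<in>R. J r < m + 1 / real (Suc n)" for n
  proof -
    have "Inf (J ` R) < m + 1 / real (Suc n)" by (simp add: m_def)
    thus ?thesis using cInf_lessD[of "J ` R"] ne by blast
  qed
  then obtain r where r: "\<And>n. r n \<in> R" "\<And>n. J (r n) < m + 1 / real (Suc n)" by metis
  define X where "X n = fst (r n)" for n
  define S where "S n = snd (r n)" for n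
  have XS: "(X n, S n) \<in> R" for n using r(1)[of n] by (simp add: X_def S_def)
  have XV: "X n \<in> V" for n using XS R by blast
  have JX: "J (X n, S n) < m + 1 / real (Suc n)" for n using r(2)[of n] by (simp add: X_def S_def)
  \<comment> \<open>Parallelogram law at the midpoint, where \<open>J\<close> is at least
    \<open>m\<close>: two nearly minimal elements are close to each other.\<close>
  have par: "(nm (\<lambda>z. x z - y z))\<^sup>2 \<le> 2 * (J (x,s) - m) + 2 * (J (y,t) - m)"
    if "(x,s) \<in> R" "(y,t) \<in> R" for x s y t
  proof -
    have V: "x \<in> V" "y \<in> V" using that R by auto
    have "(\<lambda>z. (1/2) * (x z + y z), (1/2) * (s + t)) \<in> R" using scale[OF add[OF that]] .
    hence "m \<le> J (\<lambda>z. (1/2) * (x z + y z), (1/2) * (s + t))" by (rule mle)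
    also have "\<dots> = (nm (\<lambda>z. x z + y z))\<^sup>2 / 4 - Re (s + t)"
      unfolding J_def prod.case nm_scale[OF add_mem[OF V]] by (simp add: power2_eq_square field_simps)
    finally show ?thesis using nm_sq_add[OF V] nm_sq_diff[OF V] unfolding J_def by (simp add: field_simps)
  qed
  have Cauchy: "\<exists>N. \<forall>p\<ge>N. \<forall>q\<ge>N. nm (\<lambda>z. X p z - X q z) < e" if "e > 0" for e
  proof -
    obtain N where N: "1 / real (Suc N) < e\<^sup>2 / 4"
      using reals_Archimedean[of "e\<^sup>2/4"] \<open>e > 0\<close> by (auto simp: inverse_eq_divide)
    have "nm (\<lambda>z. X p z - X q z) < e" if "p \<ge> N" "q \<ge> N" for p q
    proof -
      have le: "1 / real (Suc n) \<le> 1 / real (Suc N)" if "n \<ge> N" for n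
        using that by (auto simp: field_simps)
      have J: "J (X n, S n) - m < 1 / real (Suc N)" if "n \<ge> N" for n
        using JX[of n] le[OF that] by linarith
      have "(nm (\<lambda>z. X p z - X q z))\<^sup>2 < e\<^sup>2"
        using par[OF XS[of p] XS[of q]] J[OF \<open>p \<ge> N\<close>] J[OF \<open>q \<ge> N\<close>] N by argo
      thus ?thesis using \<open>e > 0\<close> power2_less_imp_less by fastforce
    qed
    thus ?thesis by blast
  qed
  obtain g where g: "g \<in> V" and lim: "(\<lambda>n. nm (\<lambda>z. X n z - g z)) \<longlonglongrightarrow> 0"
    using complete[OF XV Cauchy] by blast
  have rep: "t = ip y g" if yt: "(y,t) \<in> R" for y t
  proof -
    have y: "y \<in> V" using yt R by blast
    define B where "B = (nm y)\<^sup>2"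
    define d where "d = ip y g - t"
    \<comment> \<open>First variation: moving \<open>X n\<close> by \<open>c * y\<close> cannot
      bring \<open>J\<close> below \<open>m\<close>; then \<open>n\<close> tends to
      infinity.\<close>
    have var: "0 \<le> 2 * Re (c * d) + (cmod c)\<^sup>2 * B" for c
    proof -
      have ineq: "- 1 / real (Suc n) \<le> 2 * Re (cnj c * ip (X n) y) - 2 * Re (c * t) + (cmod c)\<^sup>2 * B" for n
      proof -
        have "m \<le> J (\<lambda>z. X n z + c * y z, S n + c * t)"
          by (intro mle add scale XS yt)
        also have "\<dots> = J (X n, S n) + 2 * Re (cnj c * ip (X n) y) - 2 * Re (c * t) + (cmod c)\<^sup>2 * B"
          using y XV[of n] by (simp add: J_def nm_sq_add nm_scale ip_scale_right power_mult_distrib B_def)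
        finally show ?thesis using JX[of n] by simp
      qed
      have l: "(\<lambda>n. 2 * Re (cnj c * ip (X n) y) - 2 * Re (c * t) + (cmod c)\<^sup>2 * B)
         \<longlonglongrightarrow> 2 * Re (cnj c * ip g y) - 2 * Re (c * t) + (cmod c)\<^sup>2 * B"
        by (intro tendsto_intros ip_tendsto XV g y lim)
      have l0: "(\<lambda>n. - 1 / real (Suc n)) \<longlonglongrightarrow> 0"
        using LIMSEQ_inverse_real_of_nat_add_minus[of 0] by (simp add: inverse_eq_divide)
      have "0 \<le> 2 * Re (cnj c * ip g y) - 2 * Re (c * t) + (cmod c)\<^sup>2 * B"
        using LIMSEQ_le[OF l0 l] ineq by auto
      moreover have "Re (cnj c * ip g y) = Re (c * ip y g)"
        using ip_cnj[OF y g] by (metis complex_cnj_cnj complex_cnj_mult cnj.sel(1))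
      ultimately show ?thesis unfolding d_def by (simp add: algebra_simps)
    qed
    have B0: "B \<ge> 0" by (simp add: B_def)
    \<comment> \<open>This step length keeps the quadratic term of the variation below the linear
      one; the direction \<open>cnj d\<close> with negative sign then forces
      \<open>d = 0\<close>.\<close>
    define e where "e = 1 / (B + 1)"
    have e: "e > 0" "e * B < 1" using B0 by (auto simp: e_def field_simps)
    have "cnj d * d = of_real ((cmod d)\<^sup>2)"
      using complex_norm_square[of d] by (simp add: mult.commute)
    hence "0 \<le> - 2 * e * (cmod d)\<^sup>2 + e\<^sup>2 * (cmod d)\<^sup>2 * B"
      using var[of "- of_real e * cnj d"] e by (simp add: norm_mult power_mult_distrib mult.assoc del: of_real_power)
    also have "\<dots> = e * (cmod d)\<^sup>2 * (e * B - 2)" by (simp add: power2_eq_square algebra_simps)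
    finally have "(cmod d)\<^sup>2 = 0" using e by (auto simp: zero_le_mult_iff mult_le_0_iff)
    thus ?thesis by (simp add: d_def)
  qed
  \<comment> \<open>\<open>g\<close> need not belong to the domain of \<open>R\<close>, so the bound
    is used along the minimizing sequence and passed to the limit.\<close>
  have "(\<lambda>n. cmod (ip (X n) g)) \<longlonglongrightarrow> cmod (ip g g)"
    by (intro tendsto_intros ip_tendsto XV g lim)
  moreover have "(\<lambda>n. C * nm (X n)) \<longlonglongrightarrow> C * nm g"
    by (intro tendsto_intros nm_tendsto XV g lim)
  moreover have "cmod (ip (X n) g) \<le> C * nm (X n)" for n
    using rep[OF XS[of n]] bound[OF XS[of n]] by simp
  ultimately have "cmod (ip g g) \<le> C * nm g" using LIMSEQ_le by blast
  hence "nm g * nm g \<le> C * nm g" using g by (simp add: ip_self power2_eq_square norm_mult)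
  hence "nm g \<le> C" using nm_nonneg[OF g] C by (metis linorder_not_le mult_le_cancel_right order_le_less)
  thus ?thesis using that g rep by blast
qed

lemma riesz:
  assumes "\<And>x y. x \<in> V \<Longrightarrow> y \<in> V \<Longrightarrow> L (\<lambda>z. x z + y z) = L x + L y"
    and "\<And>x c. x \<in> V \<Longrightarrow> L (\<lambda>z. c * x z) = c * L x"
    and "\<And>x. x \<in> V \<Longrightarrow> cmod (L x) \<le> C * nm x" "0 \<le> C"
  obtains g where "g \<in> V" "nm g \<le> C" "\<And>x. x \<in> V \<Longrightarrow> L x = ip x g"
proof -
  obtain g where "g \<in> V" "nm g \<le> C" "\<And>x s. (x,s) \<in> {(x, L x) | x. x \<in> V} \<Longrightarrow> s = ip x g"
    by (rule riesz_relation[of "{(x, L x) | x. x \<in> V}" C]) (use assms in auto)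
  thus ?thesis using that by blast
qed

lemma summable_series:
  assumes f: "\<And>n. f n \<in> V" and s: "summable (\<lambda>n. nm (f n))"
  obtains g where "g \<in> V" "(\<lambda>N. nm (\<lambda>z. (\<Sum>n<N. f n z) - g z)) \<longlonglongrightarrow> 0"
proof (rule complete[of "\<lambda>N z. \<Sum>n<N. f n z"])
  show "\<And>n. (\<lambda>z. \<Sum>n<n. f n z) \<in> V" using f by auto
  fix e :: real assume e: "e > 0"
  obtain N where N: "\<And>m n. m \<ge> N \<Longrightarrow> norm (sum (\<lambda>n. nm (f n)) {m..<n}) < e"
    using s e unfolding summable_Cauchy by blast
  have *: "nm (\<lambda>z. (\<Sum>i<q. f i z) - (\<Sum>i<p. f i z)) < e" if "N \<le> p" "p \<le> q" for p q
  proof -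
    have "(\<lambda>z. (\<Sum>i<q. f i z) - (\<Sum>i<p. f i z)) = (\<lambda>z. \<Sum>i\<in>{p..<q}. f i z)"
      using sum_diff_nat_ivl[of 0 p q "\<lambda>i. f i _"] that by (simp add: lessThan_atLeast0)
    hence "nm (\<lambda>z. (\<Sum>i<q. f i z) - (\<Sum>i<p. f i z)) \<le> (\<Sum>i\<in>{p..<q}. nm (f i))"
      using nm_sum_le[of "{p..<q}" f] f by simp
    thus ?thesis using N[of p q] that by simp
  qed
  have "nm (\<lambda>z. (\<Sum>i<m. f i z) - (\<Sum>i<n. f i z)) < e" if "N \<le> m" "N \<le> n" for m n
  proof (cases "n \<le> m")
    case False
    thus ?thesis using *[of m n] that nm_diff_sym[of "\<lambda>z. \<Sum>i<m. f i z" "\<lambda>z. \<Sum>i<n. f i z"] f by auto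
  qed (use * that in auto)
  thus "\<exists>N. \<forall>m\<ge>N. \<forall>n\<ge>N. nm (\<lambda>z. (\<Sum>i<m. f i z) - (\<Sum>i<n. f i z)) < e" by blast
qed (use that in blast)

end

lemma hsub_simps [simp]: "hcarrier (hsub H K) = K" "hinner (hsub H K) = hinner H" "hnorm (hsub H K) = hnorm H"
  by (auto simp: hsub_def hnorm_def fun_eq_iff)

lemma (in fn_hilbert) hilbert_annihilator:
  assumes "A \<subseteq> V"
  shows "hilbert_fn_space (hsub H {f \<in> V. \<forall>g\<in>A. ip f g = 0})" (is "hilbert_fn_space (hsub H ?K)")
proof -
  have compl: "\<exists>g\<in>?K. (\<lambda>n. nm (\<lambda>z. f n z - g z)) \<longlonglongrightarrow> 0"
    if f: "\<And>n. f n \<in> ?K" and c: "\<forall>e>0. \<exists>N. \<forall>m\<ge>N. \<forall>n\<ge>N. nm (\<lambda>z. f m z - f n z) < e" for f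
  proof -
    obtain g where g: "g \<in> V" "(\<lambda>n. nm (\<lambda>z. f n z - g z)) \<longlonglongrightarrow> 0"
      using complete[of f] f c by auto
    have "ip g h = 0" if "h \<in> A" for h
    proof -
      have "(\<lambda>n. ip (f n) h) \<longlonglongrightarrow> ip g h" using ip_tendsto[of f g h] f g that assms by auto
      moreover have "(\<lambda>n. ip (f n) h) = (\<lambda>n. 0)" using f that by auto
      ultimately show ?thesis using LIMSEQ_unique tendsto_const by metis
    qed
    thus ?thesis using g by auto
  qed
  have "supported_on_ball f" if "f \<in> V" for f using supported that by (auto simp: supported_on_ball_def)
  moreover have "hinner H f f = 0 \<longrightarrow> f = (\<lambda>z. 0)" if "f \<in> V" for f
    using nm_eq_0[of f] that by (simp add: hnorm_def)
  moreover have "g \<in> V" if "g \<in> A" for g using that assms by blast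
  ultimately show ?thesis
    unfolding hilbert_fn_space_def hsub_simps
    by (intro conjI ballI allI impI compl)
      (simp_all add: ip_add_left ip_scale_left ip_cnj flip: nm_sq)
qed

section \<open>Positive kernels and reproducing kernel spaces\<close>

text \<open>Only real parts are compared, so that Hermitian symmetry never has to be tracked.\<close>

definition psd :: "(complex ^ 'n \<Rightarrow> complex ^ 'n \<Rightarrow> complex) \<Rightarrow> bool" where
  "psd K \<longleftrightarrow> (\<forall>S c. finite S \<longrightarrow> S \<subseteq> ball 0 1 \<longrightarrow> 0 \<le> Re (\<Sum>z\<in>S. \<Sum>w\<in>S. c z * cnj (c w) * K z w))"

text \<open>Positivity of an entrywise factor, encoded by its action on positive kernels. Closure
  under sums and products is then immediate, and rank one factors are handled by congruence.\<close>

definition psd_mult :: "(complex ^ 'n \<Rightarrow> complex ^ 'n \<Rightarrow> complex) \<Rightarrow> bool" where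
  "psd_mult A \<longleftrightarrow> (\<forall>K. psd K \<longrightarrow> psd (\<lambda>z w. A z w * K z w))"

lemma psdD: "psd K \<Longrightarrow> finite S \<Longrightarrow> S \<subseteq> ball 0 1 \<Longrightarrow> 0 \<le> Re (\<Sum>z\<in>S. \<Sum>w\<in>S. c z * cnj (c w) * K z w)"
  by (simp add: psd_def)

lemma psd_cong:
  fixes K L :: "complex ^ 'n \<Rightarrow> complex ^ 'n \<Rightarrow> complex"
  assumes "psd L" "\<And>z w. z \<in> ball 0 1 \<Longrightarrow> w \<in> ball 0 1 \<Longrightarrow> K z w = L z w"
  shows "psd K"
  unfolding psd_def
proof (intro allI impI)
  fix S c assume S: "finite S" "S \<subseteq> (ball 0 1 :: (complex ^ 'n) set)"
  have "(\<Sum>z\<in>S. \<Sum>w\<in>S. c z * cnj (c w) * K z w) = (\<Sum>z\<in>S. \<Sum>w\<in>S. c z * cnj (c w) * L z w)"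
    using S assms(2) by (intro sum.cong refl) (metis subsetD)
  thus "0 \<le> Re (\<Sum>z\<in>S. \<Sum>w\<in>S. c z * cnj (c w) * K z w)" using psdD[OF assms(1) S] by simp
qed

lemma psd_add: "psd K \<Longrightarrow> psd L \<Longrightarrow> psd (\<lambda>z w. K z w + L z w)"
  unfolding psd_def by (simp only: distrib_left sum.distrib plus_complex.sel) (meson add_nonneg_nonneg)

lemma psd_zero: "psd (\<lambda>z w. 0)"
  by (simp add: psd_def)

lemma cmod_sq_eq: "(cmod x)\<^sup>2 = Re (cnj x * x)"
  by (metis Re_complex_of_real complex_norm_square mult.commute)

lemma psd_one: "psd (\<lambda>(z :: complex ^ 'n) w. 1)"
  unfolding psd_def
proof (intro allI impI)
  fix S :: "(complex ^ 'n) set" and c :: "complex ^ 'n \<Rightarrow> complex" assume S: "finite S"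
  have "(\<Sum>z\<in>S. \<Sum>w\<in>S. c z * cnj (c w) * 1) = (\<Sum>z\<in>S. c z) * cnj (\<Sum>w\<in>S. c w)"
    by (simp add: sum_product)
  thus "0 \<le> Re (\<Sum>z\<in>S. \<Sum>w\<in>S. c z * cnj (c w) * 1)"
    by (metis Re_complex_of_real complex_norm_square zero_le_power2)
qed

lemma psd_congruence:
  fixes K :: "complex ^ 'n \<Rightarrow> complex ^ 'n \<Rightarrow> complex"
  assumes "psd K" shows "psd (\<lambda>z w. f z * cnj (f w) * K z w)"
  unfolding psd_def
proof (intro allI impI)
  fix S :: "(complex ^ 'n) set" and c :: "complex ^ 'n \<Rightarrow> complex" assume S: "finite S" "S \<subseteq> ball 0 1"
  show "0 \<le> Re (\<Sum>z\<in>S. \<Sum>w\<in>S. c z * cnj (c w) * (f z * cnj (f w) * K z w))"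
    using psdD[OF assms S, of "\<lambda>z. c z * f z"] by (simp add: mult_ac)
qed

lemma psd_lim:
  fixes K :: "complex ^ 'n \<Rightarrow> complex ^ 'n \<Rightarrow> complex"
  assumes "\<And>n. psd (F n)" "\<And>z w. z \<in> ball 0 1 \<Longrightarrow> w \<in> ball 0 1 \<Longrightarrow> (\<lambda>n. F n z w) \<longlonglongrightarrow> K z w"
  shows "psd K"
  unfolding psd_def
proof (intro allI impI)
  fix S :: "(complex ^ 'n) set" and c :: "complex ^ 'n \<Rightarrow> complex" assume S: "finite S" "S \<subseteq> ball 0 1"
  have "(\<lambda>n. Re (\<Sum>z\<in>S. \<Sum>w\<in>S. c z * cnj (c w) * F n z w)) \<longlonglongrightarrow> Re (\<Sum>z\<in>S. \<Sum>w\<in>S. c z * cnj (c w) * K z w)"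
    using S by (intro tendsto_intros assms(2)) auto
  thus "0 \<le> Re (\<Sum>z\<in>S. \<Sum>w\<in>S. c z * cnj (c w) * K z w)"
    by (rule LIMSEQ_le_const) (use psdD[OF assms(1) S] in auto)
qed

lemma psd_multD: "psd_mult A \<Longrightarrow> psd K \<Longrightarrow> psd (\<lambda>z w. A z w * K z w)"
  by (simp only: psd_mult_def)

lemma psd_mult_add: "psd_mult A \<Longrightarrow> psd_mult B \<Longrightarrow> psd_mult (\<lambda>z w. A z w + B z w)"
  by (simp add: psd_mult_def psd_add distrib_right)

lemma psd_mult_times: "psd_mult A \<Longrightarrow> psd_mult B \<Longrightarrow> psd_mult (\<lambda>z w. A z w * B z w)"
  by (simp add: psd_mult_def mult.assoc)

lemma psd_mult_const: "r \<ge> 0 \<Longrightarrow> psd_mult (\<lambda>(z :: complex ^ 'n) w. of_real r)"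
proof -
  assume "r \<ge> 0"
  hence "of_real r = of_real (sqrt r) * cnj (of_real (sqrt r) :: complex)"
    by (simp flip: of_real_mult)
  thus ?thesis
    unfolding psd_mult_def using psd_congruence[of _ "\<lambda>z :: complex ^ 'n. of_real (sqrt r)"] by simp
qed

lemma psd_mult_zero: "psd_mult (\<lambda>z w. 0)"
  by (simp add: psd_mult_def psd_zero)

lemma psd_mult_one: "psd_mult (\<lambda>z w. 1)"
  by (simp add: psd_mult_def)

lemma psd_mult_rank_one: "psd_mult (\<lambda>z w. f z * cnj (f w))"
  by (simp add: psd_mult_def psd_congruence)

lemma psd_mult_sum: "(\<And>i. i \<in> A \<Longrightarrow> psd_mult (F i)) \<Longrightarrow> psd_mult (\<lambda>z w. \<Sum>i\<in>A. F i z w)"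
proof (induction A rule: infinite_finite_induct)
  case (insert x A)
  thus ?case using psd_mult_add[of "F x" "\<lambda>z w. \<Sum>i\<in>A. F i z w"] by simp
qed (simp_all add: psd_mult_zero)

lemma psd_mult_power: "psd_mult A \<Longrightarrow> psd_mult (\<lambda>z w. A z w ^ n)"
  by (induction n) (simp_all add: psd_mult_times psd_mult_one)

text \<open>Telescoping by \<open>A ^ Suc n - B ^ Suc n = A ^ n * (A - B) + (A ^ n - B ^ n) *
  B\<close>. It carries the domination of a rank one kernel by \<open>vinner z w\<close> over to all
  powers.\<close>

lemma psd_mult_power_diff:
  assumes "psd_mult A" "psd_mult B" "psd_mult (\<lambda>z w. A z w - B z w)"
  shows "psd_mult (\<lambda>z w. A z w ^ n - B z w ^ n)"
proof (induction n)
  case (Suc n)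
  have "psd_mult (\<lambda>z w. A z w ^ n * (A z w - B z w) + (A z w ^ n - B z w ^ n) * B z w)"
    by (intro psd_mult_add psd_mult_times psd_mult_power assms Suc.IH)
  moreover have "(\<lambda>z w. A z w ^ n * (A z w - B z w) + (A z w ^ n - B z w ^ n) * B z w)
      = (\<lambda>z w. A z w ^ Suc n - B z w ^ Suc n)"
    by (simp add: fun_eq_iff algebra_simps)
  ultimately show ?case by simp
qed (simp add: psd_mult_def psd_zero)

lemma psd_mult_imp_psd: "psd_mult A \<Longrightarrow> psd A"
  using psd_one unfolding psd_mult_def by fastforce

section \<open>The Hermitian form on complex vectors and kernels built from it\<close>

lemma vinner_add_left: "vinner (x + y) z = vinner x z + vinner y z"
  by (simp add: vinner_def sum.distrib distrib_right)

lemma vinner_diff_left: "vinner (x - y) z = vinner x z - vinner y z"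
  by (simp add: vinner_def sum_subtractf left_diff_distrib)

lemma vinner_diff_right: "vinner z (x - y) = vinner z x - vinner z y"
  by (simp add: vinner_def sum_subtractf right_diff_distrib)

lemma vinner_add_right: "vinner z (x + y) = vinner z x + vinner z y"
  by (simp add: vinner_def sum.distrib distrib_left)

lemma vinner_scale_left: "vinner (c *s x) z = c * vinner x z"
  by (simp add: vinner_def sum_distrib_left mult_ac)

lemma vinner_scale_right: "vinner z (c *s x) = cnj c * vinner z x"
  by (simp add: vinner_def sum_distrib_left mult_ac)

lemma cnj_vinner: "cnj (vinner x y) = vinner y x"
  by (simp add: vinner_def mult_ac)

lemma vinner_self: "vinner x x = of_real ((norm x)\<^sup>2)"
  unfolding vinner_def norm_vec_def L2_set_def
  by (simp add: sum_nonneg complex_mult_cnj cmod_power2 flip: of_real_power of_real_add)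

lemma vinner_zero [simp]: "vinner 0 x = 0" "vinner x 0 = 0"
  by (simp_all add: vinner_def)

lemma vinner_axis: "vinner z (axis i 1) = z $ i" for z :: "complex ^ 'n"
  by (simp add: vinner_def axis_def if_distrib[of cnj] if_distrib[of "(*) _"] cong: if_cong)

lemma inner_eq_Re_vinner: "x \<bullet> y = Re (vinner x y)" for x y :: "complex ^ 'n"
  by (simp add: inner_vec_def vinner_def inner_complex_def)

lemma norm_vec_scale: "norm (c *s x) = cmod c * norm x" for x :: "complex ^ 'n"
proof -
  have "vinner (c *s x) (c *s x) = (c * cnj c) * vinner x x"
    by (simp add: vinner_scale_left vinner_scale_right mult_ac)
  also have "\<dots> = of_real ((cmod c * norm x)\<^sup>2)"
    unfolding vinner_self complex_norm_square[symmetric] power_mult_distrib of_real_mult ..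
  finally have "vinner (c *s x) (c *s x) = of_real ((cmod c * norm x)\<^sup>2)" .
  hence "(norm (c *s x))\<^sup>2 = (cmod c * norm x)\<^sup>2"
    unfolding vinner_self of_real_eq_iff .
  thus ?thesis by (simp add: power2_eq_iff_nonneg)
qed

text \<open>Each coordinate contributes a rank one kernel. The free map \<open>f\<close> covers both
  \<open>vinner z w\<close> itself and kernels of projected vectors.\<close>

lemma psd_mult_vinner: "psd_mult (\<lambda>z w. vinner (f z) (f w))"
  unfolding vinner_def by (intro psd_mult_sum psd_mult_rank_one)

lemma vinner_orth_part:
  assumes "vinner u u = 1"
  shows "vinner (z - vinner z u *s u) (w - vinner w u *s u) = vinner z w - vinner z u * cnj (vinner w u)"
  using assms cnj_vinner[of u w]
  by (simp add: vinner_diff_left vinner_diff_right vinner_scale_left vinner_scale_right cnj_vinner algebra_simps)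

text \<open>The difference is the inner product of the components orthogonal to
  \<open>u\<close>.\<close>

lemma psd_mult_orth_part:
  assumes "vinner u u = 1"
  shows "psd_mult (\<lambda>z w. vinner z w - vinner z u * cnj (vinner w u))"
  using psd_mult_vinner[of "\<lambda>z. z - vinner z u *s u"] by (simp add: vinner_orth_part[OF assms])

lemma psd_mult_orth_part2:
  assumes "vinner u u = 1" "vinner v v = 1" "vinner u v = 0"
  shows "psd_mult (\<lambda>z w. vinner z w - (vinner z u * cnj (vinner w u) + vinner z v * cnj (vinner w v)))"
proof -
  let ?D = "\<lambda>u z. z - vinner z u *s u"
  have "vinner (?D v (?D u z)) (?D v (?D u w))
    = vinner z w - (vinner z u * cnj (vinner w u) + vinner z v * cnj (vinner w v))" for z w
    unfolding vinner_orth_part[OF assms(2)] vinner_orth_part[OF assms(1)]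
    using assms(3) by (simp add: vinner_diff_left vinner_scale_left)
  thus ?thesis using psd_mult_vinner[of "\<lambda>z. ?D v (?D u z)"] by simp
qed

section \<open>Membership and multiplier bounds in a reproducing kernel space\<close>

locale ball_rkhs =
  fixes H :: "('n::finite) fn_space" and k
  assumes rkhs: "rkhs H k"
begin

sublocale fn_hilbert H
  using rkhs by unfold_locales (simp add: rkhs_def)

definition kf :: "complex ^ 'n \<Rightarrow> 'n fn" where "kf w = on_ball (\<lambda>z. k z w)"

lemma kf_mem [simp, intro]: "w \<in> ball 0 1 \<Longrightarrow> kf w \<in> V"
  using rkhs by (auto simp: rkhs_def kf_def)

lemma ip_kf: "w \<in> ball 0 1 \<Longrightarrow> f \<in> V \<Longrightarrow> ip f (kf w) = f w"
  using rkhs by (auto simp: rkhs_def kf_def)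

lemma kf_apply: "z \<in> ball 0 1 \<Longrightarrow> kf w z = k z w"
  by (simp add: kf_def on_ball_def)

lemma kf_comb_mem: "S \<subseteq> ball 0 1 \<Longrightarrow> (\<lambda>z. \<Sum>w\<in>S. c w * kf w z) \<in> V"
  by (intro sum_mem scale_mem kf_mem) auto

lemma ip_kf_comb: "S \<subseteq> ball 0 1 \<Longrightarrow> f \<in> V \<Longrightarrow> ip (\<lambda>z. \<Sum>w\<in>S. c w * kf w z) f = (\<Sum>w\<in>S. c w * cnj (f w))"
proof -
  assume S: "S \<subseteq> ball 0 1" and f: "f \<in> V"
  have "ip (\<lambda>z. \<Sum>w\<in>S. c w * kf w z) f = (\<Sum>w\<in>S. ip (\<lambda>z. c w * kf w z) f)"
    using S f by (intro ip_sum_left) auto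
  also have "\<dots> = (\<Sum>w\<in>S. c w * cnj (f w))"
  proof (rule sum.cong[OF refl])
    fix w assume "w \<in> S"
    hence w: "w \<in> ball 0 1" using S by blast
    show "ip (\<lambda>z. c w * kf w z) f = c w * cnj (f w)"
      using ip_scale_left[OF kf_mem[OF w] f] ip_cnj[OF f kf_mem[OF w]] ip_kf[OF w f] by metis
  qed
  finally show ?thesis .
qed

lemma nm_kf_comb:
  assumes S: "S \<subseteq> ball 0 1"
  shows "(nm (\<lambda>z. \<Sum>w\<in>S. c w * kf w z))\<^sup>2 = Re (\<Sum>z\<in>S. \<Sum>w\<in>S. cnj (c z) * c w * k z w)"
proof -
  have "ip (\<lambda>z. \<Sum>w\<in>S. c w * kf w z) (\<lambda>z. \<Sum>w\<in>S. c w * kf w z)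
      = (\<Sum>z\<in>S. c z * cnj (\<Sum>w\<in>S. c w * kf w z))"
    by (rule ip_kf_comb[OF S kf_comb_mem[OF S]])
  also have "\<dots> = cnj (\<Sum>z\<in>S. cnj (c z) * (\<Sum>w\<in>S. c w * kf w z))" by simp
  also have "(\<Sum>z\<in>S. cnj (c z) * (\<Sum>w\<in>S. c w * kf w z)) = (\<Sum>z\<in>S. \<Sum>w\<in>S. cnj (c z) * c w * k z w)"
    using S by (auto simp: sum_distrib_left mult.assoc kf_apply subset_iff intro!: sum.cong)
  finally have e: "ip (\<lambda>z. \<Sum>w\<in>S. c w * kf w z) (\<lambda>z. \<Sum>w\<in>S. c w * kf w z)
      = cnj (\<Sum>z\<in>S. \<Sum>w\<in>S. cnj (c z) * c w * k z w)" .
  show ?thesis unfolding nm_sq[OF kf_comb_mem[OF S]] e by (rule cnj.sel(1))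
qed

lemma psd_kernel: "psd k"
  unfolding psd_def
proof (intro allI impI)
  fix S c assume "finite S" and S: "S \<subseteq> (ball 0 1 :: (complex ^ 'n) set)"
  have "0 \<le> (nm (\<lambda>z. \<Sum>w\<in>S. cnj (c w) * kf w z))\<^sup>2" by simp
  also have "\<dots> = Re (\<Sum>z\<in>S. \<Sum>w\<in>S. cnj (cnj (c z)) * cnj (c w) * k z w)" by (rule nm_kf_comb[OF S])
  finally show "0 \<le> Re (\<Sum>z\<in>S. \<Sum>w\<in>S. c z * cnj (c w) * k z w)" by (simp only: complex_cnj_cnj)
qed

text \<open>The bound makes \<open>kf w \<mapsto> cnj (F w)\<close> a bounded functional on the span
  of the kernel functions, and the vector representing it takes the values of \<open>F\<close>. A
  combination may have several coefficient families, hence the relation \<open>R\<close> instead of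
  a function.\<close>

lemma mem_of_bound:
  assumes F: "\<And>z. z \<notin> ball 0 1 \<Longrightarrow> F z = 0" and C: "0 \<le> C"
    and bound: "\<And>S c. finite S \<Longrightarrow> S \<subseteq> ball 0 1 \<Longrightarrow>
      cmod (\<Sum>w\<in>S. c w * cnj (F w)) \<le> C * nm (\<lambda>z. \<Sum>w\<in>S. c w * kf w z)"
  shows "F \<in> V \<and> nm F \<le> C"
proof -
  define R where "R = {((\<lambda>z. \<Sum>w\<in>S. c w * kf w z), (\<Sum>w\<in>S. c w * cnj (F w))) | S c.
    finite S \<and> S \<subseteq> ball 0 1}"
  have RI: "((\<lambda>z. \<Sum>w\<in>S. c w * kf w z), (\<Sum>w\<in>S. c w * cnj (F w))) \<in> R" if "finite S" "S \<subseteq> ball 0 1" for S c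
    using that unfolding R_def by blast
  obtain g where g: "g \<in> V" "nm g \<le> C" "\<And>x s. (x,s) \<in> R \<Longrightarrow> s = ip x g"
  proof (rule riesz_relation[of R C])
    show "R \<noteq> {}" using RI[of "{}"] by auto
    show "x \<in> V" if "(x,s) \<in> R" for x s using that kf_comb_mem unfolding R_def by auto
    show "cmod s \<le> C * nm x" if "(x,s) \<in> R" for x s using that bound unfolding R_def by auto
    show "(\<lambda>z. d * x z, d * s) \<in> R" if xs: "(x,s) \<in> R" for x s d
    proof -
      obtain S c where S: "finite S" "S \<subseteq> ball 0 1"
        and "x = (\<lambda>z. \<Sum>w\<in>S. c w * kf w z)" "s = (\<Sum>w\<in>S. c w * cnj (F w))"
        using xs unfolding R_def by blast
      thus ?thesis using RI[OF S, of "\<lambda>w. d * c w"] by (simp add: sum_distrib_left mult.assoc)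
    qed
    show "(\<lambda>z. x z + y z, s + t) \<in> R" if xs: "(x,s) \<in> R" and yt: "(y,t) \<in> R" for x s y t
    proof -
      obtain S c where S: "finite S" "S \<subseteq> ball 0 1"
        and x: "x = (\<lambda>z. \<Sum>w\<in>S. c w * kf w z)" "s = (\<Sum>w\<in>S. c w * cnj (F w))"
        using xs unfolding R_def by blast
      obtain S' c' where S': "finite S'" "S' \<subseteq> ball 0 1"
        and y: "y = (\<lambda>z. \<Sum>w\<in>S'. c' w * kf w z)" "t = (\<Sum>w\<in>S'. c' w * cnj (F w))"
        using yt unfolding R_def by blast
      \<comment> \<open>Both coefficient families are extended by zero and added on the union of
        their supports.\<close>
      define e where "e w = (if w \<in> S then c w else 0) + (if w \<in> S' then c' w else 0)" for w
      have *: "(\<Sum>w\<in>S \<union> S'. e w * h w) = (\<Sum>w\<in>S. c w * h w) + (\<Sum>w\<in>S'. c' w * h w)" for h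
      proof -
        have "(\<Sum>w\<in>S \<union> S'. e w * h w) = (\<Sum>w\<in>S \<union> S'. if w \<in> S then c w * h w else 0)
           + (\<Sum>w\<in>S \<union> S'. if w \<in> S' then c' w * h w else 0)"
          unfolding e_def distrib_right sum.distrib by (intro arg_cong2[of _ _ _ _ "(+)"] sum.cong) auto
        also have "(\<Sum>w\<in>S \<union> S'. if w \<in> S then c w * h w else 0) = (\<Sum>w\<in>S. c w * h w)"
          using S S' by (intro sum.mono_neutral_cong_right) auto
        also have "(\<Sum>w\<in>S \<union> S'. if w \<in> S' then c' w * h w else 0) = (\<Sum>w\<in>S'. c' w * h w)"
          using S S' by (intro sum.mono_neutral_cong_right) auto
        finally show ?thesis .
      qed
      show ?thesis using RI[of "S \<union> S'" e] S S' unfolding x y * by simp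
    qed
  qed (use C in auto)
  have "F w = g w" for w
  proof (cases "w \<in> ball 0 1")
    case True
    have "(kf w, cnj (F w)) \<in> R" using RI[of "{w}" "\<lambda>w. 1"] True by simp
    hence "cnj (F w) = ip (kf w) g" by (rule g(3))
    also have "\<dots> = cnj (g w)" using ip_cnj[OF g(1) kf_mem[OF True]] ip_kf[OF True g(1)] by simp
    finally show ?thesis by simp
  qed (use F supported[OF g(1)] in simp)
  hence "F = g" by blast
  thus ?thesis using g by blast
qed

text \<open>Testing the positive kernel against \<open>cnj (c z)\<close> is the square of the
  estimate required by \<open>mem_of_bound\<close>.\<close>

lemma mem_of_psd:
  assumes "\<And>z. z \<notin> ball 0 1 \<Longrightarrow> F z = 0" "0 \<le> C"
    and "psd (\<lambda>z w. of_real (C\<^sup>2) * k z w - F z * cnj (F w))"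
  shows "F \<in> V \<and> nm F \<le> C"
proof (rule mem_of_bound[OF assms(1,2)])
  fix S c assume S: "finite S" "S \<subseteq> (ball 0 1 :: (complex ^ 'n) set)"
  let ?x = "\<lambda>z. \<Sum>w\<in>S. c w * kf w z"
  have cnj: "cnj (\<Sum>w\<in>S. c w * cnj (F w)) = (\<Sum>z\<in>S. cnj (c z) * F z)" by simp
  have "(cmod (\<Sum>w\<in>S. c w * cnj (F w)))\<^sup>2 = Re ((\<Sum>z\<in>S. cnj (c z) * F z) * (\<Sum>w\<in>S. c w * cnj (F w)))"
    unfolding cmod_sq_eq cnj ..
  also have "(\<Sum>z\<in>S. cnj (c z) * F z) * (\<Sum>w\<in>S. c w * cnj (F w))
      = (\<Sum>z\<in>S. \<Sum>w\<in>S. cnj (c z) * c w * (F z * cnj (F w)))"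
    by (simp add: sum_product mult_ac)
  also have "Re \<dots> \<le> Re (\<Sum>z\<in>S. \<Sum>w\<in>S. cnj (c z) * c w * (of_real (C\<^sup>2) * k z w))"
    using psdD[OF assms(3) S, of "\<lambda>z. cnj (c z)"] by (simp add: right_diff_distrib sum_subtractf)
  also have "(\<Sum>z\<in>S. \<Sum>w\<in>S. cnj (c z) * c w * (of_real (C\<^sup>2) * k z w))
      = of_real (C\<^sup>2) * (\<Sum>z\<in>S. \<Sum>w\<in>S. cnj (c z) * c w * k z w)"
    by (simp add: sum_distrib_left mult_ac)
  also have "Re \<dots> = C\<^sup>2 * (nm ?x)\<^sup>2"
    unfolding nm_kf_comb[OF S(2)] by (simp del: of_real_power Re_sum)
  finally have "(cmod (\<Sum>w\<in>S. c w * cnj (F w)))\<^sup>2 \<le> (C * nm ?x)\<^sup>2" by (simp add: power_mult_distrib)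
  moreover have "0 \<le> C * nm ?x" using assms(2) nm_nonneg[OF kf_comb_mem[OF S(2)]] by simp
  ultimately show "cmod (\<Sum>w\<in>S. c w * cnj (F w)) \<le> C * nm ?x" by (rule power2_le_imp_le)
qed

text \<open>The adjoint of multiplication by \<open>\<phi> i\<close> maps \<open>kf w\<close> to
  \<open>cnj (\<phi> i w) * kf w\<close>, so positivity says that the column of adjoints is
  contractive on combinations of kernel functions. Pairing with \<open>g\<close> and Cauchy-Schwarz
  bound the row; \<open>mem_of_bound\<close> yields membership at the same time.\<close>

lemma row_contraction:
  fixes m :: nat
  assumes psd: "psd (\<lambda>z w. k z w - (\<Sum>i<m. \<phi> i z * cnj (\<phi> i w)) * k z w)"
    and g: "\<And>i. i < m \<Longrightarrow> g i \<in> V"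
  shows "(\<lambda>z. \<Sum>i<m. \<phi> i z * g i z) \<in> V \<and>
    nm (\<lambda>z. \<Sum>i<m. \<phi> i z * g i z) \<le> sqrt (\<Sum>i<m. (nm (g i))\<^sup>2)"
proof (rule mem_of_bound)
  show "(\<Sum>i<m. \<phi> i z * g i z) = 0" if "z \<notin> ball 0 1" for z
    using supported[OF g that] by simp
  show "0 \<le> sqrt (\<Sum>i<m. (nm (g i))\<^sup>2)" by (simp add: sum_nonneg)
  fix S c assume S: "finite S" "S \<subseteq> (ball 0 1 :: (complex ^ 'n) set)"
  let ?x = "\<lambda>z. \<Sum>w\<in>S. c w * kf w z"
  \<comment> \<open>The adjoint of multiplication by \<open>\<phi> i\<close>, applied to
    \<open>?x\<close>.\<close>
  define x where "x i = (\<lambda>z. \<Sum>w\<in>S. (c w * cnj (\<phi> i w)) * kf w z)" for i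
  have x: "x i \<in> V" for i unfolding x_def by (rule kf_comb_mem[OF S(2)])
  have "(\<Sum>w\<in>S. c w * cnj (\<Sum>i<m. \<phi> i w * g i w)) = (\<Sum>w\<in>S. \<Sum>i<m. (c w * cnj (\<phi> i w)) * cnj (g i w))"
    by (simp add: sum_distrib_left mult.assoc)
  also have "\<dots> = (\<Sum>i<m. ip (x i) (g i))"
    unfolding x_def by (subst sum.swap) (simp add: ip_kf_comb[OF S(2) g])
  finally have eq: "(\<Sum>w\<in>S. c w * cnj (\<Sum>i<m. \<phi> i w * g i w)) = (\<Sum>i<m. ip (x i) (g i))" .
  have "(\<Sum>i<m. (nm (x i))\<^sup>2) = Re (\<Sum>i<m. \<Sum>z\<in>S. \<Sum>w\<in>S. cnj (c z) * c w * (\<phi> i z * cnj (\<phi> i w) * k z w))"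
    unfolding x_def nm_kf_comb[OF S(2)] by (simp add: mult_ac)
  also have "(\<Sum>i<m. \<Sum>z\<in>S. \<Sum>w\<in>S. cnj (c z) * c w * (\<phi> i z * cnj (\<phi> i w) * k z w))
      = (\<Sum>z\<in>S. \<Sum>i<m. \<Sum>w\<in>S. cnj (c z) * c w * (\<phi> i z * cnj (\<phi> i w) * k z w))"
    by (rule sum.swap)
  also have "\<dots> = (\<Sum>z\<in>S. \<Sum>w\<in>S. \<Sum>i<m. cnj (c z) * c w * (\<phi> i z * cnj (\<phi> i w) * k z w))"
    by (intro sum.cong refl sum.swap)
  also have "\<dots> = (\<Sum>z\<in>S. \<Sum>w\<in>S. cnj (c z) * c w * ((\<Sum>i<m. \<phi> i z * cnj (\<phi> i w)) * k z w))"
    by (simp only: sum_distrib_left sum_distrib_right)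
  also have "Re \<dots> \<le> Re (\<Sum>z\<in>S. \<Sum>w\<in>S. cnj (c z) * c w * k z w)"
    using psdD[OF psd S, of "\<lambda>z. cnj (c z)"] by (simp add: right_diff_distrib sum_subtractf)
  also have "\<dots> = (nm ?x)\<^sup>2" by (rule nm_kf_comb[OF S(2), symmetric])
  finally have xs: "(\<Sum>i<m. (nm (x i))\<^sup>2) \<le> (nm ?x)\<^sup>2" .
  have "cmod (\<Sum>i<m. ip (x i) (g i)) \<le> (\<Sum>i<m. \<bar>nm (x i)\<bar> * \<bar>nm (g i)\<bar>)"
    using cauchy_schwarz x g by (intro sum_norm_le) auto
  also have "\<dots> \<le> sqrt (\<Sum>i<m. (nm (x i))\<^sup>2) * sqrt (\<Sum>i<m. (nm (g i))\<^sup>2)"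
    using L2_set_mult_ineq[of "\<lambda>i. nm (x i)" "\<lambda>i. nm (g i)" "{..<m}"] by (simp add: L2_set_def)
  also have "\<dots> \<le> nm ?x * sqrt (\<Sum>i<m. (nm (g i))\<^sup>2)"
    using xs nm_nonneg[OF kf_comb_mem[OF S(2)]] by (intro mult_right_mono real_le_lsqrt) (auto intro: sum_nonneg)
  finally show "cmod (\<Sum>w\<in>S. c w * cnj (\<Sum>i<m. \<phi> i w * g i w)) \<le> sqrt (\<Sum>i<m. (nm (g i))\<^sup>2) * nm ?x"
    unfolding eq by (simp add: mult.commute)
qed

text \<open>The closed graph theorem for multiplication operators: the sets \<open>{f. nm (\<phi> f) \<le> n}\<close> are closed
  because norm bounds can be tested against finite combinations of kernel functions.\<close>

lemma multiplier_bounded: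
  assumes mult: "\<And>f. f \<in> V \<Longrightarrow> (\<lambda>z. \<phi> z * f z) \<in> V"
  obtains C where "C \<ge> 0" "\<And>f. f \<in> V \<Longrightarrow> nm (\<lambda>z. \<phi> z * f z) \<le> C * nm f"
proof -
  \<comment> \<open>The value 0 off the carrier keeps \<open>d\<close> nonnegative and symmetric for
    all arguments, as \<open>Metric_space\<close> demands.\<close>
  define d where "d f g = (if f \<in> V \<and> g \<in> V then nm (\<lambda>z. f z - g z) else 0)" for f g
  interpret M: Metric_space V d
  proof
    fix x y z
    show "0 \<le> d x y" by (auto simp: d_def)
    show "d x y = d y x" using nm_diff_sym by (auto simp: d_def)
    show "d x y = 0 \<longleftrightarrow> x = y" if "x \<in> V" "y \<in> V"
      using nm_eq_0[of "\<lambda>z. x z - y z"] that by (auto simp: d_def fun_eq_iff)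
    show "d x z \<le> d x y + d y z" if "x \<in> V" "y \<in> V" "z \<in> V"
      using nm_triangle3[of x y z] that by (auto simp: d_def)
  qed
  have "M.mcomplete"
    unfolding M.mcomplete_def
  proof (intro allI impI)
    fix f assume "M.MCauchy f"
    hence f: "\<And>n. f n \<in> V" and c: "\<And>e. e > 0 \<Longrightarrow> \<exists>N. \<forall>n n'. N \<le> n \<longrightarrow> N \<le> n' \<longrightarrow> d (f n) (f n') < e"
      unfolding M.MCauchy_def by auto
    have "\<exists>N. \<forall>m\<ge>N. \<forall>n\<ge>N. nm (\<lambda>z. f m z - f n z) < e" if "e > 0" for e
      using c[OF that] f by (auto simp: d_def)
    then obtain g where "g \<in> V" "(\<lambda>n. nm (\<lambda>z. f n z - g z)) \<longlonglongrightarrow> 0"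
      using complete[of f] f by blast
    moreover from this have "(\<lambda>n. d (f n) g) \<longlonglongrightarrow> 0" using f by (simp add: d_def)
    ultimately show "\<exists>x. limitin M.mtopology f x sequentially"
      using f unfolding M.limit_metric_sequentially
      by (intro exI[of _ g]) (auto simp: LIMSEQ_iff)
  qed
  define T where "T n = {f \<in> V. nm (\<lambda>z. \<phi> z * f z) \<le> real n}" for n
  have closed: "closedin M.mtopology (T n)" for n
    unfolding M.closedin_metric
  proof (intro conjI allI impI)
    show "T n \<subseteq> V" by (auto simp: T_def)
    fix f assume f: "f \<in> V - T n"
    show "\<exists>r>0. disjnt (T n) (M.mball f r)"
    proof (rule ccontr)
      assume neg: "\<not> ?thesis"
      have "\<exists>g. g \<in> T n \<and> d f g < 1 / real (Suc j)" for j
      proof -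
        have "\<not> disjnt (T n) (M.mball f (1 / real (Suc j)))" using neg by simp
        thus ?thesis unfolding disjnt_def by (auto simp del: of_nat_Suc)
      qed
      then obtain h where h: "\<And>j. h j \<in> T n" "\<And>j. d f (h j) < 1 / real (Suc j)" by metis
      have hV: "h j \<in> V" for j using h(1) by (auto simp: T_def)
      have l: "(\<lambda>j. nm (\<lambda>z. h j z - f z)) \<longlonglongrightarrow> 0"
      proof (rule Lim_null_comparison[OF _ LIMSEQ_inverse_real_of_nat])
        have "nm (\<lambda>z. h j z - f z) \<le> inverse (real (Suc j))" for j
          using h(2)[of j] hV[of j] f nm_diff_sym[of f "h j"] by (auto simp: d_def inverse_eq_divide)
        thus "\<forall>\<^sub>F j in sequentially. norm (nm (\<lambda>z. h j z - f z)) \<le> inverse (real (Suc j))"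
          using hV f by simp
      qed
      have "(\<lambda>z. \<phi> z * f z) \<in> V \<and> nm (\<lambda>z. \<phi> z * f z) \<le> real n"
      proof (rule mem_of_bound)
        fix S c assume S: "finite S" "S \<subseteq> (ball 0 1 :: (complex ^ 'n) set)"
        have hl: "(\<lambda>j. h j w) \<longlonglongrightarrow> f w" if "w \<in> S" for w
        proof -
          have w: "w \<in> ball 0 1" using that S by blast
          show ?thesis using ip_tendsto[OF hV _ kf_mem[OF w] l] f ip_kf[OF w] hV by simp
        qed
        have "(\<lambda>j. cmod (\<Sum>w\<in>S. c w * cnj (\<phi> w * h j w))) \<longlonglongrightarrow> cmod (\<Sum>w\<in>S. c w * cnj (\<phi> w * f w))"
          by (intro tendsto_norm tendsto_sum tendsto_mult tendsto_const tendsto_cnj hl)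
        moreover have "cmod (\<Sum>w\<in>S. c w * cnj (\<phi> w * h j w)) \<le> real n * nm (\<lambda>z. \<Sum>w\<in>S. c w * kf w z)" for j
        proof -
          have "cmod (\<Sum>w\<in>S. c w * cnj (\<phi> w * h j w)) \<le>
              nm (\<lambda>z. \<Sum>w\<in>S. c w * kf w z) * nm (\<lambda>z. \<phi> z * h j z)"
            using cauchy_schwarz[OF kf_comb_mem[OF S(2)] mult[OF hV[of j]], of c]
            unfolding ip_kf_comb[OF S(2) mult[OF hV[of j]]] .
          also have "\<dots> \<le> nm (\<lambda>z. \<Sum>w\<in>S. c w * kf w z) * real n"
            using h(1)[of j] nm_nonneg[OF kf_comb_mem[OF S(2)]] by (intro mult_left_mono) (auto simp: T_def)
          finally show ?thesis by (simp add: mult.commute)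
        qed
        ultimately show "cmod (\<Sum>w\<in>S. c w * cnj (\<phi> w * f w)) \<le> real n * nm (\<lambda>z. \<Sum>w\<in>S. c w * kf w z)"
          using LIMSEQ_le_const2 by blast
      qed (use f supported in auto)
      thus False using f by (auto simp: T_def)
    qed
  qed
  have "(\<Union>n. T n) = V" using real_arch_simple by (auto simp: T_def)
  hence "M.mtopology interior_of \<Union>(range T) \<noteq> {}"
    using M.topspace_mtopology zero_mem by (metis empty_iff interior_of_topspace)
  then obtain n where "M.mtopology interior_of (T n) \<noteq> {}"
    using M.metric_Baire_category_alt[OF \<open>M.mcomplete\<close>, of "range T"] closed by auto
  then obtain f r where f: "f \<in> V" "r > 0" "M.mball f r \<subseteq> T n"
    by (metis M.in_interior_of_mball ex_in_conv)
  have fT: "nm (\<lambda>z. \<phi> z * f z) \<le> real n" using f by (auto simp: T_def subset_iff)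
  show ?thesis
  \<comment> \<open>A move of length \<open>r / 2\<close> stays inside the ball around
    \<open>f\<close>. The images of its two end points have norm at most \<open>n\<close>, so the
    difference costs \<open>2 * n\<close>, divided by \<open>r / 2\<close>.\<close>
  proof (rule that[of "4 * real n / r"])
    show "0 \<le> 4 * real n / r" using f by simp
    fix h assume h: "h \<in> V"
    show "nm (\<lambda>z. \<phi> z * h z) \<le> 4 * real n / r * nm h"
    proof (cases "nm h = 0")
      case True
      thus ?thesis using nm_eq_0[OF h] by simp
    next
      case False
      hence pos: "nm h > 0" using nm_nonneg[OF h] by linarith
      define t where "t = r / (2 * nm h)"
      have t: "t > 0" using f pos by (simp add: t_def)
      let ?g = "\<lambda>z. f z + of_real t * h z"
      have g: "?g \<in> V" using f h by auto
      have "nm (\<lambda>z. - (of_real t * h z)) = r / 2"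
        unfolding nm_minus[OF scale_mem[OF h]] nm_scale[OF h] norm_of_real
        using pos f(2) by (simp add: t_def)
      hence "d f ?g < r" using f g by (simp add: d_def)
      hence "?g \<in> T n" using f g by (auto simp: subset_iff)
      hence 1: "nm (\<lambda>z. \<phi> z * ?g z) \<le> real n" by (simp add: T_def)
      have "(\<lambda>z. of_real t * (\<phi> z * h z)) = (\<lambda>z. \<phi> z * ?g z - \<phi> z * f z)"
        by (simp add: fun_eq_iff algebra_simps)
      hence "t * nm (\<lambda>z. \<phi> z * h z) = nm (\<lambda>z. \<phi> z * ?g z - \<phi> z * f z)"
        using nm_scale[OF mult[OF h], of "of_real t"] t by simp
      also have "\<dots> \<le> 2 * real n"
        using nm_triangle_diff[OF mult[OF g] mult[OF f(1)]] 1 fT by simp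
      finally show ?thesis using t pos f by (simp add: t_def field_simps)
    qed
  qed
qed

end

section \<open>Polynomials and homogeneous expansions\<close>

lemma powser_has_fps_expansion:
  fixes f :: "complex \<Rightarrow> complex"
  assumes "r > 0" "\<And>t. cmod t < r \<Longrightarrow> (\<lambda>n. c n * t ^ n) sums f t"
  shows "f has_fps_expansion Abs_fps c"
proof (rule has_fps_expansionI)
  have "eventually (\<lambda>t::complex. t \<in> ball 0 r) (nhds 0)"
    using assms(1) by (intro eventually_nhds_in_open) auto
  thus "eventually (\<lambda>u. (\<lambda>n. fps_nth (Abs_fps c) n * u ^ n) sums f u) (nhds 0)"
    by eventually_elim (use assms in auto)
qed

lemma powser_unique:
  fixes f :: "complex \<Rightarrow> complex"
  assumes "r > 0" "\<And>t. cmod t < r \<Longrightarrow> (\<lambda>n. c n * t ^ n) sums f t"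
    and "\<And>t. cmod t < r \<Longrightarrow> (\<lambda>n. d n * t ^ n) sums f t"
  shows "c = d"
proof -
  have "Abs_fps c = Abs_fps d"
    using powser_has_fps_expansion[OF assms(1,2)] powser_has_fps_expansion[OF assms(1,3)]
    by (rule fps_expansion_unique_complex)
  hence "fps_nth (Abs_fps c) n = fps_nth (Abs_fps d) n" for n by (rule arg_cong)
  thus ?thesis by (simp add: fun_eq_iff)
qed

text \<open>The exponents \<open>\<alpha> i\<close> may coincide, while \<open>polynomial_fn\<close>
  sums over a set of exponents; coefficients of equal exponents are collected. This is what sums and
  products produce.\<close>

lemma polynomial_fn_sum_monomials:
  assumes "finite A"
  shows "polynomial_fn (\<lambda>z. \<Sum>i\<in>A. c i * monomial_fn (\<alpha> i) z)"
proof -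
  have "(\<Sum>i\<in>A. c i * monomial_fn (\<alpha> i) z) =
      (\<Sum>\<beta>\<in>\<alpha> ` A. (\<Sum>i\<in>{i \<in> A. \<alpha> i = \<beta>}. c i) * monomial_fn \<beta> z)" for z
    unfolding sum.image_gen[OF assms, of _ \<alpha>] sum_distrib_right by (intro sum.cong) auto
  thus ?thesis
    unfolding polynomial_fn_def
    by (intro exI[of _ "\<alpha> ` A"] exI[of _ "\<lambda>\<beta>. \<Sum>i\<in>{i \<in> A. \<alpha> i = \<beta>}. c i"]) (use assms in auto)
qed

lemma polynomial_fn_add:
  assumes "polynomial_fn p" "polynomial_fn q"
  shows "polynomial_fn (\<lambda>z. p z + q z)"
proof -
  obtain F c where p: "finite F" "p = (\<lambda>z. \<Sum>\<alpha>\<in>F. c \<alpha> * monomial_fn \<alpha> z)"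
    using assms unfolding polynomial_fn_def by blast
  obtain G d where q: "finite G" "q = (\<lambda>z. \<Sum>\<alpha>\<in>G. d \<alpha> * monomial_fn \<alpha> z)"
    using assms unfolding polynomial_fn_def by blast
  have "polynomial_fn (\<lambda>z. \<Sum>i\<in>F <+> G. case_sum c d i * monomial_fn (case_sum id id i) z)"
    using p q by (intro polynomial_fn_sum_monomials) auto
  thus ?thesis using p q by (simp add: sum.Plus)
qed

lemma monomial_fn_add: "monomial_fn \<alpha> z * monomial_fn \<beta> z = monomial_fn (\<lambda>i. \<alpha> i + \<beta> i) z"
  by (simp add: monomial_fn_def power_add prod.distrib)

lemma polynomial_fn_mult:
  assumes "polynomial_fn p" "polynomial_fn q"
  shows "polynomial_fn (\<lambda>z. p z * q z)"
proof -
  obtain F c where p: "finite F" "p = (\<lambda>z. \<Sum>\<alpha>\<in>F. c \<alpha> * monomial_fn \<alpha> z)"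
    using assms unfolding polynomial_fn_def by blast
  obtain G d where q: "finite G" "q = (\<lambda>z. \<Sum>\<alpha>\<in>G. d \<alpha> * monomial_fn \<alpha> z)"
    using assms unfolding polynomial_fn_def by blast
  have "polynomial_fn (\<lambda>z. \<Sum>i\<in>F \<times> G. (c (fst i) * d (snd i)) * monomial_fn (\<lambda>j. fst i j + snd i j) z)"
    using p q by (intro polynomial_fn_sum_monomials) auto
  moreover have "(\<Sum>i\<in>F \<times> G. (c (fst i) * d (snd i)) * monomial_fn (\<lambda>j. fst i j + snd i j) z) = p z * q z" for z
    unfolding p q sum_product sum.cartesian_product
    by (intro sum.cong) (auto simp: mult_ac simp flip: monomial_fn_add)
  ultimately show ?thesis by simp
qed

lemma polynomial_fn_const: "polynomial_fn (\<lambda>z. c)"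
  using polynomial_fn_sum_monomials[of "{()}" "\<lambda>_. c" "\<lambda>_ _. 0"] by (simp add: monomial_fn_def)

lemma polynomial_fn_coord: "polynomial_fn (\<lambda>z. z $ i)"
proof -
  have "monomial_fn (\<lambda>j. if j = i then 1 else 0) z = z $ i" for z :: "complex ^ 'a"
  proof -
    have "monomial_fn (\<lambda>j. if j = i then 1 else 0) z = (\<Prod>j\<in>UNIV. if j = i then z $ j else 1)"
      unfolding monomial_fn_def by (intro prod.cong) auto
    thus ?thesis by simp
  qed
  thus ?thesis
    using polynomial_fn_sum_monomials[of "{()}" "\<lambda>_. 1" "\<lambda>_ j. if j = i then 1 else 0"] by simp
qed

lemma polynomial_fn_sum: "(\<And>i. i \<in> A \<Longrightarrow> polynomial_fn (p i)) \<Longrightarrow> polynomial_fn (\<lambda>z. \<Sum>i\<in>A. p i z)"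
  by (induction A rule: infinite_finite_induct) (simp_all add: polynomial_fn_const polynomial_fn_add)

lemma polynomial_fn_power: "polynomial_fn p \<Longrightarrow> polynomial_fn (\<lambda>z. p z ^ n)"
  by (induction n) (simp_all add: polynomial_fn_const polynomial_fn_mult)

lemma polynomial_fn_vinner: "polynomial_fn (\<lambda>z. vinner z w)"
  unfolding vinner_def by (intro polynomial_fn_sum polynomial_fn_mult polynomial_fn_const polynomial_fn_coord)

lemmas polynomial_fn_intros = polynomial_fn_const polynomial_fn_coord polynomial_fn_add polynomial_fn_mult
  polynomial_fn_power polynomial_fn_vinner polynomial_fn_sum

text \<open>The auxiliary predicate \<open>Q\<close> carries polynomiality along, so that it is
  available as a premise in the steps for sums and products.\<close>

lemma polynomial_fn_induct [consumes 1, case_names const coord add mult]: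
  assumes p: "polynomial_fn (p :: ('n::finite) fn)" and const: "\<And>c. P (\<lambda>z. c)" and coord: "\<And>i. P (\<lambda>z :: complex ^ 'n. z $ i)"
    and add: "\<And>p q. polynomial_fn p \<Longrightarrow> polynomial_fn q \<Longrightarrow> P p \<Longrightarrow> P q \<Longrightarrow> P (\<lambda>z. p z + q z)"
    and mult: "\<And>p q. polynomial_fn p \<Longrightarrow> polynomial_fn q \<Longrightarrow> P p \<Longrightarrow> P q \<Longrightarrow> P (\<lambda>z. p z * q z)"
  shows "P p"
proof -
  define Q where "Q p \<longleftrightarrow> polynomial_fn p \<and> P p" for p
  have Qc: "Q (\<lambda>z. c)" for c using const by (simp add: Q_def polynomial_fn_const)
  have Qi: "Q (\<lambda>z. z $ i :: complex)" for i using coord by (simp add: Q_def polynomial_fn_coord)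
  have Qa: "Q (\<lambda>z. p z + q z)" if "Q p" "Q q" for p q
    using that add by (simp add: Q_def polynomial_fn_add)
  have Qm: "Q (\<lambda>z. p z * q z)" if "Q p" "Q q" for p q
    using that mult by (simp add: Q_def polynomial_fn_mult)
  have pow: "Q (\<lambda>z. (z $ i :: complex) ^ n)" for i n by (induction n) (use Qc Qm Qi in auto)
  have mon: "Q (\<lambda>z. \<Prod>i\<in>A. z $ i ^ \<alpha> i)" for A \<alpha>
    by (induction A rule: infinite_finite_induct) (use Qc Qm pow in auto)
  obtain F c where "finite F" "p = (\<lambda>z. \<Sum>\<alpha>\<in>F. c \<alpha> * monomial_fn \<alpha> z)"
    using p unfolding polynomial_fn_def by blast
  moreover have "Q (\<lambda>z. \<Sum>\<alpha>\<in>F. c \<alpha> * monomial_fn \<alpha> z)" for F c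
    unfolding monomial_fn_def
    by (induction F rule: infinite_finite_induct) (use Qc Qm Qa mon in auto)
  ultimately show ?thesis by (simp add: Q_def)
qed

lemma homogeneous_fn_polynomial: "homogeneous_fn g \<Longrightarrow> polynomial_fn g"
  unfolding homogeneous_fn_def polynomial_fn_def by blast

lemma monomial_fn_degree_one:
  assumes "(\<Sum>i\<in>UNIV. \<alpha> i) = (1::nat)"
  obtains i where "monomial_fn \<alpha> = (\<lambda>z. z $ i)"
proof -
  obtain i where i: "\<alpha> i = 1" "\<And>j. j \<noteq> i \<Longrightarrow> \<alpha> j = 0"
    using assms sum_eq_1_iff[of UNIV \<alpha>] by auto
  have "monomial_fn \<alpha> z = z $ i" for z
  proof -
    have "monomial_fn \<alpha> z = (\<Prod>j\<in>UNIV. if j = i then z $ j else 1)"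
      unfolding monomial_fn_def using i by (intro prod.cong) auto
    thus ?thesis by simp
  qed
  thus ?thesis using that by blast
qed

text \<open>Generators enter the argument through scaling alone, except those of degree one: they
  decide which linear forms act as zero, so their vector \<gamma> is exhibited.\<close>

lemma homogeneous_fn_cases:
  assumes "homogeneous_fn g"
  obtains m where "\<And>t z. g (t *s z) = t ^ m * g z" "m = 1 \<Longrightarrow> \<exists>\<gamma>. g = (\<lambda>z. vinner z \<gamma>)"
proof -
  obtain m F c where F: "finite F" "\<And>\<alpha>. \<alpha> \<in> F \<Longrightarrow> (\<Sum>i\<in>UNIV. \<alpha> i) = m"
    and g: "g = (\<lambda>z. \<Sum>\<alpha>\<in>F. c \<alpha> * monomial_fn \<alpha> z)"
    using assms unfolding homogeneous_fn_def by blast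
  have hom: "g (t *s z) = t ^ m * g z" for t z
  proof -
    have "c \<alpha> * monomial_fn \<alpha> (t *s z) = t ^ m * (c \<alpha> * monomial_fn \<alpha> z)" if "\<alpha> \<in> F" for \<alpha>
      using F(2)[OF that]
      by (simp add: monomial_fn_def power_mult_distrib prod.distrib mult_ac flip: power_sum)
    thus ?thesis unfolding g sum_distrib_left by (intro sum.cong) auto
  qed
  have "\<exists>\<gamma>. g = (\<lambda>z. vinner z \<gamma>)" if m: "m = 1"
  proof -
    have "\<exists>\<gamma>. (\<lambda>z. \<Sum>\<alpha>\<in>F'. c \<alpha> * monomial_fn \<alpha> z) = (\<lambda>z. vinner z \<gamma>)" if "F' \<subseteq> F" for F'
      using finite_subset[OF that F(1)] that
    proof (induction F' rule: finite_induct)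
      case empty
      show ?case by (rule exI[of _ 0]) simp
    next
      case (insert \<alpha> F')
      then obtain \<gamma> where \<gamma>: "(\<lambda>z. \<Sum>\<alpha>\<in>F'. c \<alpha> * monomial_fn \<alpha> z) = (\<lambda>z. vinner z \<gamma>)" by auto
      have "(\<Sum>i\<in>UNIV. \<alpha> i) = 1" using F(2) insert.prems m by auto
      then obtain i where i: "monomial_fn \<alpha> = (\<lambda>z. z $ i)" using monomial_fn_degree_one by blast
      \<comment> \<open>The conjugate compensates for \<open>vinner\<close> being conjugate linear
        in its second argument.\<close>
      have "vinner z (cnj (c \<alpha>) *s axis i 1) = c \<alpha> * z $ i" for z
        by (simp add: vinner_scale_right vinner_axis)
      hence "(\<lambda>z. \<Sum>\<alpha>\<in>insert \<alpha> F'. c \<alpha> * monomial_fn \<alpha> z) = (\<lambda>z. vinner z (cnj (c \<alpha>) *s axis i 1 + \<gamma>))"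
        using insert.hyps fun_cong[OF \<gamma>] by (simp add: vinner_add_right i fun_eq_iff)
      thus ?case by blast
    qed
    thus ?thesis unfolding g by blast
  qed
  thus ?thesis using that hom by blast
qed

lemma exists_unit_vec: obtains u :: "complex ^ 'n" where "vinner u u = 1"
proof -
  have "vinner (axis i 1 :: complex ^ 'n) (axis i 1) = 1" for i
    by (simp add: vinner_self)
  thus ?thesis using that by blast
qed

lemma vinner_self_unit: "vinner u u = 1 \<longleftrightarrow> norm u = 1"
  unfolding vinner_self of_real_eq_1_iff by (simp add: power2_eq_1_iff) (metis norm_ge_zero not_one_le_zero neg_0_le_iff_le zero_le_one le_minus_one_simps(3))

lemma polar_vec:
  fixes w :: "complex ^ 'n"
  obtains r u where "r \<ge> 0" "vinner u u = 1" "w = of_real r *s u"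
proof (cases "w = 0")
  case True
  obtain u :: "complex ^ 'n" where "vinner u u = 1" by (rule exists_unit_vec)
  thus ?thesis using True by (intro that[of 0 u]) auto
next
  case False
  show ?thesis
  proof (rule that[of "norm w" "of_real (1 / norm w) *s w"])
    show "vinner (of_real (1 / norm w) *s w) (of_real (1 / norm w) *s w) = 1"
      using False by (simp add: vinner_self_unit norm_vec_scale norm_divide)
    show "w = of_real (norm w) *s (of_real (1 / norm w) *s w)"
      using False by (simp add: vector_smult_assoc)
  qed simp
qed

section \<open>Powers of linear forms, and contractive rows from the kernel identity\<close>

locale ui_cnp =
  fixes H :: "('n::finite) fn_space" and k a b
  assumes reg: "regular_ui_cnp_space H k a b"
begin

sublocale ball_rkhs H k
  using reg by unfold_locales (simp add: regular_ui_cnp_space_def)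

lemma kernel_sums:
  "z \<in> ball 0 1 \<Longrightarrow> w \<in> ball 0 1 \<Longrightarrow> (\<lambda>n. of_real (a n) * vinner z w ^ n) sums k z w"
  using reg by (simp add: regular_ui_cnp_space_def)

lemma a_0: "a 0 = 1" and a_pos: "a n > 0"
  using reg by (simp_all add: regular_ui_cnp_space_def)

lemma b_nonneg: "b (Suc n) \<ge> 0"
  using reg by (simp add: regular_ui_cnp_space_def)

lemma k_nonzero: "z \<in> ball 0 1 \<Longrightarrow> w \<in> ball 0 1 \<Longrightarrow> k z w \<noteq> 0"
  using reg by (simp add: regular_ui_cnp_space_def)

lemma cnp_sums:
  "z \<in> ball 0 1 \<Longrightarrow> w \<in> ball 0 1 \<Longrightarrow> (\<lambda>n. of_real (b (Suc n)) * vinner z w ^ Suc n) sums (1 - 1 / k z w)"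
  using reg by (simp add: regular_ui_cnp_space_def)

text \<open>For \<open>w\<close> in the ball, \<open>a n\<close> times \<open>pf n w\<close> is the
  degree \<open>n\<close> part of \<open>kf w\<close>, so pairing with it extracts the degree
  \<open>n\<close> part of a function at \<open>w\<close>.\<close>

definition pf :: "nat \<Rightarrow> complex ^ 'n \<Rightarrow> 'n fn" where "pf n w = on_ball (\<lambda>z. vinner z w ^ n)"

lemma pf_apply: "z \<in> ball 0 1 \<Longrightarrow> pf n w z = vinner z w ^ n"
  by (simp add: pf_def on_ball_def)

lemma pf_scale: "pf n (c *s w) = (\<lambda>z. cnj c ^ n * pf n w z)"
  by (auto simp: pf_def on_ball_def vinner_scale_right power_mult_distrib)

lemma psd_mult_of_real_mult: "r \<ge> 0 \<Longrightarrow> psd_mult A \<Longrightarrow> psd_mult (\<lambda>z w. of_real r * A z w)"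
  by (intro psd_mult_times psd_mult_const)

lemma psd_kernel_minus_term: "psd (\<lambda>z w. k z w - of_real (a n) * vinner z w ^ n)"
proof (rule psd_lim)
  \<comment> \<open>Partial sums of the kernel without the term \<open>n\<close>; the length
    \<open>N + Suc n\<close> guarantees that this term occurs and can be removed.\<close>
  let ?F = "\<lambda>N z w. \<Sum>m\<in>{..<N + Suc n} - {n}. of_real (a m) * vinner z w ^ m"
  show "psd (?F N)" for N
    by (intro psd_mult_imp_psd psd_mult_sum psd_mult_of_real_mult psd_mult_power
        psd_mult_vinner[of "\<lambda>z. z"] less_imp_le a_pos)
  fix z w :: "complex ^ 'n" assume zw: "z \<in> ball 0 1" "w \<in> ball 0 1"
  have "(\<lambda>N. (\<Sum>m<N + Suc n. of_real (a m) * vinner z w ^ m) - of_real (a n) * vinner z w ^ n)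
      \<longlonglongrightarrow> k z w - of_real (a n) * vinner z w ^ n"
    using kernel_sums[OF zw] unfolding sums_def
    by (intro tendsto_diff tendsto_const) (rule LIMSEQ_ignore_initial_segment)
  thus "(\<lambda>N. ?F N z w) \<longlonglongrightarrow> k z w - of_real (a n) * vinner z w ^ n"
    by (simp add: sum_diff1)
qed

text \<open>Two dominations are added: \<open>k / a n\<close> dominates
  \<open>vinner z w ^ n\<close>, and this power dominates the rank one kernel of
  \<open>pf n u\<close>. Then \<open>mem_of_psd\<close> applies.\<close>

lemma pf_unit:
  assumes "vinner u u = 1"
  shows "pf n u \<in> V \<and> nm (pf n u) \<le> sqrt (1 / a n)"
proof (rule mem_of_psd)
  show "pf n u z = 0" if "z \<notin> ball 0 1" for z using that by (simp add: pf_def on_ball_def)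
  show "0 \<le> sqrt (1 / a n)" using a_pos[of n] by simp
  have 1: "psd (\<lambda>z w. of_real (1 / a n) * (k z w - of_real (a n) * vinner z w ^ n))"
    by (rule psd_multD[OF psd_mult_const psd_kernel_minus_term]) (use a_pos[of n] in simp)
  have 2: "psd (\<lambda>z w. vinner z w ^ n - (vinner z u * cnj (vinner w u)) ^ n)"
    by (intro psd_mult_imp_psd psd_mult_power_diff psd_mult_vinner[of "\<lambda>z. z"] psd_mult_rank_one
        psd_mult_orth_part assms)
  show "psd (\<lambda>z w. of_real ((sqrt (1 / a n))\<^sup>2) * k z w - pf n u z * cnj (pf n u w))"
    by (rule psd_cong[OF psd_add[OF 1 2]])
      (use a_pos[of n] in \<open>simp add: pf_apply power_mult_distrib field_simps\<close>)
qed

lemma pf_mem [simp, intro]: "pf n w \<in> V"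
proof -
  obtain r u where u: "vinner u u = 1" and w: "w = of_real r *s u" by (rule polar_vec)
  show ?thesis unfolding w pf_scale using pf_unit[OF u] by (intro scale_mem) blast
qed

lemma nm_pf_le: "nm (pf n w) \<le> norm w ^ n / sqrt (a n)"
proof -
  obtain r u where r: "r \<ge> 0" and u: "vinner u u = 1" and w: "w = of_real r *s u" by (rule polar_vec)
  have norm: "norm w = r" using r u unfolding w norm_vec_scale vinner_self_unit by simp
  have "nm (pf n w) = r ^ n * nm (pf n u)"
    unfolding w pf_scale using r by (subst nm_scale) (auto simp: norm_power)
  also have "\<dots> \<le> r ^ n * sqrt (1 / a n)" using pf_unit[OF u] r by (intro mult_left_mono) auto
  finally show ?thesis unfolding norm by (simp add: real_sqrt_divide)
qed

text \<open>Convergence of the kernel on the diagonal at a radius \<open>s\<close> slightly larger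
  than \<open>norm w\<close> bounds \<open>sqrt (a n) * s ^ n\<close>; what remains is geometric
  with ratio \<open>norm w / s\<close>.\<close>

lemma summable_nm_pf:
  assumes "norm w < 1"
  shows "summable (\<lambda>n. nm (\<lambda>z. of_real (a n) * pf n w z))"
proof -
  obtain s where s: "norm w < s" "s < 1" using dense[OF assms] by blast
  have s0: "s > 0" using s norm_ge_zero[of w] by linarith
  obtain u :: "complex ^ 'n" where u: "vinner u u = 1" by (rule exists_unit_vec)
  have "norm (of_real s *s u) < 1" using s s0 u by (simp add: norm_vec_scale vinner_self_unit)
  hence "(\<lambda>n. of_real (a n) * vinner (of_real s *s u) (of_real s *s u) ^ n) sums k (of_real s *s u) (of_real s *s u)"
    by (intro kernel_sums) auto
  hence "(\<lambda>n. of_real (a n) * vinner (of_real s *s u) (of_real s *s u) ^ n) \<longlonglongrightarrow> 0"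
    using sums_summable summable_LIMSEQ_zero by blast
  moreover have "vinner (of_real s *s u) (of_real s *s u) = of_real (s\<^sup>2)"
    using u by (simp add: vinner_scale_left vinner_scale_right power2_eq_square)
  ultimately have "(\<lambda>n. of_real (a n * (s\<^sup>2) ^ n) :: complex) \<longlonglongrightarrow> 0" by simp
  hence "(\<lambda>n. a n * (s\<^sup>2) ^ n) \<longlonglongrightarrow> 0" by (simp only: tendsto_of_real_iff[of _ 0, simplified])
  hence "Bseq (\<lambda>n. a n * (s\<^sup>2) ^ n)" using convergentI convergent_imp_Bseq by blast
  then obtain C where C: "C > 0" "\<And>n. \<bar>a n * (s\<^sup>2) ^ n\<bar> \<le> C" unfolding Bseq_def by auto
  have bound: "sqrt (a n) * s ^ n \<le> sqrt C" for n
  proof -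
    have "sqrt (a n) * s ^ n = sqrt (a n * (s\<^sup>2) ^ n)"
      using s0 by (simp add: real_sqrt_mult real_sqrt_power)
    also have "\<dots> \<le> sqrt C" using C(2)[of n] by (intro real_sqrt_le_mono) linarith
    finally show ?thesis .
  qed
  show ?thesis
  proof (rule summable_comparison_test')
    show "summable (\<lambda>n. sqrt C * (norm w / s) ^ n)"
      using s s0 by (intro summable_mult summable_geometric) simp
    fix n :: nat
    have "nm (\<lambda>z. of_real (a n) * pf n w z) = a n * nm (pf n w)"
      using a_pos[of n] by (simp add: nm_scale)
    also have "\<dots> \<le> a n * (norm w ^ n / sqrt (a n))"
      using a_pos[of n] by (intro mult_left_mono nm_pf_le) auto
    also have "\<dots> = (a n / sqrt (a n)) * norm w ^ n" by simp
    also have "\<dots> = sqrt (a n) * norm w ^ n" using a_pos[of n] by (simp only: real_div_sqrt less_imp_le)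
    also have "\<dots> = (sqrt (a n) * s ^ n) * (norm w / s) ^ n"
      using s0 by (simp add: power_divide)
    also have "\<dots> \<le> sqrt C * (norm w / s) ^ n"
      using s0 by (intro mult_right_mono bound) auto
    finally show "norm (nm (\<lambda>z. of_real (a n) * pf n w z)) \<le> sqrt C * (norm w / s) ^ n"
      by simp
  qed
qed

text \<open>The kernel series converges to \<open>kf w\<close> in norm and not only pointwise, so it
  may be paired with \<open>f\<close> term by term.\<close>

lemma expand:
  assumes f: "f \<in> V" and w: "w \<in> ball 0 1"
  shows "(\<lambda>n. of_real (a n) * ip f (pf n w)) sums f w"
proof -
  have pV: "(\<lambda>z. of_real (a n) * pf n w z) \<in> V" for n by auto
  obtain g where g: "g \<in> V" and lim: "(\<lambda>N. nm (\<lambda>z. (\<Sum>n<N. of_real (a n) * pf n w z) - g z)) \<longlonglongrightarrow> 0"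
    using summable_series[OF pV summable_nm_pf] w by auto
  have SV: "(\<lambda>z. \<Sum>n<N. of_real (a n) * pf n w z) \<in> V" for N by auto
  have ips: "(\<lambda>n. ip (\<lambda>z. of_real (a n) * pf n w z) h) sums ip g h" if "h \<in> V" for h
    using ip_tendsto[OF SV g that lim] ip_sum_left[of _ "\<lambda>n z. of_real (a n) * pf n w z", OF pV that] unfolding sums_def by simp
  have "g z = kf w z" for z
  proof (cases "z \<in> ball 0 1")
    case True
    have "(\<lambda>n. of_real (a n) * vinner z w ^ n) sums g z"
      using ips[OF kf_mem[OF True]] ip_kf[OF True g] ip_kf[OF True pV] by (simp add: pf_apply[OF True])
    thus ?thesis using kernel_sums[OF True w] sums_unique2 kf_apply[OF True] by metis
  next
    case False
    thus ?thesis using supported[OF g False] supported[OF kf_mem[OF w] False] by simp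
  qed
  hence "g = kf w" by (rule ext)
  hence "(\<lambda>n. cnj (ip (\<lambda>z. of_real (a n) * pf n w z) f)) sums cnj (ip (kf w) f)"
    using ips[OF f] by (simp only: sums_cnj)
  moreover have "cnj (ip (kf w) f) = f w" using ip_cnj[OF kf_mem[OF w] f] ip_kf[OF w f] by simp
  moreover have "cnj (ip (\<lambda>z. of_real (a n) * pf n w z) f) = of_real (a n) * ip f (pf n w)" for n
    using f by (simp add: ip_scale_left ip_cnj)
  ultimately show ?thesis by simp
qed

lemma expand_scaled:
  assumes f: "f \<in> V" and w: "t *s w \<in> ball 0 1"
  shows "(\<lambda>n. (of_real (a n) * ip f (pf n w)) * t ^ n) sums f (t *s w)"
proof -
  have "ip f (pf n (t *s w)) = t ^ n * ip f (pf n w)" for n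
    unfolding pf_scale using f by (simp add: ip_scale_right)
  thus ?thesis using expand[OF f w] by (simp add: mult_ac)
qed

lemma small_scaling:
  fixes w :: "complex ^ 'n"
  obtains r where "r > 0" "\<And>t. cmod t < r \<Longrightarrow> t *s w \<in> ball 0 1"
proof (rule that[of "1 / (norm w + 1)"])
  show "1 / (norm w + 1) > 0" by (simp add: add_nonneg_pos)
  fix t assume "cmod t < 1 / (norm w + 1)"
  hence "cmod t * (norm w + 1) < 1" by (simp add: pos_less_divide_eq add_nonneg_pos)
  hence "cmod t * norm w < 1" using norm_ge_zero[of t] unfolding distrib_left by linarith
  thus "t *s w \<in> ball 0 1" by (simp add: norm_vec_scale)
qed

text \<open>Both sides are the coefficient of \<open>t ^ n\<close> in \<open>g (t w) * h (t w)\<close>.\<close>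

lemma ip_homogeneous_mult:
  assumes hom: "\<And>t. g (t *s w) = t ^ m * g w" and h: "h \<in> V" and gh: "(\<lambda>z. g z * h z) \<in> V"
  shows "of_real (a n) * ip (\<lambda>z. g z * h z) (pf n w) =
    (if n < m then 0 else g w * (of_real (a (n - m)) * ip h (pf (n - m) w)))"
proof -
  obtain r where r: "r > 0" "\<And>t. cmod t < r \<Longrightarrow> t *s w \<in> ball 0 1"
    using small_scaling[of w] by blast
  let ?d = "\<lambda>n. if n < m then 0 else g w * (of_real (a (n - m)) * ip h (pf (n - m) w))"
  have "(\<lambda>n. of_real (a n) * ip (\<lambda>z. g z * h z) (pf n w)) = ?d"
  proof (rule powser_unique[OF r(1)])
    fix t assume t: "cmod t < r"
    show "(\<lambda>n. (of_real (a n) * ip (\<lambda>z. g z * h z) (pf n w)) * t ^ n) sums (g (t *s w) * h (t *s w))"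
      using expand_scaled[OF gh r(2)[OF t]] .
    have "(\<lambda>n. (g w * t ^ m) * ((of_real (a n) * ip h (pf n w)) * t ^ n)) sums ((g w * t ^ m) * h (t *s w))"
      by (intro sums_mult expand_scaled[OF h r(2)[OF t]])
    hence "(\<lambda>n. ?d (n + m) * t ^ (n + m)) sums (g (t *s w) * h (t *s w))"
      by (simp add: hom power_add mult_ac)
    thus "(\<lambda>n. ?d n * t ^ n) sums (g (t *s w) * h (t *s w))"
      by (subst (asm) sums_zero_iff_shift) auto
  qed
  thus ?thesis by (rule fun_cong)
qed

definition one :: "'n fn" where "one = on_ball (\<lambda>z. 1)"

lemma pf_0: "pf 0 w = one" by (simp add: pf_def one_def)

lemma one_mem [simp, intro]: "one \<in> V" using pf_mem[of 0 0] by (simp add: pf_0)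

lemma kf_0: "kf 0 = one"
proof
  fix z
  show "kf 0 z = one z"
  proof (cases "z \<in> ball 0 1")
    case True
    have "(\<lambda>n. of_real (a n) * vinner z 0 ^ n) sums k z 0" using True by (intro kernel_sums) auto
    hence "k z 0 = 1" using powser_sums_zero[of "\<lambda>n. complex_of_real (a n)"] sums_unique2 a_0 by fastforce
    thus ?thesis using True by (simp add: kf_apply one_def on_ball_def)
  qed (simp add: kf_def one_def on_ball_def)
qed

lemma ip_one: "f \<in> V \<Longrightarrow> ip f one = f 0"
  using ip_kf[of 0 f] by (simp add: kf_0)

lemma nm_one: "nm one = 1"
  using nm_sq[OF one_mem] nm_nonneg[OF one_mem] ip_one[OF one_mem]
  by (simp add: one_def on_ball_def power2_eq_1_iff)

lemma ip_one_pf: "ip one (pf n w) = (if n = 0 then 1 else 0)"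
proof (cases "n = 0")
  case True
  thus ?thesis using ip_one[OF one_mem] by (simp add: pf_0) (simp add: one_def on_ball_def)
next
  case False
  hence "ip (pf n w) one = 0" using ip_one[OF pf_mem] by (simp add: pf_apply)
  thus ?thesis using False ip_cnj[OF pf_mem one_mem] by (metis complex_cnj_zero)
qed

text \<open>A power of a linear form is a homogeneous factor times the constant function, so
  \<open>ip_homogeneous_mult\<close> gives orthogonality and norms together.\<close>

lemma ip_pf: "ip (pf m v) (pf n w) = (if m = n then vinner w v ^ n / of_real (a n) else 0)"
proof -
  have eq: "(\<lambda>z. vinner z v ^ m * one z) = pf m v" by (auto simp: pf_def one_def on_ball_def)
  have "of_real (a n) * ip (\<lambda>z. vinner z v ^ m * one z) (pf n w) =
    (if n < m then 0 else vinner w v ^ m * (of_real (a (n - m)) * ip one (pf (n - m) w)))"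
    by (rule ip_homogeneous_mult) (simp_all add: vinner_scale_left power_mult_distrib eq)
  thus ?thesis using a_pos[of n] unfolding eq by (auto simp: ip_one_pf a_0 field_simps split: if_splits)
qed

lemma nm_pf: "vinner u u = 1 \<Longrightarrow> (nm (pf n u))\<^sup>2 = 1 / a n"
  unfolding nm_sq[OF pf_mem] ip_pf by simp

text \<open>Comparison of the coefficients of \<open>t\<close> in
  \<open>f t * (1 - (1 - 1 / f t)) = 1\<close>, where the constant coefficient of \<open>f\<close>
  is \<open>a 0 = 1\<close>.\<close>

lemma b_1: "b 1 = a 1"
proof -
  obtain u :: "complex ^ 'n" where u: "vinner u u = 1" by (rule exists_unit_vec)
  \<comment> \<open>The second point is fixed and the first one scaled so that \<open>vinner\<close>
    equals \<open>t\<close>; for \<open>cmod t < 1/2\<close> both points lie in the ball.\<close>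
  define f where "f t = k ((2 * t) *s u) ((1/2) *s u)" for t
  have vin: "vinner ((2 * t) *s u) ((1/2) *s u) = t" for t
    using u by (simp add: vinner_scale_left vinner_scale_right)
  have ball: "(2 * t) *s u \<in> ball 0 1" "(1/2::complex) *s u \<in> ball 0 1" if "cmod t < 1/2" for t
    using that u by (simp_all add: norm_vec_scale vinner_self_unit norm_mult)
  let ?A = "Abs_fps (\<lambda>n. complex_of_real (a n))"
  let ?B = "Abs_fps (\<lambda>n. if n = 0 then 0 else complex_of_real (b n))"
  have A: "f has_fps_expansion ?A"
  proof (rule powser_has_fps_expansion[of "1/2"])
    fix t :: complex assume "cmod t < 1/2"
    from kernel_sums[OF ball[OF this]] show "(\<lambda>n. of_real (a n) * t ^ n) sums f t"
      by (simp add: vin f_def)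
  qed simp
  have "(\<lambda>t. 1 - 1 / f t) has_fps_expansion ?B"
  proof (rule powser_has_fps_expansion[of "1/2"])
    fix t :: complex assume "cmod t < 1/2"
    from cnp_sums[OF ball[OF this]]
    have "(\<lambda>n. of_real (b (Suc n)) * t ^ Suc n) sums (1 - 1 / f t)"
      by (simp add: vin f_def)
    thus "(\<lambda>n. (if n = 0 then 0 else of_real (b n)) * t ^ n) sums (1 - 1 / f t)"
      by (subst sums_Suc_iff[where f = "\<lambda>n. (if n = 0 then 0 else of_real (b n)) * t ^ n", simplified, symmetric]) simp
  qed simp
  hence "(\<lambda>t. f t * (1 - (1 - 1 / f t))) has_fps_expansion ?A * (1 - ?B)"
    by (intro has_fps_expansion_mult has_fps_expansion_diff has_fps_expansion_1 A)
  moreover have "(\<lambda>t. f t * (1 - (1 - 1 / f t))) has_fps_expansion 1"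
  proof -
    have "eventually (\<lambda>t::complex. t \<in> ball 0 (1/2)) (nhds 0)"
      by (intro eventually_nhds_in_open) auto
    hence "eventually (\<lambda>t. f t * (1 - (1 - 1 / f t)) = 1) (nhds 0)"
      by eventually_elim (use k_nonzero[OF ball] in \<open>simp add: f_def\<close>)
    thus ?thesis using has_fps_expansion_cong[of _ "\<lambda>_. 1" 1 1] by simp
  qed
  ultimately have "?A * (1 - ?B) = 1" by (rule fps_expansion_unique_complex)
  hence "fps_nth (?A * (1 - ?B)) 1 = fps_nth 1 1" by simp
  hence "complex_of_real (a 1) - complex_of_real (b 1) = 0"
    by (simp add: fps_mult_nth_1 a_0)
  thus ?thesis by simp
qed

text \<open>Since \<open>k (1 - \<Sum>n\<ge>1. b n \<langle>z,w\<rangle> ^ n) = 1\<close>, replacing some of the powers \<open>\<langle>z,w\<rangle> ^ n\<close> by smaller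
  kernels keeps the left hand side positive.\<close>

lemma psd_cnp:
  assumes q: "\<And>i. i < N \<Longrightarrow> psd_mult (\<lambda>z w. vinner z w ^ Suc i - q i z w)"
  shows "psd (\<lambda>z w. k z w - (\<Sum>i<N. of_real (b (Suc i)) * q i z w) * k z w)"
proof (rule psd_lim)
  \<comment> \<open>The length \<open>M + N\<close> contains all replaced powers from the start. As
    \<open>M\<close> grows, the full powers add up to \<open>1 - 1 / k z w\<close>, so
    \<open>1 + ?A M z w * k z w\<close> tends to the asserted kernel.\<close>
  let ?A = "\<lambda>M z w. \<Sum>i<M + N. of_real (b (Suc i)) * (vinner z w ^ Suc i - (if i < N then q i z w else 0))"
  show "psd (\<lambda>z w. 1 + ?A M z w * k z w)" for M
  proof -
    have "psd_mult (\<lambda>z w. vinner z w ^ Suc i - (if i < N then q i z w else 0))" for i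
      using q[of i] psd_mult_power[OF psd_mult_vinner[of "\<lambda>z. z"], of "Suc i"] by (cases "i < N") auto
    hence "psd_mult (?A M)" by (intro psd_mult_sum psd_mult_of_real_mult b_nonneg)
    hence "psd (\<lambda>z w. ?A M z w * k z w)" by (rule psd_multD[OF _ psd_kernel])
    thus ?thesis by (intro psd_add psd_one)
  qed
  fix z w :: "complex ^ 'n" assume zw: "z \<in> ball 0 1" "w \<in> ball 0 1"
  have A: "?A M z w = (\<Sum>i<M + N. of_real (b (Suc i)) * vinner z w ^ Suc i) - (\<Sum>i<N. of_real (b (Suc i)) * q i z w)" for M
  proof -
    have "(\<Sum>i<M + N. of_real (b (Suc i)) * (if i < N then q i z w else 0)) = (\<Sum>i<N. of_real (b (Suc i)) * q i z w)"
      by (rule sum.mono_neutral_cong_right) auto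
    thus ?thesis by (simp only: right_diff_distrib sum_subtractf)
  qed
  have "(\<lambda>M. 1 + ?A M z w * k z w) \<longlonglongrightarrow>
     1 + ((1 - 1 / k z w) - (\<Sum>i<N. of_real (b (Suc i)) * q i z w)) * k z w"
    unfolding A using cnp_sums[OF zw] unfolding sums_def
    by (intro tendsto_intros) (rule LIMSEQ_ignore_initial_segment)
  thus "(\<lambda>M. 1 + ?A M z w * k z w) \<longlonglongrightarrow> k z w - (\<Sum>i<N. of_real (b (Suc i)) * q i z w) * k z w"
    using k_nonzero[OF zw] by (simp add: algebra_simps)
qed

text \<open>The weights \<open>sqrt (b n)\<close> make the row kernel equal to the sum of
  \<open>b n\<close> times the \<open>n\<close>-th power of a rank one kernel, which
  \<open>vinner z w ^ n\<close> dominates. Index \<open>i\<close> stands for the exponent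
  \<open>Suc i\<close>.\<close>

lemma row_powers:
  assumes u: "vinner u u = 1" and g: "\<And>i. i < N \<Longrightarrow> g i \<in> V"
  shows "(\<lambda>z. \<Sum>i<N. (of_real (sqrt (b (Suc i))) * vinner z u ^ Suc i) * g i z) \<in> V \<and>
    nm (\<lambda>z. \<Sum>i<N. (of_real (sqrt (b (Suc i))) * vinner z u ^ Suc i) * g i z) \<le> sqrt (\<Sum>i<N. (nm (g i))\<^sup>2)"
proof (rule row_contraction[OF _ g])
  have eq: "(of_real (sqrt (b (Suc i))) * vinner z u ^ Suc i) * cnj (of_real (sqrt (b (Suc i))) * vinner w u ^ Suc i)
     = of_real (b (Suc i)) * (vinner z u * cnj (vinner w u)) ^ Suc i" for i z w
  proof -
    have "of_real (b (Suc i)) = of_real (sqrt (b (Suc i))) * (of_real (sqrt (b (Suc i))) :: complex)"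
      using b_nonneg by (simp flip: of_real_mult)
    thus ?thesis by (simp add: power_mult_distrib mult_ac)
  qed
  show "psd (\<lambda>z w. k z w - (\<Sum>i<N. (of_real (sqrt (b (Suc i))) * vinner z u ^ Suc i) *
      cnj (of_real (sqrt (b (Suc i))) * vinner w u ^ Suc i)) * k z w)"
    unfolding eq
    by (intro psd_cnp psd_mult_power_diff psd_mult_vinner[of "\<lambda>z. z"] psd_mult_rank_one psd_mult_orth_part u)
qed

lemma row_orthonormal:
  assumes u: "vinner u u = 1" and v: "vinner v v = 1" and uv: "vinner u v = 0"
    and g: "\<And>i. i < 2 \<Longrightarrow> g i \<in> V"
  defines "\<phi> \<equiv> \<lambda>(i::nat) z. of_real (sqrt (b 1)) * (if i = 0 then vinner z u else vinner z v)"
  shows "(\<lambda>z. \<Sum>i<2. \<phi> i z * g i z) \<in> V \<and> nm (\<lambda>z. \<Sum>i<2. \<phi> i z * g i z) \<le> sqrt (\<Sum>i<2. (nm (g i))\<^sup>2)"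
proof (rule row_contraction[OF _ g])
  have b: "of_real (b 1) = of_real (sqrt (b 1)) * (of_real (sqrt (b 1)) :: complex)"
    using b_nonneg[of 0] by (simp flip: of_real_mult)
  have eq: "(\<Sum>i<2. \<phi> i z * cnj (\<phi> i w)) =
     of_real (b 1) * (vinner z u * cnj (vinner w u) + vinner z v * cnj (vinner w v))" for z w
    unfolding b \<phi>_def by (simp add: numeral_2_eq_2 algebra_simps)
  \<comment> \<open>Only the first power is replaced; its replacement, of rank two, accounts for
    both entries of the row.\<close>
  have "psd (\<lambda>z w. k z w - (\<Sum>i<1. of_real (b (Suc i)) *
      (vinner z u * cnj (vinner w u) + vinner z v * cnj (vinner w v))) * k z w)"
    by (intro psd_cnp) (use psd_mult_orth_part2[OF u v uv] in simp)
  thus "psd (\<lambda>z w. k z w - (\<Sum>i<2. \<phi> i z * cnj (\<phi> i w)) * k z w)"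
    unfolding eq by simp
qed

text \<open>A row of length one, divided by its weight: \<open>b 1 = a 1\<close> is
  positive.\<close>

lemma coord_mult_mem: "h \<in> V \<Longrightarrow> (\<lambda>z. z $ i * h z) \<in> V"
proof -
  assume h: "h \<in> V"
  let ?u = "axis i 1 :: complex ^ 'n"
  have b: "b (Suc 0) > 0" using b_1 a_pos[of 1] by simp
  have "vinner ?u ?u = 1" by (simp add: vinner_self)
  hence "(\<lambda>z. (of_real (sqrt (b (Suc 0))) * z $ i) * h z) \<in> V"
    using row_powers[of ?u 1 "\<lambda>_. h"] h by (simp add: vinner_axis)
  hence "(\<lambda>z. of_real (1 / sqrt (b (Suc 0))) * ((of_real (sqrt (b (Suc 0))) * z $ i) * h z)) \<in> V"
    by (rule scale_mem)
  moreover have "of_real (1 / sqrt (b (Suc 0))) * ((of_real (sqrt (b (Suc 0))) * z $ i) * h z) = z $ i * h z" for z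
    using b by simp
  ultimately show ?thesis by simp
qed

lemma poly_mult_mem:
  assumes "polynomial_fn p" "h \<in> V"
  shows "(\<lambda>z. p z * h z) \<in> V"
  using assms
proof (induction p arbitrary: h rule: polynomial_fn_induct)
  case (coord i)
  thus ?case by (rule coord_mult_mem)
next
  case (add p q)
  thus ?case using add_mem[of "\<lambda>z. p z * h z" "\<lambda>z. q z * h z"] by (simp add: distrib_right)
next
  case (mult p q)
  thus ?case by (simp add: mult.assoc)
qed auto

end

section \<open>Compressions to the quotient space\<close>

context fn_hilbert
begin

lemma bounded_opsD:
  assumes "T \<in> bounded_ops H"
  shows "\<And>f. f \<in> V \<Longrightarrow> T f \<in> V" "\<And>f. f \<notin> V \<Longrightarrow> T f = undefined"
    "\<And>f g. f \<in> V \<Longrightarrow> g \<in> V \<Longrightarrow> T (\<lambda>z. f z + g z) = (\<lambda>z. T f z + T g z)"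
    "\<And>c f. f \<in> V \<Longrightarrow> T (\<lambda>z. c * f z) = (\<lambda>z. c * T f z)"
    "\<exists>C\<ge>0. \<forall>f\<in>V. nm (T f) \<le> C * nm f"
proof -
  obtain C where C: "\<forall>f\<in>V. nm (T f) \<le> C * nm f" using assms unfolding bounded_ops_def by blast
  have "nm (T f) \<le> max C 0 * nm f" if "f \<in> V" for f
    using C that by (meson max.cobounded1 mult_right_mono nm_nonneg order_trans)
  thus "\<exists>C\<ge>0. \<forall>f\<in>V. nm (T f) \<le> C * nm f" by (intro exI[of _ "max C 0"]) auto
qed (use assms in \<open>unfold bounded_ops_def, auto\<close>)

lemma bounded_opsI:
  assumes "\<And>f. f \<in> V \<Longrightarrow> T f \<in> V" "\<And>f. f \<notin> V \<Longrightarrow> T f = undefined"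
    "\<And>f g. f \<in> V \<Longrightarrow> g \<in> V \<Longrightarrow> T (\<lambda>z. f z + g z) = (\<lambda>z. T f z + T g z)"
    "\<And>c f. f \<in> V \<Longrightarrow> T (\<lambda>z. c * f z) = (\<lambda>z. c * T f z)"
    "\<And>f. f \<in> V \<Longrightarrow> nm (T f) \<le> C * nm f"
  shows "T \<in> bounded_ops H"
  unfolding bounded_ops_def
  by (intro CollectI conjI ballI allI PiE_I exI[of _ C]) (use assms in auto)

lemma bounded_ops_diff:
  assumes "T \<in> bounded_ops H" "f \<in> V" "g \<in> V"
  shows "T (\<lambda>z. f z - g z) = (\<lambda>z. T f z - T g z)"
  using bounded_opsD(3)[OF assms(1), of f "\<lambda>z. - 1 * g z"] bounded_opsD(4)[OF assms(1,3), of "-1"] assms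
    scale_mem[OF assms(3), of "-1"]
  by simp

lemma bounded_ops_zero: "T \<in> bounded_ops H \<Longrightarrow> T (\<lambda>z. 0) = (\<lambda>z. 0)"
  using bounded_opsD(4)[of T "\<lambda>z. 0" 0] by simp

lemma bounded_ops_eqI:
  assumes "T \<in> bounded_ops H" "U \<in> bounded_ops H" "\<And>f. f \<in> V \<Longrightarrow> T f = U f"
  shows "T = U"
  using assms bounded_opsD(2) by (metis ext)

lemma op_norm_le:
  assumes "\<And>f. f \<in> V \<Longrightarrow> nm f \<le> 1 \<Longrightarrow> nm (T f) \<le> e"
  shows "op_norm H T \<le> e"
  unfolding op_norm_def
proof (rule cSup_least)
  have "nm (T (\<lambda>z. 0)) \<in> {nm (T f) |f. f \<in> V \<and> nm f \<le> 1}" by (auto intro!: exI[of _ "\<lambda>z. 0"])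
  thus "{nm (T f) |f. f \<in> V \<and> nm f \<le> 1} \<noteq> {}" by blast
qed (use assms in auto)

lemma op_norm_bound:
  assumes T: "\<And>f. f \<in> V \<Longrightarrow> T f \<in> V" "\<And>c f. f \<in> V \<Longrightarrow> T (\<lambda>z. c * f z) = (\<lambda>z. c * T f z)"
    and C: "\<And>f. f \<in> V \<Longrightarrow> nm (T f) \<le> C * nm f" and f: "f \<in> V"
  shows "nm (T f) \<le> op_norm H T * nm f"
proof -
  have bdd: "bdd_above {nm (T f) |f. f \<in> V \<and> nm f \<le> 1}"
  proof (rule bdd_aboveI[of _ "\<bar>C\<bar>"], clarify)
    fix f assume f: "f \<in> V" "nm f \<le> 1"
    have "C * nm f \<le> \<bar>C\<bar> * nm f" using f by (intro mult_right_mono) auto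
    also have "\<dots> \<le> \<bar>C\<bar> * 1" using f by (intro mult_left_mono) auto
    finally show "nm (T f) \<le> \<bar>C\<bar>" using C[OF f(1)] by simp
  qed
  show ?thesis
  proof (cases "nm f = 0")
    case True
    hence "nm (T f) \<le> 0" using C[OF f] by simp
    thus ?thesis using True by simp
  next
    case False
    hence pos: "nm f > 0" using nm_nonneg[OF f] by linarith
    let ?c = "of_real (1 / nm f) :: complex"
    have c: "cmod ?c = 1 / nm f" by (subst norm_of_real) (use pos in simp)
    have "nm (\<lambda>z. ?c * f z) \<le> 1" unfolding nm_scale[OF f] c using pos by simp
    hence "nm (T (\<lambda>z. ?c * f z)) \<le> op_norm H T"
      unfolding op_norm_def using bdd scale_mem[OF f] by (intro cSup_upper) blast
    hence "1 / nm f * nm (T f) \<le> op_norm H T" unfolding T(2)[OF f] nm_scale[OF T(1)[OF f]] c .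
    thus ?thesis using pos by (simp add: field_simps)
  qed
qed

text \<open>Together with \<open>op_norm_le\<close> this trades the supremum in
  \<open>op_norm\<close> for pointwise estimates, the form in which approximation is used
  below.\<close>

lemma op_diff_bound:
  assumes T: "T \<in> bounded_ops H" and U: "U \<in> bounded_ops H" and f: "f \<in> V"
    and e: "op_norm H (op_diff H T U) \<le> e"
  shows "nm (\<lambda>z. T f z - U f z) \<le> e * nm f"
proof -
  obtain C1 where C1: "\<And>f. f \<in> V \<Longrightarrow> nm (T f) \<le> C1 * nm f" using bounded_opsD(5)[OF T] by blast
  obtain C2 where C2: "\<And>f. f \<in> V \<Longrightarrow> nm (U f) \<le> C2 * nm f" using bounded_opsD(5)[OF U] by blast
  let ?D = "op_diff H T U"
  note mem = bounded_opsD(1)[OF T] bounded_opsD(1)[OF U]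
  have "nm (?D f) \<le> op_norm H ?D * nm f"
  proof (rule op_norm_bound[where C = "C1 + C2", OF _ _ _ f])
    fix f c assume f: "f \<in> V"
    show "?D f \<in> V" using mem f by (simp add: op_diff_def)
    show "?D (\<lambda>z. c * f z) = (\<lambda>z. c * ?D f z)"
      using f bounded_opsD(4)[OF T f] bounded_opsD(4)[OF U f] by (simp add: op_diff_def right_diff_distrib)
    have "nm (?D f) \<le> nm (T f) + nm (U f)"
      using nm_triangle_diff[OF mem(1)[OF f] mem(2)[OF f]] f by (simp add: op_diff_def)
    thus "nm (?D f) \<le> (C1 + C2) * nm f" using C1[OF f] C2[OF f] by (simp add: distrib_right)
  qed
  also have "\<dots> \<le> e * nm f" using e f by (intro mult_right_mono) auto
  finally show ?thesis using f by (simp add: op_diff_def)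
qed

text \<open>A supremum of reals bounds its members only over a set bounded above; a crude sum of
  entry bounds provides this for \<open>op_mat_norm\<close>.\<close>

lemma op_mat_norm_bdd:
  fixes n :: nat
  assumes X: "\<And>i j. i < n \<Longrightarrow> j < n \<Longrightarrow> X i j \<in> bounded_ops H"
  shows "bdd_above {sqrt (\<Sum>i<n. (nm (\<lambda>z. \<Sum>j<n. X i j (f j) z))\<^sup>2) | f.
    (\<forall>j<n. f j \<in> V) \<and> (\<Sum>j<n. (nm (f j))\<^sup>2) \<le> 1}"
proof -
  have "\<exists>C. i < n \<longrightarrow> j < n \<longrightarrow> C \<ge> 0 \<and> (\<forall>f\<in>V. nm (X i j f) \<le> C * nm f)" for i j
    using bounded_opsD(5)[OF X, of i j] by metis
  then obtain C where C: "\<And>i j. i < n \<Longrightarrow> j < n \<Longrightarrow> C i j \<ge> 0"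
      "\<And>i j f. i < n \<Longrightarrow> j < n \<Longrightarrow> f \<in> V \<Longrightarrow> nm (X i j f) \<le> C i j * nm f"
    by metis
  have "sqrt (\<Sum>i<n. (nm (\<lambda>z. \<Sum>j<n. X i j (f j) z))\<^sup>2) \<le> sqrt (\<Sum>i<n. (\<Sum>j<n. C i j)\<^sup>2)"
    if f: "\<forall>j<n. f j \<in> V" "(\<Sum>j<n. (nm (f j))\<^sup>2) \<le> 1" for f
  proof (intro real_sqrt_le_mono sum_mono power_mono)
    fix i assume i: "i \<in> {..<n}"
    have mem: "X i j (f j) \<in> V" if "j < n" for j using bounded_opsD(1)[OF X] f i that by auto
    have f1: "nm (f j) \<le> 1" if "j < n" for j
    proof -
      have "(nm (f j))\<^sup>2 \<le> (\<Sum>j<n. (nm (f j))\<^sup>2)" using that by (intro member_le_sum) auto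
      thus ?thesis using f(2) by (metis abs_le_square_iff abs_one abs_of_nonneg f(1) nm_nonneg one_power2 order_trans that)
    qed
    have "nm (\<lambda>z. \<Sum>j<n. X i j (f j) z) \<le> (\<Sum>j<n. nm (X i j (f j)))"
      using mem by (intro nm_sum_le) auto
    also have "\<dots> \<le> (\<Sum>j<n. C i j)"
    proof (rule sum_mono)
      fix j assume j: "j \<in> {..<n}"
      have "nm (X i j (f j)) \<le> C i j * nm (f j)" using C(2) i j f(1) by auto
      also have "\<dots> \<le> C i j * 1" using C(1) i j f1 by (intro mult_left_mono) auto
      finally show "nm (X i j (f j)) \<le> C i j" by simp
    qed
    finally show "nm (\<lambda>z. \<Sum>j<n. X i j (f j) z) \<le> (\<Sum>j<n. C i j)" .
    show "0 \<le> nm (\<lambda>z. \<Sum>j<n. X i j (f j) z)" using mem by (intro nm_nonneg sum_mem) auto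
  qed
  thus ?thesis by (intro bdd_aboveI[of _ "sqrt (\<Sum>i<n. (\<Sum>j<n. C i j)\<^sup>2)"]) blast
qed

lemma op_mat_norm_ge:
  assumes X: "\<And>i j. i < n \<Longrightarrow> j < n \<Longrightarrow> X i j \<in> bounded_ops H"
    and f: "\<And>j. j < n \<Longrightarrow> f j \<in> V" "(\<Sum>j<n. (nm (f j))\<^sup>2) \<le> 1"
  shows "sqrt (\<Sum>i<n. (nm (\<lambda>z. \<Sum>j<n. X i j (f j) z))\<^sup>2) \<le> op_mat_norm H n X"
  unfolding op_mat_norm_def using f by (intro cSup_upper op_mat_norm_bdd X) blast+

lemma op_mat_norm_le:
  assumes "\<And>f. (\<And>j. j < n \<Longrightarrow> f j \<in> V) \<Longrightarrow> (\<Sum>j<n. (nm (f j))\<^sup>2) \<le> 1 \<Longrightarrow>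
      sqrt (\<Sum>i<n. (nm (\<lambda>z. \<Sum>j<n. X i j (f j) z))\<^sup>2) \<le> B"
  shows "op_mat_norm H n X \<le> B"
  unfolding op_mat_norm_def
proof (rule cSup_least)
  have "sqrt (\<Sum>i<n. (nm (\<lambda>z. \<Sum>j<n. X i j ((\<lambda>_ z. 0) j) z))\<^sup>2) \<in>
    {sqrt (\<Sum>i<n. (nm (\<lambda>z. \<Sum>j<n. X i j (f j) z))\<^sup>2) | f. (\<forall>j<n. f j \<in> V) \<and> (\<Sum>j<n. (nm (f j))\<^sup>2) \<le> 1}"
    by (intro CollectI exI[of _ "\<lambda>_ z. 0"]) auto
  thus "{sqrt (\<Sum>i<n. (nm (\<lambda>z. \<Sum>j<n. X i j (f j) z))\<^sup>2) | f.
    (\<forall>j<n. f j \<in> V) \<and> (\<Sum>j<n. (nm (f j))\<^sup>2) \<le> 1} \<noteq> {}" by blast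
qed (use assms in auto)

end

section \<open>Norms of scalar matrices, rows and columns\<close>

lemma cmat_norm_ge:
  assumes "(\<Sum>j<n. (cmod (v j))\<^sup>2) \<le> 1"
  shows "sqrt (\<Sum>i<n. (cmod (\<Sum>j<n. M i j * v j))\<^sup>2) \<le> cmat_norm n M"
  unfolding cmat_norm_def
proof (rule cSup_upper)
  show "bdd_above {sqrt (\<Sum>i<n. (cmod (\<Sum>j<n. M i j * v j))\<^sup>2) | v. (\<Sum>j<n. (cmod (v j))\<^sup>2) \<le> 1}"
  proof (rule bdd_aboveI[of _ "sqrt (\<Sum>i<n. (\<Sum>j<n. cmod (M i j))\<^sup>2)"], clarify)
    fix v :: "nat \<Rightarrow> complex" assume v: "(\<Sum>j<n. (cmod (v j))\<^sup>2) \<le> 1"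
    have v1: "cmod (v j) \<le> 1" if "j < n" for j
    proof -
      have "(cmod (v j))\<^sup>2 \<le> (\<Sum>j<n. (cmod (v j))\<^sup>2)" using that by (intro member_le_sum) auto
      hence "(cmod (v j))\<^sup>2 \<le> 1\<^sup>2" using v by simp
      thus ?thesis by (rule power2_le_imp_le) simp
    qed
    show "sqrt (\<Sum>i<n. (cmod (\<Sum>j<n. M i j * v j))\<^sup>2) \<le> sqrt (\<Sum>i<n. (\<Sum>j<n. cmod (M i j))\<^sup>2)"
      by (intro real_sqrt_le_mono sum_mono power_mono sum_norm_le)
        (auto simp: norm_mult intro!: mult_left_le v1)
  qed
qed (use assms in blast)

lemma cmat_norm_le:
  assumes "\<And>v. (\<Sum>j<n. (cmod (v j))\<^sup>2) \<le> 1 \<Longrightarrow> sqrt (\<Sum>i<n. (cmod (\<Sum>j<n. M i j * v j))\<^sup>2) \<le> B"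
  shows "cmat_norm n M \<le> B"
  unfolding cmat_norm_def
proof (rule cSup_least)
  show "{sqrt (\<Sum>i<n. (cmod (\<Sum>j<n. M i j * v j))\<^sup>2) | v. (\<Sum>j<n. (cmod (v j))\<^sup>2) \<le> 1} \<noteq> {}"
    by (auto intro!: exI[of _ "\<lambda>_. 0"])
qed (use assms in auto)

lemma cmat_norm_1: "cmat_norm 1 M = cmod (M 0 0)"
proof (rule antisym)
  show "cmat_norm 1 M \<le> cmod (M 0 0)"
  proof (rule cmat_norm_le)
    fix v :: "nat \<Rightarrow> complex" assume "(\<Sum>j<1. (cmod (v j))\<^sup>2) \<le> 1"
    hence "(cmod (v 0))\<^sup>2 \<le> 1\<^sup>2" by simp
    hence "cmod (v 0) \<le> 1" by (rule power2_le_imp_le) simp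
    thus "sqrt (\<Sum>i<1. (cmod (\<Sum>j<1. M i j * v j))\<^sup>2) \<le> cmod (M 0 0)"
      by (simp add: norm_mult mult_left_le)
  qed
  show "cmod (M 0 0) \<le> cmat_norm 1 M"
    using cmat_norm_ge[where v = "\<lambda>_. 1" and n = 1 and M = M] by simp
qed

lemma cmat_norm_row:
  assumes "cmat_norm n (\<lambda>i j. if i = 0 then c j else 0) \<le> 1" "n \<ge> 1"
  shows "(\<Sum>j<n. (cmod (c j))\<^sup>2) \<le> 1"
proof -
  define s where "s = sqrt (\<Sum>j<n. (cmod (c j))\<^sup>2)"
  have s2: "s\<^sup>2 = (\<Sum>j<n. (cmod (c j))\<^sup>2)" by (simp add: s_def sum_nonneg)
  have "s \<le> 1"
  proof (cases "s = 0")
    case False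
    hence s0: "s > 0" by (simp add: s_def sum_nonneg less_le)
    \<comment> \<open>The unit vector at which the row attains its norm \<open>s\<close>.\<close>
    let ?v = "\<lambda>j. cnj (c j) / of_real s"
    have "(\<Sum>j<n. (cmod (?v j))\<^sup>2) = s\<^sup>2 / s\<^sup>2"
      using s0 unfolding s2 sum_divide_distrib by (simp add: norm_divide power_divide s2)
    hence "(\<Sum>j<n. (cmod (?v j))\<^sup>2) \<le> 1" using s0 by simp
    from order_trans[OF cmat_norm_ge[OF this] assms(1)]
    have "sqrt (\<Sum>i<n. (cmod (\<Sum>j<n. (if i = 0 then c j else 0) * ?v j))\<^sup>2) \<le> 1" .
    moreover have "(\<Sum>i<n. (cmod (\<Sum>j<n. (if i = 0 then c j else 0) * ?v j))\<^sup>2)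
        = (\<Sum>i<n. if i = 0 then (cmod (\<Sum>j<n. c j * ?v j))\<^sup>2 else 0)"
      by (intro sum.cong) auto
    moreover have "(\<Sum>j<n. c j * ?v j) = of_real s"
    proof -
      have "(\<Sum>j<n. c j * ?v j) = (\<Sum>j<n. of_real ((cmod (c j))\<^sup>2)) / of_real s"
        by (simp add: sum_divide_distrib complex_norm_square del: of_real_power)
      also have "\<dots> = of_real (s\<^sup>2 / s)" unfolding s2 by simp
      finally show ?thesis using s0 by (simp add: power2_eq_square)
    qed
    ultimately have "s\<^sup>2 \<le> 1\<^sup>2" using s0 assms(2) by simp
    thus ?thesis by (rule power2_le_imp_le) simp
  qed simp
  thus ?thesis using s2 by (simp add: s_def)
qed

lemma cmat_norm_column:
  assumes "(\<Sum>j<n. (cmod (c j))\<^sup>2) \<le> 1" "n \<ge> 1"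
  shows "cmat_norm n (\<lambda>i j. if j = 0 then c i else 0) \<le> 1"
proof (rule cmat_norm_le)
  fix v :: "nat \<Rightarrow> complex" assume v: "(\<Sum>j<n. (cmod (v j))\<^sup>2) \<le> 1"
  have "(cmod (v 0))\<^sup>2 \<le> (\<Sum>j<n. (cmod (v j))\<^sup>2)" using assms(2) by (intro member_le_sum) auto
  hence v0: "(cmod (v 0))\<^sup>2 \<le> 1" using v by simp
  have "(\<Sum>j<n. (if j = 0 then c i else 0) * v j) = c i * v 0" for i
  proof -
    have "(\<Sum>j<n. (if j = 0 then c i else 0) * v j) = (\<Sum>j<n. if j = 0 then c i * v j else 0)"
      by (intro sum.cong) auto
    thus ?thesis using assms(2) by simp
  qed
  hence "(\<Sum>i<n. (cmod (\<Sum>j<n. (if j = 0 then c i else 0) * v j))\<^sup>2) = (\<Sum>i<n. (cmod (c i))\<^sup>2) * (cmod (v 0))\<^sup>2"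
    by (simp add: norm_mult power_mult_distrib sum_distrib_right)
  also have "\<dots> \<le> 1 * 1" using assms(1) v0 by (intro mult_mono) auto
  finally show "sqrt (\<Sum>i<n. (cmod (\<Sum>j<n. (if j = 0 then c i else 0) * v j))\<^sup>2) \<le> 1" by simp
qed

section \<open>Multiplication operators and weak-star closure\<close>

lemma (in fn_hilbert) mult_op_apply: "h \<in> V \<Longrightarrow> mult_op H \<phi> h = (\<lambda>z. \<phi> z * h z)"
  by (simp add: mult_op_def)

lemma (in fn_hilbert) on_ball_mult: "h \<in> V \<Longrightarrow> (\<lambda>z. on_ball p z * h z) = (\<lambda>z. p z * h z)"
  using supported by (auto simp: on_ball_def)

lemma (in ball_rkhs) multipliers_bounded:
  assumes "\<phi> \<in> multipliers H"
  obtains C where "C \<ge> 0" "\<And>f. f \<in> V \<Longrightarrow> nm (\<lambda>z. \<phi> z * f z) \<le> C * nm f"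
  using assms multiplier_bounded[of \<phi>] unfolding multipliers_def by blast

lemma (in ball_rkhs) multipliers_mem: "\<phi> \<in> multipliers H \<Longrightarrow> f \<in> V \<Longrightarrow> (\<lambda>z. \<phi> z * f z) \<in> V"
  by (simp add: multipliers_def)

lemma (in ball_rkhs) mult_op_bounded:
  assumes "\<phi> \<in> multipliers H"
  shows "mult_op H \<phi> \<in> bounded_ops H"
proof -
  obtain C where "\<And>f. f \<in> V \<Longrightarrow> nm (\<lambda>z. \<phi> z * f z) \<le> C * nm f"
    using multipliers_bounded[OF assms] by blast
  thus ?thesis
    using multipliers_mem[OF assms] 
    by (intro bounded_opsI[of _ C]) (auto simp: mult_op_def distrib_left mult.left_commute)
qed

lemma (in ui_cnp) poly_multiplier:
  assumes "polynomial_fn p"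
  shows "on_ball p \<in> multipliers H"
  using poly_mult_mem[OF assms] unfolding multipliers_def
  by (auto simp: supported_on_ball_def on_ball_mult) (simp add: on_ball_def)

lemma (in ball_rkhs) topspace_mult_weak_star: "topspace (mult_weak_star H) = multipliers H"
proof -
  have "bounded_ops H \<subseteq> topspace (weak_star_topology H)"
    unfolding weak_star_topology_def topology_generated_by_topspace
  proof (rule Union_upper, intro CollectI exI conjI)
    \<comment> \<open>Zero sequences and the whole plane exhibit the full operator space as a
      generating open set.\<close>
    show "bounded_ops H = {T \<in> bounded_ops H. (\<Sum>m. ip (T ((\<lambda>m z. 0) m)) ((\<lambda>m z. 0) m)) \<in> UNIV}"
      by simp
  qed auto
  thus ?thesis
    unfolding mult_weak_star_def topspace_pullback_topology using mult_op_bounded by blast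
qed

text \<open>The functional \<open>T \<mapsto> ip (T h) f\<close> is weak-star continuous: it belongs
  to sequences with \<open>h\<close> and \<open>f\<close> as their only nonzero terms. If it
  vanishes on a set, it vanishes on the closure.\<close>

lemma (in ball_rkhs) weak_star_closure_annihilates:
  assumes \<phi>: "\<phi> \<in> mult_weak_star H closure_of S" and h: "h \<in> V" and f: "f \<in> V"
    and S: "\<And>p. p \<in> S \<Longrightarrow> ip (\<lambda>z. p z * h z) f = 0"
  shows "ip (\<lambda>z. \<phi> z * h z) f = 0"
proof (rule ccontr)
  assume neq: "\<not> ?thesis"
  define x where "x m = (if m = 0 then h else (\<lambda>z. 0))" for m :: nat
  define y where "y m = (if m = 0 then f else (\<lambda>z. 0))" for m :: nat
  define W where "W = {T \<in> bounded_ops H. (\<Sum>m. ip (T (x m)) (y m)) \<in> - {0}}"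
  have "openin (weak_star_topology H) W"
    unfolding weak_star_topology_def
  proof (rule topology_generated_by_Basis, rule CollectI, rule exI[of _ x], rule exI[of _ y],
      rule exI[of _ "- {0}"], intro conjI)
    show "summable (\<lambda>m. (nm (x m))\<^sup>2)" by (rule summable_finite[of "{0}"]) (auto simp: x_def)
    show "summable (\<lambda>m. (nm (y m))\<^sup>2)" by (rule summable_finite[of "{0}"]) (auto simp: y_def)
    show "W = {T \<in> bounded_ops H. (\<Sum>m. ip (T (x m)) (y m)) \<in> - {0}}" by (fact W_def)
    show "\<forall>m. x m \<in> V" "\<forall>m. y m \<in> V" using h f by (auto simp: x_def y_def)
    show "open (- {0 :: complex})" by (simp add: open_Compl)
  qed
  hence op: "openin (mult_weak_star H) (mult_op H -` W \<inter> multipliers H)"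
    unfolding mult_weak_star_def openin_pullback_topology by blast
  have W: "mult_op H \<psi> \<in> W \<longleftrightarrow> ip (\<lambda>z. \<psi> z * h z) f \<noteq> 0" if \<psi>: "\<psi> \<in> multipliers H" for \<psi>
  proof -
    have "ip (mult_op H \<psi> (x m)) (y m) = 0" if "m \<notin> {0}" for m
      using that bounded_opsD(1)[OF mult_op_bounded[OF \<psi>]] by (simp add: x_def y_def)
    hence "(\<Sum>m. ip (mult_op H \<psi> (x m)) (y m)) = (\<Sum>m\<in>{0}. ip (mult_op H \<psi> (x m)) (y m))"
      by (intro suminf_finite) auto
    thus ?thesis using mult_op_bounded[OF \<psi>] h by (simp add: W_def x_def y_def mult_op_apply)
  qed
  have mem: "\<phi> \<in> multipliers H" using \<phi> topspace_mult_weak_star by (auto simp: in_closure_of)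
  hence "\<phi> \<in> mult_op H -` W \<inter> multipliers H" using W neq by simp
  moreover have "\<forall>T. \<phi> \<in> T \<and> openin (mult_weak_star H) T \<longrightarrow> (\<exists>y. y \<in> S \<and> y \<in> T)"
    using \<phi> unfolding in_closure_of by (rule conjunct2)
  ultimately obtain p where "p \<in> S" "p \<in> mult_op H -` W \<inter> multipliers H"
    using op by meson
  thus False using W[of p] S[of p] by simp
qed

section \<open>The quotient space of a homogeneous ideal and its projection\<close>

locale ideal_quotient = ui_cnp H k a b for H :: "('n::finite) fn_space" and k a b +
  fixes I G :: "'n fn set"
  assumes ideal: "multiplier_ideal H I"
    and G: "\<And>g. g \<in> G \<Longrightarrow> homogeneous_fn g"
    and I_eq: "I = mult_weak_star H closure_of (on_ball ` polynomial_ideal G)"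
begin

abbreviation "Q \<equiv> quotient_space H I"
abbreviation "K \<equiv> hcarrier Q"

lemma I_multipliers: "\<phi> \<in> I \<Longrightarrow> \<phi> \<in> multipliers H"
  using ideal by (auto simp: multiplier_ideal_def)

lemma polynomial_ideal_poly:
  assumes "p \<in> polynomial_ideal G" shows "polynomial_fn p"
proof -
  obtain N q g where "p = (\<lambda>z. \<Sum>i<(N::nat). q i z * g i z)" "\<forall>i<N. polynomial_fn (q i) \<and> g i \<in> G"
    using assms unfolding polynomial_ideal_def by blast
  thus ?thesis using G homogeneous_fn_polynomial by (auto intro!: polynomial_fn_intros)
qed

lemma polynomial_ideal_in_I: "p \<in> polynomial_ideal G \<Longrightarrow> on_ball p \<in> I"
proof -
  assume p: "p \<in> polynomial_ideal G"
  have "on_ball ` polynomial_ideal G \<subseteq> topspace (mult_weak_star H)"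
    using polynomial_ideal_poly poly_multiplier unfolding topspace_mult_weak_star by blast
  thus ?thesis unfolding I_eq using p by (meson closure_of_subset image_eqI subsetD)
qed

lemma poly_times_generator_in_I:
  assumes "polynomial_fn q" "g \<in> G" shows "on_ball (\<lambda>z. q z * g z) \<in> I"
proof (rule polynomial_ideal_in_I)
  show "(\<lambda>z. q z * g z) \<in> polynomial_ideal G"
    unfolding polynomial_ideal_def using assms
    by (intro CollectI exI[of _ 1] exI[of _ "\<lambda>_. q"] exI[of _ "\<lambda>_. g"]) auto
qed

lemma generator_in_I: "g \<in> G \<Longrightarrow> on_ball g \<in> I"
  using poly_times_generator_in_I[OF polynomial_fn_const[of 1]] by simp

lemma ideal_range_subset: "ideal_range H I \<subseteq> V"
  by (auto simp: ideal_range_def closed_span_def)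

lemma Q_eq: "Q = hsub H {f \<in> V. \<forall>g\<in>ideal_range H I. ip f g = 0}"
  by (simp add: quotient_space_def)

lemma Q_simps [simp]: "hinner Q = ip" "hnorm Q = nm"
  by (simp_all add: Q_eq)

sublocale K: fn_hilbert Q
  rewrites "hinner Q = ip" and "hnorm Q = nm"
proof -
  show "fn_hilbert Q" by unfold_locales (use hilbert_annihilator[OF ideal_range_subset] in \<open>simp add: Q_eq\<close>)
qed simp_all

lemma K_V: "f \<in> K \<Longrightarrow> f \<in> V"
  by (simp add: Q_eq)

text \<open>Orthogonality to the products passes to their closed span, by approximation with finite
  combinations.\<close>

lemma K_iff: "f \<in> K \<longleftrightarrow> f \<in> V \<and> (\<forall>\<phi>\<in>I. \<forall>h\<in>V. ip f (\<lambda>z. \<phi> z * h z) = 0)"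
proof
  assume f: "f \<in> K"
  have "ip f (\<lambda>z. \<phi> z * h z) = 0" if \<phi>: "\<phi> \<in> I" and h: "h \<in> V" for \<phi> h
  proof -
    have m: "(\<lambda>z. \<phi> z * h z) \<in> V" using multipliers_mem[OF I_multipliers[OF \<phi>] h] .
    have "(\<lambda>z. \<phi> z * h z) \<in> ideal_range H I"
      unfolding ideal_range_def closed_span_def
    proof (intro CollectI conjI m allI impI)
      fix e :: real assume "e > 0"
      hence "nm (\<lambda>z. \<phi> z * h z - (\<Sum>i<(1::nat). 1 * mult_op H \<phi> h z)) < e"
        using h by (simp add: mult_op_apply)
      thus "\<exists>(N::nat) c g. (\<forall>i<N. g i \<in> {mult_op H \<phi> f | \<phi> f. \<phi> \<in> I \<and> f \<in> V}) \<and>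
          nm (\<lambda>z. \<phi> z * h z - (\<Sum>i<N. c i * g i z)) < e"
        using \<phi> h by (intro exI[of _ 1] exI[of _ "\<lambda>_. 1"] exI[of _ "\<lambda>_. mult_op H \<phi> h"]) blast
    qed
    thus ?thesis using f by (simp add: Q_eq)
  qed
  thus "f \<in> V \<and> (\<forall>\<phi>\<in>I. \<forall>h\<in>V. ip f (\<lambda>z. \<phi> z * h z) = 0)" using K_V[OF f] by blast
next
  assume f: "f \<in> V \<and> (\<forall>\<phi>\<in>I. \<forall>h\<in>V. ip f (\<lambda>z. \<phi> z * h z) = 0)"
  have "ip f g = 0" if g: "g \<in> ideal_range H I" for g
  proof -
    have gV: "g \<in> V" using g ideal_range_subset by blast
    show ?thesis
    proof (rule eq_0_of_small_multiples)
      fix e :: real assume e: "e > 0"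
      obtain N c x where x: "\<forall>i<(N::nat). x i \<in> {mult_op H \<phi> f | \<phi> f. \<phi> \<in> I \<and> f \<in> V}"
        and lt: "nm (\<lambda>z. g z - (\<Sum>i<N. c i * x i z)) < e"
        using g e unfolding ideal_range_def closed_span_def by blast
      have xV: "x i \<in> V" if "i < N" for i
        using x that multipliers_mem[OF I_multipliers] by (auto simp: mult_op_apply)
      have x0: "ip f (x i) = 0" if "i < N" for i
        using x that f by (auto simp: mult_op_apply)
      have sV: "(\<lambda>z. \<Sum>i<N. c i * x i z) \<in> V" using xV by auto
      have "ip f (\<lambda>z. \<Sum>i<N. c i * x i z) = (\<Sum>i<N. ip f (\<lambda>z. c i * x i z))"
        using xV f by (intro ip_sum_right) auto
      also have "\<dots> = 0" using xV x0 f by (simp add: ip_scale_right)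
      finally have "ip f g = ip f (\<lambda>z. g z - (\<Sum>i<N. c i * x i z))"
        using ip_diff_right[OF gV sV, of f] f by simp
      also have "cmod \<dots> \<le> nm f * nm (\<lambda>z. g z - (\<Sum>i<N. c i * x i z))"
        using f gV sV by (intro cauchy_schwarz) auto
      also have "\<dots> \<le> nm f * e" using lt f by (intro mult_left_mono) auto
      finally show "cmod (ip f g) \<le> e * nm f" by (simp add: mult.commute)
    qed
  qed
  thus "f \<in> K" using f by (simp add: Q_eq)
qed

lemma K_orthogonal_generator:
  assumes "f \<in> K" "g \<in> G" "h \<in> V" shows "ip f (\<lambda>z. g z * h z) = 0"
  using assms generator_in_I[of g] on_ball_mult[of h g] unfolding K_iff by metis

text \<open>Membership needs testing on the homogeneous generators alone: polynomial coefficients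
  are absorbed into \<open>h\<close>, and the weak-star closure adds nothing by continuity.\<close>

lemma K_I:
  assumes f: "f \<in> V" and orth: "\<And>g h. g \<in> G \<Longrightarrow> h \<in> V \<Longrightarrow> ip (\<lambda>z. g z * h z) f = 0"
  shows "f \<in> K"
  unfolding K_iff
proof (intro conjI ballI f)
  fix \<phi> h assume \<phi>: "\<phi> \<in> I" and h: "h \<in> V"
  have gV: "(\<lambda>z. g z * h z) \<in> V" if "g \<in> G" "h \<in> V" for g h
    using that by (intro poly_mult_mem homogeneous_fn_polynomial G)
  have "ip (\<lambda>z. \<phi> z * h z) f = 0"
  proof (rule weak_star_closure_annihilates[OF _ h f])
    show "\<phi> \<in> mult_weak_star H closure_of (on_ball ` polynomial_ideal G)" using \<phi> I_eq by simp
    fix p assume "p \<in> on_ball ` polynomial_ideal G"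
    then obtain N q g where p: "p = on_ball (\<lambda>z. \<Sum>i<(N::nat). q i z * g i z)"
      and qg: "\<And>i. i < N \<Longrightarrow> polynomial_fn (q i)" "\<And>i. i < N \<Longrightarrow> g i \<in> G"
      unfolding polynomial_ideal_def by blast
    have qh: "(\<lambda>z. q i z * h z) \<in> V" if "i < N" for i using qg(1)[OF that] h by (rule poly_mult_mem)
    have eq: "(\<lambda>z. p z * h z) = (\<lambda>z. \<Sum>i<N. g i z * (q i z * h z))"
      unfolding p on_ball_mult[OF h] by (simp add: sum_distrib_left sum_distrib_right mult_ac)
    have "ip (\<lambda>z. p z * h z) f = (\<Sum>i<N. ip (\<lambda>z. g i z * (q i z * h z)) f)"
      unfolding eq by (rule ip_sum_left) (use gV[OF qg(2) qh] f in auto)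
    also have "\<dots> = 0" using orth qg(2) qh by simp
    finally show "ip (\<lambda>z. p z * h z) f = 0" .
  qed
  thus "ip f (\<lambda>z. \<phi> z * h z) = 0"
    using ip_cnj[OF multipliers_mem[OF I_multipliers[OF \<phi>] h] f] by simp
qed

definition P :: "'n fn \<Rightarrow> 'n fn" where "P f = proj_onto H K f"

text \<open>Riesz representation inside \<open>K\<close> for the functional
  \<open>x \<mapsto> ip x f\<close> produces the projection of \<open>f\<close>.\<close>

lemma P_exists: "f \<in> V \<Longrightarrow> \<exists>g\<in>K. \<forall>h\<in>K. ip (\<lambda>z. f z - g z) h = 0"
proof -
  assume f: "f \<in> V"
  obtain g where g: "g \<in> K" "\<And>x. x \<in> K \<Longrightarrow> ip x f = ip x g"
    by (rule K.riesz[of "\<lambda>x. ip x f" "nm f"])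
      (use f K_V cauchy_schwarz in \<open>auto simp: ip_add_left ip_scale_left mult.commute\<close>)
  have "ip (\<lambda>z. f z - g z) h = 0" if h: "h \<in> K" for h
    using g(2)[OF h] ip_cnj[OF f K_V[OF h]] ip_cnj[OF K_V[OF g(1)] K_V[OF h]] f K_V[OF g(1)] K_V[OF h]
    by (simp add: ip_diff_left) (metis complex_cnj_cancel_iff ip_cnj)
  thus ?thesis using g(1) by blast
qed

lemma P_unique:
  assumes f: "f \<in> V" and g: "g \<in> K" "\<And>h. h \<in> K \<Longrightarrow> ip (\<lambda>z. f z - g z) h = 0"
  shows "P f = g"
  unfolding P_def proj_onto_def
proof (rule the_equality)
  fix g' assume g': "g' \<in> K \<and> (\<forall>h\<in>K. ip (\<lambda>z. f z - g' z) h = 0)"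
  let ?d = "\<lambda>z. g z - g' z"
  have d: "?d \<in> K" using g(1) g' by simp
  have V: "g \<in> V" "g' \<in> V" "?d \<in> V" using g(1) g' d K_V by auto
  have "ip f ?d - ip g ?d = 0" "ip f ?d - ip g' ?d = 0"
    using g(2)[OF d] g' d f V by (auto simp: ip_diff_left)
  hence "ip ?d ?d = 0" using V by (simp add: ip_diff_left[of g g' ?d])
  hence "nm ?d = 0" using nm_sq[OF V(3)] by simp
  thus "g' = g" using nm_eq_0[OF V(3)] by (auto simp: fun_eq_iff)
qed (use g in blast)

lemma P_mem [simp, intro]: "f \<in> V \<Longrightarrow> P f \<in> K"
  and P_orth: "f \<in> V \<Longrightarrow> h \<in> K \<Longrightarrow> ip (\<lambda>z. f z - P f z) h = 0"
  using P_exists[of f] P_unique[of f] by metis+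

lemma ip_P: "f \<in> V \<Longrightarrow> h \<in> K \<Longrightarrow> ip (P f) h = ip f h"
  using P_orth[of f h] ip_diff_left[of f "P f" h] K_V by simp

lemma P_ident: "f \<in> K \<Longrightarrow> P f = f"
  by (rule P_unique) (use K_V in auto)

lemma P_eqI:
  assumes "f \<in> V" "g \<in> K" "\<And>h. h \<in> K \<Longrightarrow> ip f h = ip g h"
  shows "P f = g"
  by (rule P_unique) (use assms K_V in \<open>auto simp: ip_diff_left\<close>)

lemma P_add: "f \<in> V \<Longrightarrow> g \<in> V \<Longrightarrow> P (\<lambda>z. f z + g z) = (\<lambda>z. P f z + P g z)"
  by (rule P_eqI) (use K_V in \<open>auto simp: ip_add_left ip_P\<close>)

lemma P_scale: "f \<in> V \<Longrightarrow> P (\<lambda>z. c * f z) = (\<lambda>z. c * P f z)"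
  by (rule P_eqI) (use K_V in \<open>auto simp: ip_scale_left ip_P\<close>)

lemma P_diff: "f \<in> V \<Longrightarrow> g \<in> V \<Longrightarrow> P (\<lambda>z. f z - g z) = (\<lambda>z. P f z - P g z)"
  by (rule P_eqI) (use K_V in \<open>auto simp: ip_diff_left ip_P\<close>)

lemma nm_P: "f \<in> V \<Longrightarrow> nm (P f) \<le> nm f"
proof -
  assume f: "f \<in> V"
  have PV: "P f \<in> V" using f K_V by blast
  have "nm (P f) * nm (P f) = cmod (ip (P f) (P f))"
    unfolding ip_self[OF PV] by (simp add: power2_eq_square norm_mult PV)
  also have "\<dots> = cmod (ip f (P f))" using ip_P[OF f P_mem[OF f]] by simp
  also have "\<dots> \<le> nm f * nm (P f)" by (rule cauchy_schwarz[OF f PV])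
  finally show ?thesis using nm_nonneg[OF PV] nm_nonneg[OF f]
    by (metis mult_le_cancel_right not_le order_le_less)
qed

text \<open>The orthogonal complement of \<open>K\<close> is invariant under multiplication, because \<open>K\<close> is invariant
  under the adjoints.\<close>

lemma coinvariant:
  assumes \<psi>: "\<psi> \<in> multipliers H" and f: "f \<in> V" "\<And>h. h \<in> K \<Longrightarrow> ip f h = 0" and g: "g \<in> K"
  shows "ip (\<lambda>z. \<psi> z * f z) g = 0"
proof -
  obtain C where C: "C \<ge> 0" "\<And>f. f \<in> V \<Longrightarrow> nm (\<lambda>z. \<psi> z * f z) \<le> C * nm f"
    using multipliers_bounded[OF \<psi>] by blast
  have gV: "g \<in> V" using K_V[OF g] .
  note mem = multipliers_mem[OF \<psi>]
  \<comment> \<open>\<open>g'\<close> is the adjoint of multiplication by \<psi>, applied to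
    \<open>g\<close>.\<close>
  obtain g' where g': "g' \<in> V" "\<And>x. x \<in> V \<Longrightarrow> ip (\<lambda>z. \<psi> z * x z) g = ip x g'"
  proof (rule riesz[of "\<lambda>x. ip (\<lambda>z. \<psi> z * x z) g" "C * nm g"])
    fix x y c assume x: "x \<in> V"
    show "ip (\<lambda>z. \<psi> z * (c * x z)) g = c * ip (\<lambda>z. \<psi> z * x z) g"
      using ip_scale_left[OF mem[OF x] gV, of c] by (simp add: mult.left_commute)
    have "cmod (ip (\<lambda>z. \<psi> z * x z) g) \<le> nm (\<lambda>z. \<psi> z * x z) * nm g"
      by (rule cauchy_schwarz[OF mem[OF x] gV])
    also have "\<dots> \<le> (C * nm x) * nm g" using C(2)[OF x] gV by (intro mult_right_mono) auto
    finally show "cmod (ip (\<lambda>z. \<psi> z * x z) g) \<le> C * nm g * nm x" by (simp add: mult_ac)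
    assume y: "y \<in> V"
    show "ip (\<lambda>z. \<psi> z * (x z + y z)) g = ip (\<lambda>z. \<psi> z * x z) g + ip (\<lambda>z. \<psi> z * y z) g"
      using ip_add_left[OF mem[OF x] mem[OF y] gV] by (simp add: distrib_left)
  qed (use C gV in auto)
  have "g' \<in> K"
  proof (rule K_I[OF g'(1)])
    fix g0 h assume g0: "g0 \<in> G" and h: "h \<in> V"
    have gh: "(\<lambda>z. g0 z * h z) \<in> V" by (intro poly_mult_mem homogeneous_fn_polynomial G g0 h)
    \<comment> \<open>Commutativity moves \<psi> next to \<open>h\<close>, so the generator again
      multiplies a member of the space.\<close>
    have "ip (\<lambda>z. g0 z * h z) g' = ip (\<lambda>z. g0 z * (\<psi> z * h z)) g"
      using g'(2)[OF gh] by (simp add: mult.left_commute)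
    also have "\<dots> = 0"
    proof -
      have m: "(\<lambda>z. g0 z * (\<psi> z * h z)) \<in> V" using mem[OF gh] by (simp add: mult.left_commute)
      show ?thesis using K_orthogonal_generator[OF g g0 mem[OF h]] ip_cnj[OF gV m] by simp
    qed
    finally show "ip (\<lambda>z. g0 z * h z) g' = 0" .
  qed
  thus ?thesis using g'(2)[OF f(1)] f(2) by simp
qed

lemma compression_apply: "f \<in> K \<Longrightarrow> compression H I \<psi> f = P (\<lambda>z. \<psi> z * f z)"
  using K_V by (simp add: compression_def P_def mult_op_apply)

lemma compression_bounded:
  assumes \<psi>: "\<psi> \<in> multipliers H"
  shows "compression H I \<psi> \<in> bounded_ops Q"
proof -
  obtain C where C: "\<And>f. f \<in> V \<Longrightarrow> nm (\<lambda>z. \<psi> z * f z) \<le> C * nm f"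
    using multipliers_bounded[OF \<psi>] by blast
  note mem = multipliers_mem[OF \<psi> K_V]
  show ?thesis
  proof (rule K.bounded_opsI[of _ C, unfolded Q_simps])
    fix f assume f: "f \<in> K"
    show "compression H I \<psi> f \<in> K" using mem[OF f] by (simp add: compression_apply[OF f])
    show "nm (compression H I \<psi> f) \<le> C * nm f"
      unfolding compression_apply[OF f] using nm_P[OF mem[OF f]] C[OF K_V[OF f]] by linarith
    show "compression H I \<psi> (\<lambda>z. c * f z) = (\<lambda>z. c * compression H I \<psi> f z)" for c
      using P_scale[OF mem[OF f], of c] f by (simp add: compression_apply mult.left_commute)
    show "compression H I \<psi> (\<lambda>z. f z + g z) = (\<lambda>z. compression H I \<psi> f z + compression H I \<psi> g z)"
      if g: "g \<in> K" for g
      using P_add[OF mem[OF f] mem[OF g]] f g by (simp add: compression_apply distrib_left)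
  qed (simp add: compression_def)
qed

definition C :: "'n fn \<Rightarrow> 'n fn_op" where "C p = compression H I (on_ball p)"

lemma C_apply: "f \<in> K \<Longrightarrow> C p f = P (\<lambda>z. p z * f z)"
  using on_ball_mult[OF K_V] by (simp add: C_def compression_apply)

lemma C_eqI: "(\<And>f. f \<in> K \<Longrightarrow> C p f = T f) \<Longrightarrow> C p = (\<lambda>f\<in>K. T f)"
  by (auto simp: fun_eq_iff C_def compression_def)

lemma C_bounded: "polynomial_fn p \<Longrightarrow> C p \<in> bounded_ops Q"
  unfolding C_def by (intro compression_bounded poly_multiplier)

text \<open>The part of \<open>q f\<close> lost by the first projection is orthogonal to
  \<open>K\<close>, and multiplication by \<open>p\<close> keeps it there, so the intermediate
  projection makes no difference.\<close>

lemma C_mult: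
  assumes "polynomial_fn p" "polynomial_fn q" "f \<in> K"
  shows "C (\<lambda>z. p z * q z) f = C p (C q f)"
proof -
  have f: "f \<in> V" using K_V assms by blast
  have qf: "(\<lambda>z. q z * f z) \<in> V" and pqf: "(\<lambda>z. p z * (q z * f z)) \<in> V"
    using assms f by (auto intro!: poly_mult_mem)
  have PV: "P (\<lambda>z. q z * f z) \<in> V" using qf K_V by blast
  have pP: "(\<lambda>z. p z * P (\<lambda>z. q z * f z) z) \<in> V" using assms PV by (intro poly_mult_mem)
  have "P (\<lambda>z. p z * (q z * f z)) = P (\<lambda>z. p z * P (\<lambda>z. q z * f z) z)"
  proof (rule P_eqI[OF pqf])
    fix h assume h: "h \<in> K"
    let ?d = "\<lambda>z. q z * f z - P (\<lambda>z. q z * f z) z"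
    have d: "?d \<in> V" using qf PV by auto
    have "ip (\<lambda>z. on_ball p z * ?d z) h = 0"
      using P_orth[OF qf] by (intro coinvariant poly_multiplier assms d h) auto
    hence "ip (\<lambda>z. p z * (q z * f z) - p z * P (\<lambda>z. q z * f z) z) h = 0"
      unfolding on_ball_mult[OF d] by (simp add: right_diff_distrib)
    thus "ip (\<lambda>z. p z * (q z * f z)) h = ip (P (\<lambda>z. p z * P (\<lambda>z. q z * f z) z)) h"
      using pqf pP K_V[OF h] ip_P[OF pP h] by (simp add: ip_diff_left)
  qed (use pP in auto)
  thus ?thesis using assms qf by (simp add: C_apply mult.assoc)
qed

section \<open>The operator algebra as the closure of compressed polynomials\<close>

abbreviation "A \<equiv> quotient_alg H I"

lemma A_simps:
  "acarrier A = {T \<in> bounded_ops Q. \<forall>e>0. \<exists>\<phi>\<in>poly_closure H. op_norm Q (op_diff Q T (compression H I \<phi>)) < e}"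
  "aplus A = (\<lambda>T U. \<lambda>f\<in>K. \<lambda>z. T f z + U f z)"
  "ascale A = (\<lambda>c T. \<lambda>f\<in>K. \<lambda>z. c * T f z)"
  "atimes A = (\<lambda>T U. \<lambda>f\<in>K. T (U f))"
  "aone A = (\<lambda>f\<in>K. f)"
  "amat_norm A = op_mat_norm Q"
  by (simp_all add: quotient_alg_def Let_def)

lemma A_bounded: "T \<in> acarrier A \<Longrightarrow> T \<in> bounded_ops Q"
  by (simp add: A_simps)

lemma poly_in_poly_closure:
  assumes "polynomial_fn p" shows "on_ball p \<in> poly_closure H"
  unfolding poly_closure_def
proof (intro CollectI conjI poly_multiplier assms allI impI exI)
  fix e :: real assume e: "e > 0"
  have "op_norm H (op_diff H (mult_op H (on_ball p)) (mult_op H (on_ball p))) \<le> 0"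
    by (rule op_norm_le) (simp add: op_diff_def)
  thus "op_norm H (op_diff H (mult_op H (on_ball p)) (mult_op H (on_ball p))) < e" using e by simp
qed (rule assms)

text \<open>Two approximations with error \<open>e / 2\<close> are chained: by a member of
  \<open>poly_closure\<close> on the quotient, and of that member by a polynomial on
  \<open>H\<close>. Projecting does not enlarge the second error.\<close>

lemma A_iff:
  "T \<in> acarrier A \<longleftrightarrow> T \<in> bounded_ops Q \<and>
    (\<forall>e>0. \<exists>p. polynomial_fn p \<and> (\<forall>f\<in>K. nm (\<lambda>z. T f z - C p f z) \<le> e * nm f))" (is "_ \<longleftrightarrow> ?R")
proof
  assume T: "T \<in> acarrier A"
  have Tb: "T \<in> bounded_ops Q" using A_bounded[OF T] .
  have "\<exists>p. polynomial_fn p \<and> (\<forall>f\<in>K. nm (\<lambda>z. T f z - C p f z) \<le> e * nm f)" if e: "e > 0" for e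
  proof -
    obtain \<phi> where \<phi>: "\<phi> \<in> poly_closure H" "op_norm Q (op_diff Q T (compression H I \<phi>)) < e / 2"
      using T half_gt_zero[OF e] unfolding A_simps by blast
    have \<phi>m: "\<phi> \<in> multipliers H" using \<phi>(1) by (simp add: poly_closure_def)
    obtain p where p: "polynomial_fn p" "op_norm H (op_diff H (mult_op H \<phi>) (mult_op H (on_ball p))) < e / 2"
      using \<phi>(1) half_gt_zero[OF e] unfolding poly_closure_def by blast
    have 1: "nm (\<lambda>z. T f z - compression H I \<phi> f z) \<le> (e / 2) * nm f" if f: "f \<in> K" for f
      by (rule K.op_diff_bound[unfolded Q_simps, OF Tb compression_bounded[OF \<phi>m] f less_imp_le[OF \<phi>(2)]])
    have 2: "nm (\<lambda>z. \<phi> z * f z - p z * f z) \<le> (e / 2) * nm f" if f: "f \<in> V" for f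
      using op_diff_bound[OF mult_op_bounded[OF \<phi>m] mult_op_bounded[OF poly_multiplier[OF p(1)]] f
          less_imp_le[OF p(2)]]
      unfolding mult_op_apply[OF f] on_ball_mult[OF f] fun_cong[OF on_ball_mult[OF f]] .
    have "nm (\<lambda>z. T f z - C p f z) \<le> e * nm f" if f: "f \<in> K" for f
    proof -
      have m: "(\<lambda>z. \<phi> z * f z) \<in> V" "(\<lambda>z. p z * f z) \<in> V"
        using multipliers_mem[OF \<phi>m K_V[OF f]] poly_mult_mem[OF p(1) K_V[OF f]] by auto
      have m': "T f \<in> V" "compression H I \<phi> f \<in> V" "C p f \<in> V"
        using K.bounded_opsD(1)[OF Tb f] K.bounded_opsD(1)[OF compression_bounded[OF \<phi>m] f]
          K.bounded_opsD(1)[OF C_bounded[OF p(1)] f] K_V by auto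
      have "(\<lambda>z. compression H I \<phi> f z - C p f z) = P (\<lambda>z. \<phi> z * f z - p z * f z)"
        unfolding compression_apply[OF f] C_apply[OF f] using P_diff[OF m] by simp
      hence "nm (\<lambda>z. compression H I \<phi> f z - C p f z) \<le> (e / 2) * nm f"
        using nm_P[OF diff_mem[OF m]] 2[OF K_V[OF f]] by simp
      thus ?thesis using nm_triangle3[OF m'] 1[OF f] by (simp add: field_simps)
    qed
    thus ?thesis using p(1) by blast
  qed
  thus ?R using Tb by blast
next
  assume R: ?R
  show "T \<in> acarrier A"
    unfolding A_simps
  proof (intro CollectI conjI allI impI)
    show "T \<in> bounded_ops Q" using R by blast
    fix e :: real assume e: "e > 0"
    obtain p where p: "polynomial_fn p" "\<And>f. f \<in> K \<Longrightarrow> nm (\<lambda>z. T f z - C p f z) \<le> (e / 2) * nm f"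
      using R e by (meson half_gt_zero)
    have "op_norm Q (op_diff Q T (compression H I (on_ball p))) \<le> e / 2"
    proof (rule K.op_norm_le[unfolded Q_simps])
      fix f assume f: "f \<in> K" "nm f \<le> 1"
      have "(e / 2) * nm f \<le> (e / 2) * 1" using f e by (intro mult_left_mono) auto
      thus "nm (op_diff Q T (compression H I (on_ball p)) f) \<le> e / 2"
        using p(2)[OF f(1)] f by (simp add: op_diff_def C_def)
    qed
    thus "\<exists>\<phi>\<in>poly_closure H. op_norm Q (op_diff Q T (compression H I \<phi>)) < e"
      using poly_in_poly_closure[OF p(1)] e by (intro bexI[of _ "on_ball p"]) auto
  qed
qed

lemma C_in_A:
  assumes "polynomial_fn p" shows "C p \<in> acarrier A"
  unfolding A_iff
proof (intro conjI allI impI C_bounded assms)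
  fix e :: real assume "e > 0"
  thus "\<exists>q. polynomial_fn q \<and> (\<forall>f\<in>K. nm (\<lambda>z. C p f z - C q f z) \<le> e * nm f)"
    using assms K_V by (intro exI[of _ p]) auto
qed

lemma zero_op_in_A: "(\<lambda>f\<in>K. \<lambda>z. 0) \<in> acarrier A"
proof -
  have "C (\<lambda>z. 0) = (\<lambda>f\<in>K. \<lambda>z. 0)"
    by (rule C_eqI) (use P_ident[OF K.zero_mem] in \<open>simp add: C_apply\<close>)
  thus ?thesis using C_in_A[OF polynomial_fn_const, of 0] by simp
qed

end

section \<open>Consequences of a completely isometric Gelfand transform\<close>

locale gelfand_quotient = ideal_quotient H k a b I G for H :: "('n::finite) fn_space" and k a b I G +
  assumes gci: "gelfand_completely_isometric A"
begin

lemma char_le: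
  assumes "\<tau> \<in> character_space A" "n \<ge> 1" "\<And>i j. i < n \<Longrightarrow> j < n \<Longrightarrow> X i j \<in> acarrier A"
  shows "cmat_norm n (\<lambda>i j. \<tau> (X i j)) \<le> op_mat_norm Q n X"
proof -
  have "X \<in> mat_carrier A n" using assms(3) by (simp add: mat_carrier_def)
  hence "cmat_norm n (\<lambda>i j. gelfand A (X i j) \<tau>) \<le> amat_norm A n X"
    using gci assms(1,2) unfolding gelfand_completely_isometric_def by blast
  thus ?thesis using assms(1) by (simp add: gelfand_def A_simps)
qed

lemma char_attained:
  assumes "n \<ge> 1" "\<And>i j. i < n \<Longrightarrow> j < n \<Longrightarrow> X i j \<in> acarrier A"
  obtains \<tau> where "\<tau> \<in> character_space A" "cmat_norm n (\<lambda>i j. \<tau> (X i j)) = op_mat_norm Q n X"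
proof -
  have "X \<in> mat_carrier A n" using assms(2) by (simp add: mat_carrier_def)
  then obtain \<tau> where \<tau>: "\<tau> \<in> character_space A"
      "cmat_norm n (\<lambda>i j. gelfand A (X i j) \<tau>) = amat_norm A n X"
    using gci assms(1) unfolding gelfand_completely_isometric_def by blast
  thus ?thesis using that[of \<tau>] by (simp add: gelfand_def A_simps)
qed

text \<open>\<open>character_space\<close> is purely algebraic; continuity of characters is drawn
  from the Gelfand hypothesis for matrices of size one.\<close>

lemma char_bound:
  assumes \<tau>: "\<tau> \<in> character_space A" and T: "T \<in> acarrier A"
    and e: "e \<ge> 0" "\<And>f. f \<in> K \<Longrightarrow> nm (T f) \<le> e * nm f"
  shows "cmod (\<tau> T) \<le> e"
proof -
  have "cmod (\<tau> T) \<le> op_mat_norm Q 1 (\<lambda>i j. T)"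
    using char_le[OF \<tau>, of 1 "\<lambda>_ _. T"] T cmat_norm_1[of "\<lambda>_ _. \<tau> T"] by simp
  also have "\<dots> \<le> e"
  proof (rule K.op_mat_norm_le[unfolded Q_simps])
    fix f :: "nat \<Rightarrow> 'n fn"
    assume f: "\<And>j. j < 1 \<Longrightarrow> f j \<in> K" "(\<Sum>j<1. (nm (f j))\<^sup>2) \<le> 1"
    have f0: "f 0 \<in> K" using f(1) by simp
    have "(nm (f 0))\<^sup>2 \<le> 1\<^sup>2" using f(2) by simp
    hence "nm (f 0) \<le> 1" by (rule power2_le_imp_le) simp
    hence "e * nm (f 0) \<le> e * 1" using e by (intro mult_left_mono)
    hence "nm (T (f 0)) \<le> e" using e(2)[OF f0] by simp
    moreover have "nm (T (f 0)) \<ge> 0"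
      by (intro nm_nonneg K_V K.bounded_opsD(1)[OF A_bounded[OF T] f0])
    ultimately show "sqrt (\<Sum>i<(1::nat). (nm (\<lambda>z. \<Sum>j<(1::nat). T (f j) z))\<^sup>2) \<le> e" by simp
  qed
  finally show ?thesis .
qed

text \<open>The norm is attained at some character, so small character values force a small
  operator. This is the tool for passing from scalars back to operators.\<close>

lemma norm_bound:
  assumes T: "T \<in> acarrier A" and B: "\<And>\<tau>. \<tau> \<in> character_space A \<Longrightarrow> cmod (\<tau> T) \<le> B"
    and f: "f \<in> K"
  shows "nm (T f) \<le> B * nm f"
proof (cases "nm f = 0")
  case True
  hence "f = (\<lambda>z. 0)" using nm_eq_0 K_V f by blast
  thus ?thesis using K.bounded_ops_zero[OF A_bounded[OF T]] by simp
next
  case False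
  hence pos: "nm f > 0" using nm_nonneg[OF K_V[OF f]] by linarith
  let ?c = "of_real (1 / nm f) :: complex"
  have c: "cmod ?c = 1 / nm f" by (subst norm_of_real) (use pos in simp)
  have Tf: "T f \<in> V" by (rule K_V[OF K.bounded_opsD(1)[OF A_bounded[OF T] f]])
  let ?g = "\<lambda>z. ?c * f z"
  have g1: "nm ?g \<le> 1" unfolding nm_scale[OF K_V[OF f]] c using pos by simp
  note g = K.scale_mem[OF f, of ?c] g1
  obtain \<tau> where \<tau>: "\<tau> \<in> character_space A" "cmat_norm 1 (\<lambda>i j. \<tau> T) = op_mat_norm Q 1 (\<lambda>i j. T)"
    using char_attained[of 1 "\<lambda>_ _. T"] T by auto
  have "(\<Sum>j<(1::nat). (nm ?g)\<^sup>2) \<le> 1" using g(2) nm_nonneg[OF K_V[OF g(1)]] by (simp add: power_le_one)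
  hence "nm (T ?g) \<le> op_mat_norm Q 1 (\<lambda>i j. T)"
    using K.op_mat_norm_ge[of 1 "\<lambda>_ _. T" "\<lambda>_. ?g"] A_bounded[OF T] g
      nm_nonneg[OF K_V[OF K.bounded_opsD(1)[OF A_bounded[OF T] g(1)]]] by simp
  also have "\<dots> \<le> B" using \<tau> B[OF \<tau>(1)] cmat_norm_1[of "\<lambda>_ _. \<tau> T"] by simp
  finally have "1 / nm f * nm (T f) \<le> B"
    unfolding K.bounded_opsD(4)[OF A_bounded[OF T] f] nm_scale[OF Tf] c .
  thus ?thesis using pos by (simp add: field_simps)
qed

lemma charD:
  assumes "\<tau> \<in> character_space A"
  shows "\<And>x y. x \<in> acarrier A \<Longrightarrow> y \<in> acarrier A \<Longrightarrow> \<tau> (\<lambda>f\<in>K. \<lambda>z. x f z + y f z) = \<tau> x + \<tau> y"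
    "\<And>c x. x \<in> acarrier A \<Longrightarrow> \<tau> (\<lambda>f\<in>K. \<lambda>z. c * x f z) = c * \<tau> x"
    "\<And>x y. x \<in> acarrier A \<Longrightarrow> y \<in> acarrier A \<Longrightarrow> \<tau> (\<lambda>f\<in>K. x (y f)) = \<tau> x * \<tau> y"
    "\<tau> (\<lambda>f\<in>K. f) = 1"
  using assms unfolding character_space_def A_simps(2-5) by auto

lemma char_zero: "\<tau> \<in> character_space A \<Longrightarrow> \<tau> (\<lambda>f\<in>K. \<lambda>z. 0) = 0"
  using charD(2)[of \<tau> _ 0] zero_op_in_A by fastforce

text \<open>For commuting scalars a row and the corresponding column have the same norm.\<close>

lemma column_contraction:
  fixes n :: nat
  assumes x: "\<And>j. j < n \<Longrightarrow> x j \<in> acarrier A" and n: "n \<ge> 1"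
    and row: "\<And>f. (\<And>j. j < n \<Longrightarrow> f j \<in> K) \<Longrightarrow>
      nm (\<lambda>z. \<Sum>j<n. x j (f j) z) \<le> sqrt (\<Sum>j<n. (nm (f j))\<^sup>2)"
    and f: "f \<in> K" "nm f \<le> 1"
  shows "(\<Sum>i<n. (nm (x i f))\<^sup>2) \<le> 1"
proof -
  let ?zero = "\<lambda>f\<in>K. \<lambda>z. 0"
  \<comment> \<open>Row and column are padded with zeros to square matrices, the shape for which
    matrix norms are given.\<close>
  let ?X = "\<lambda>i j. if i = 0 then x j else ?zero" and ?Y = "\<lambda>i j. if j = 0 then x i else ?zero"
  have xV: "x j f \<in> V" if "j < n" "f \<in> K" for j f
    by (rule K_V[OF K.bounded_opsD(1)[OF A_bounded[OF x[OF that(1)]] that(2)]])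
  have "op_mat_norm Q n ?X \<le> 1"
  proof (rule K.op_mat_norm_le[unfolded Q_simps])
    fix f :: "nat \<Rightarrow> 'n fn"
    assume f: "\<And>j. j < n \<Longrightarrow> f j \<in> K" "(\<Sum>j<n. (nm (f j))\<^sup>2) \<le> 1"
    have e: "(\<lambda>z. \<Sum>j<n. ?X i j (f j) z) = (if i = 0 then (\<lambda>z. \<Sum>j<n. x j (f j) z) else (\<lambda>z. 0))" for i
      using f(1) by auto
    have "(\<Sum>i<n. (nm (\<lambda>z. \<Sum>j<n. ?X i j (f j) z))\<^sup>2)
        = (\<Sum>i<n. if i = 0 then (nm (\<lambda>z. \<Sum>j<n. x j (f j) z))\<^sup>2 else 0)"
      unfolding e by (intro sum.cong) auto
    also have "\<dots> = (nm (\<lambda>z. \<Sum>j<n. x j (f j) z))\<^sup>2" using n by simp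
    finally have eq: "(\<Sum>i<n. (nm (\<lambda>z. \<Sum>j<n. ?X i j (f j) z))\<^sup>2) = (nm (\<lambda>z. \<Sum>j<n. x j (f j) z))\<^sup>2" .
    have "0 \<le> nm (\<lambda>z. \<Sum>j<n. x j (f j) z)" using xV f(1) by (intro nm_nonneg sum_mem) auto
    moreover have "nm (\<lambda>z. \<Sum>j<n. x j (f j) z) \<le> 1"
      by (rule order_trans[OF row]) (use f in auto)
    ultimately show "sqrt (\<Sum>i<n. (nm (\<lambda>z. \<Sum>j<n. ?X i j (f j) z))\<^sup>2) \<le> 1"
      unfolding eq by simp
  qed
  hence r: "cmat_norm n (\<lambda>i j. \<tau> (?X i j)) \<le> 1" if "\<tau> \<in> character_space A" for \<tau>
    by (rule order_trans[OF char_le[OF that n], rotated]) (use x zero_op_in_A in auto)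
  \<comment> \<open>Under a character the column becomes the transpose of the row, and for scalars
    both norms are the Euclidean norm of the entries.\<close>
  have c: "cmat_norm n (\<lambda>i j. \<tau> (?Y i j)) \<le> 1" if \<tau>: "\<tau> \<in> character_space A" for \<tau>
  proof -
    have X: "(\<lambda>i j. \<tau> (?X i j)) = (\<lambda>i j. if i = 0 then \<tau> (x j) else 0)"
      using char_zero[OF \<tau>] by (auto simp: fun_eq_iff)
    have Y: "(\<lambda>i j. \<tau> (?Y i j)) = (\<lambda>i j. if j = 0 then \<tau> (x i) else 0)"
      using char_zero[OF \<tau>] by (auto simp: fun_eq_iff)
    show ?thesis
      unfolding Y by (rule cmat_norm_column[OF cmat_norm_row[OF r[OF \<tau>, unfolded X] n] n])
  qed
  have Y: "?Y i j \<in> acarrier A" if "i < n" for i j using x[OF that] zero_op_in_A by simp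
  obtain \<tau> where \<tau>: "\<tau> \<in> character_space A" "cmat_norm n (\<lambda>i j. \<tau> (?Y i j)) = op_mat_norm Q n ?Y"
    by (rule char_attained[OF n, of ?Y, OF Y])
  \<comment> \<open>\<open>f\<close> sits in slot 0, the slot that the nonzero column acts
    on.\<close>
  define F where "F j = (if j = 0 then f else (\<lambda>z. 0))" for j :: nat
  have F: "F j \<in> K" for j using f by (simp add: F_def)
  have "(\<Sum>j<n. (nm (F j))\<^sup>2) = (\<Sum>j<n. if j = 0 then (nm f)\<^sup>2 else 0)"
    by (intro sum.cong) (auto simp: F_def)
  also have "\<dots> \<le> 1" using n f K_V by (simp add: power_le_one)
  finally have "sqrt (\<Sum>i<n. (nm (\<lambda>z. \<Sum>j<n. ?Y i j (F j) z))\<^sup>2) \<le> op_mat_norm Q n ?Y"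
    using F by (intro K.op_mat_norm_ge[unfolded Q_simps] A_bounded Y)
  also have "\<dots> \<le> 1" using \<tau>(2) c[OF \<tau>(1)] by simp
  also have "(\<Sum>i<n. (nm (\<lambda>z. \<Sum>j<n. ?Y i j (F j) z))\<^sup>2) = (\<Sum>i<n. (nm (x i f))\<^sup>2)"
  proof (intro sum.cong refl arg_cong[where f = "\<lambda>f. (nm f)\<^sup>2"] ext)
    fix i z assume "i \<in> {..<n}"
    have "(\<Sum>j<n. ?Y i j (F j) z) = (\<Sum>j<n. if j = 0 then x i f z else 0)"
      using F by (intro sum.cong) (auto simp: F_def)
    thus "(\<Sum>j<n. ?Y i j (F j) z) = x i f z" using n by simp
  qed
  finally show ?thesis by simp
qed

lemma C_const: "C (\<lambda>z. c) = (\<lambda>f\<in>K. \<lambda>z. c * f z)"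
  by (rule C_eqI) (use P_ident K.scale_mem in \<open>simp add: C_apply\<close>)

lemma C_add:
  assumes "polynomial_fn p" "polynomial_fn q"
  shows "C (\<lambda>z. p z + q z) = (\<lambda>f\<in>K. \<lambda>z. C p f z + C q f z)"
  by (rule C_eqI)
    (simp add: C_apply distrib_right P_add poly_mult_mem assms K_V)

lemma C_scale:
  assumes "polynomial_fn p"
  shows "C (\<lambda>z. c * p z) = (\<lambda>f\<in>K. \<lambda>z. c * C p f z)"
  by (rule C_eqI) (simp add: C_apply mult.assoc P_scale poly_mult_mem assms K_V)

lemma C_mult_op:
  assumes "polynomial_fn p" "polynomial_fn q"
  shows "C (\<lambda>z. p z * q z) = (\<lambda>f\<in>K. C p (C q f))"
  by (intro C_eqI C_mult assms)

lemma one_op_in_A: "(\<lambda>f\<in>K. f) \<in> acarrier A"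
  using C_in_A[OF polynomial_fn_const, of 1] by (simp add: C_const)

lemma char_poly:
  assumes \<tau>: "\<tau> \<in> character_space A" and p: "polynomial_fn p"
  shows "\<tau> (C p) = p (\<chi> i. \<tau> (C (\<lambda>z. z $ i)))"
  using p
proof (induction p rule: polynomial_fn_induct)
  case (const c)
  have eq: "C (\<lambda>z. c) = (\<lambda>f\<in>K. \<lambda>z. c * (\<lambda>f\<in>K. f) f z)" by (auto simp: C_const fun_eq_iff)
  show ?case unfolding eq charD(2)[OF \<tau> one_op_in_A] charD(4)[OF \<tau>] by simp
next
  case (add p q)
  show ?case
    unfolding C_add[OF add(1,2)] charD(1)[OF \<tau> C_in_A[OF add(1)] C_in_A[OF add(2)]] add(3,4) ..
next
  case (mult p q)
  show ?case
    unfolding C_mult_op[OF mult(1,2)] charD(3)[OF \<tau> C_in_A[OF mult(1)] C_in_A[OF mult(2)]] mult(3,4) ..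
qed simp

text \<open>Compressing a contractive row of multiplications leaves it contractive, since
  \<open>P\<close> does not increase norms. The resulting column is evaluated at \<open>one\<close>,
  a unit vector.\<close>

lemma column_poly:
  fixes n :: nat
  assumes p: "\<And>j. j < n \<Longrightarrow> polynomial_fn (p j)" and n: "n \<ge> 1"
    and row: "\<And>f. (\<And>j. j < n \<Longrightarrow> f j \<in> V) \<Longrightarrow>
      nm (\<lambda>z. \<Sum>j<n. p j z * f j z) \<le> sqrt (\<Sum>j<n. (nm (f j))\<^sup>2)"
    and one: "one \<in> K"
  shows "(\<Sum>i<n. (nm (P (\<lambda>z. p i z * one z)))\<^sup>2) \<le> 1"
proof -
  have "(\<Sum>i<n. (nm (C (p i) one))\<^sup>2) \<le> 1"
  proof (rule column_contraction[OF _ n])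
    fix f :: "nat \<Rightarrow> 'n fn" assume f: "\<And>j. j < n \<Longrightarrow> f j \<in> K"
    have pf: "(\<lambda>z. p j z * f j z) \<in> V" if "j < n" for j
      using poly_mult_mem[OF p[OF that] K_V[OF f[OF that]]] .
    have sV: "(\<lambda>z. \<Sum>j<n. p j z * f j z) \<in> V" using pf by (intro sum_mem) auto
    have "P (\<lambda>z. \<Sum>j<m. p j z * f j z) = (\<lambda>z. \<Sum>j<m. P (\<lambda>z. p j z * f j z) z)" if "m \<le> n" for m
      using that
    proof (induction m)
      case (Suc m)
      have "(\<lambda>z. \<Sum>j<m. p j z * f j z) \<in> V" using pf Suc.prems by (intro sum_mem) auto
      thus ?case using P_add[OF _ pf[of m]] Suc by simp
    qed (use P_ident[OF K.zero_mem] in simp)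
    hence "P (\<lambda>z. \<Sum>j<n. p j z * f j z) = (\<lambda>z. \<Sum>j<n. P (\<lambda>z. p j z * f j z) z)" by simp
    also have "\<dots> = (\<lambda>z. \<Sum>j<n. C (p j) (f j) z)"
      using f by (intro ext sum.cong) (auto simp: C_apply)
    finally have "nm (\<lambda>z. \<Sum>j<n. C (p j) (f j) z) \<le> nm (\<lambda>z. \<Sum>j<n. p j z * f j z)"
      using nm_P[OF sV] by simp
    also have "\<dots> \<le> sqrt (\<Sum>j<n. (nm (f j))\<^sup>2)" using row[of f] f K_V by blast
    finally show "nm (\<lambda>z. \<Sum>j<n. C (p j) (f j) z) \<le> sqrt (\<Sum>j<n. (nm (f j))\<^sup>2)" .
  qed (use p C_in_A one nm_one in auto)
  thus ?thesis using one by (simp add: C_apply)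
qed

end

section \<open>Linear forms acting on the quotient\<close>

locale proper_gelfand_quotient = gelfand_quotient +
  assumes proper: "I \<noteq> multipliers H" and dim: "dim_gt_one Q"
begin

text \<open>A nonzero constant would put \<open>one\<close> into the ideal, which would then contain
  every multiplier, against properness.\<close>

lemma degree_zero_generator:
  assumes g: "g \<in> G" and hom: "\<And>t z. g (t *s z) = t ^ 0 * g z"
  shows "g = (\<lambda>z. 0)"
proof -
  have const: "g z = g 0" for z using hom[of 0 z] by simp
  have "g 0 = 0"
  proof (rule ccontr)
    assume "g 0 \<noteq> 0"
    hence "1 / g 0 * g z = 1" for z using const[of z] by simp
    hence "on_ball (\<lambda>z. (1 / g 0) * g z) = one" by (simp only: one_def)
    hence 1: "one \<in> I" using poly_times_generator_in_I[OF polynomial_fn_const g] by metis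
    have "\<psi> \<in> I" if \<psi>: "\<psi> \<in> multipliers H" for \<psi>
    proof -
      have "(\<lambda>z. \<psi> z * one z) \<in> I" using ideal 1 \<psi> unfolding multiplier_ideal_def by blast
      moreover have "\<psi> z * one z = \<psi> z" for z
        using \<psi> by (auto simp: one_def on_ball_def multipliers_def supported_on_ball_def)
      ultimately show ?thesis by simp
    qed
    thus False using proper I_multipliers by blast
  qed
  thus ?thesis using const by auto
qed

text \<open>Pairing with \<open>one\<close> is evaluation at the origin, where every generator
  vanishes.\<close>

lemma one_in_K: "one \<in> K"
proof (rule K_I[OF one_mem])
  fix g h assume g: "g \<in> G" and h: "h \<in> V"
  obtain m where m: "\<And>t z. g (t *s z) = t ^ m * g z" using homogeneous_fn_cases[OF G[OF g]] by metis
  have "(\<lambda>z. g z * h z) \<in> V" by (intro poly_mult_mem homogeneous_fn_polynomial G g h)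
  hence "ip (\<lambda>z. g z * h z) one = g 0 * h 0" by (rule ip_one)
  moreover have "g 0 = 0"
  proof (cases "m = 0")
    case True
    thus ?thesis using degree_zero_generator[OF g] m by metis
  next
    case False
    thus ?thesis using m[of 0 0] by (simp add: power_0_left)
  qed
  ultimately show "ip (\<lambda>z. g z * h z) one = 0" by simp
qed

text \<open>The vectors \<xi> whose linear form acts as zero on the quotient; orthogonality to all
  of \<open>K\<close> expresses that the projected product vanishes.\<close>

definition S :: "(complex ^ 'a) set" where
  "S = {\<xi>. \<forall>f\<in>K. \<forall>h\<in>V. ip (\<lambda>z. vinner z \<xi> * h z) f = 0}"

lemma vinner_mult_mem: "h \<in> V \<Longrightarrow> (\<lambda>z. vinner z \<xi> * h z) \<in> V"
  by (intro poly_mult_mem polynomial_fn_intros)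

lemma S_add: "\<xi> \<in> S \<Longrightarrow> \<eta> \<in> S \<Longrightarrow> \<xi> + \<eta> \<in> S"
  using ip_add_left[OF vinner_mult_mem vinner_mult_mem] K_V
  by (simp add: S_def vinner_add_right distrib_right)

lemma S_scale: "\<xi> \<in> S \<Longrightarrow> c *s \<xi> \<in> S"
  using ip_scale_left[OF vinner_mult_mem, of _ _ "cnj c"] K_V
  by (simp add: S_def vinner_scale_right mult.assoc)

lemma subspace_S: "subspace S"
  unfolding subspace_def
proof (intro conjI ballI allI)
  show "0 \<in> S" using K_V by (simp add: S_def)
  show "c *\<^sub>R \<xi> \<in> S" if "\<xi> \<in> S" for c \<xi>
  proof -
    have "c *\<^sub>R \<xi> = (of_real c :: complex) *s \<xi>" by (simp add: vec_eq_iff scaleR_conv_of_real[where 'a = complex])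
    thus ?thesis using S_scale[OF that] by simp
  qed
qed (use S_add in blast)

lemma S_decomp:
  obtains y z where "y \<in> S" "\<And>\<xi>. \<xi> \<in> S \<Longrightarrow> vinner z \<xi> = 0" "x = y + z"
proof -
  obtain y z where yz: "y \<in> span S" "\<And>w. w \<in> span S \<Longrightarrow> orthogonal z w" "x = y + z"
    using orthogonal_subspace_decomp_exists[of S x] by blast
  have S: "span S = S" using subspace_S by (simp add: span_eq_iff)
  have "vinner z \<xi> = 0" if \<xi>: "\<xi> \<in> S" for \<xi>
  proof -
    \<comment> \<open>The library decomposition is orthogonal for the real inner product; since
      \<open>S\<close> is a complex subspace, testing with \<open>\<i> *s \<xi>\<close> also kills
      the imaginary part.\<close>
    have 1: "z \<bullet> \<xi> = 0" and 2: "z \<bullet> (\<i> *s \<xi>) = 0"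
      using yz(2) \<xi> S_scale[OF \<xi>, of \<i>] unfolding S orthogonal_def by auto
    show ?thesis using 1 2 by (simp add: inner_eq_Re_vinner vinner_scale_right complex_eq_iff)
  qed
  thus ?thesis using that yz S by blast
qed

text \<open>Pairing with \<open>pf 1 \<zeta>\<close> sees only the degree one part. A generator of
  degree above one contributes none, a linear generator belongs to a vector of \<open>S\<close> and
  hence vanishes at \<zeta>, and constant generators are zero.\<close>

lemma linear_form_in_K:
  assumes \<zeta>: "\<And>\<xi>. \<xi> \<in> S \<Longrightarrow> vinner \<zeta> \<xi> = 0"
  shows "pf 1 \<zeta> \<in> K"
proof (rule K_I[OF pf_mem])
  fix g h assume g: "g \<in> G" and h: "h \<in> V"
  obtain m where m: "\<And>t z. g (t *s z) = t ^ m * g z" "m = 1 \<Longrightarrow> \<exists>\<gamma>. g = (\<lambda>z. vinner z \<gamma>)"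
    using homogeneous_fn_cases[OF G[OF g]] by metis
  have gh: "(\<lambda>z. g z * h z) \<in> V" if "h \<in> V" for h
    by (intro poly_mult_mem homogeneous_fn_polynomial G g that)
  have "1 < m \<or> g \<zeta> = 0"
  proof -
    consider "m = 0" | "m = 1" | "1 < m" by linarith
    thus ?thesis
    proof cases
      case 1
      thus ?thesis using degree_zero_generator[OF g] m(1) by metis
    next
      case 2
      then obtain \<gamma> where \<gamma>: "g = (\<lambda>z. vinner z \<gamma>)" using m(2) by blast
      have "ip (\<lambda>z. vinner z \<gamma> * h z) f = 0" if "f \<in> K" "h \<in> V" for f h
        using K_orthogonal_generator[OF that(1) g that(2)] ip_cnj[OF K_V[OF that(1)] gh[OF that(2)]]
        unfolding \<gamma> by simp
      hence "\<gamma> \<in> S" by (simp add: S_def)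
      thus ?thesis using \<zeta> \<gamma> by simp
    qed simp
  qed
  hence "of_real (a 1) * ip (\<lambda>z. g z * h z) (pf 1 \<zeta>) = 0"
    using ip_homogeneous_mult[of g \<zeta> m h 1, OF m(1) h gh[OF h]] by auto
  thus "ip (\<lambda>z. g z * h z) (pf 1 \<zeta>) = 0" using a_pos[of 1] by simp
qed

lemma vinner_power_one: "(\<lambda>z. (c * vinner z u ^ n) * one z) = (\<lambda>z. c * pf n u z)"
  by (auto simp: one_def pf_def on_ball_def)

lemma no_orthonormal_pair:
  assumes u: "vinner u u = 1" "\<And>\<xi>. \<xi> \<in> S \<Longrightarrow> vinner u \<xi> = 0"
    and v: "vinner v v = 1" "\<And>\<xi>. \<xi> \<in> S \<Longrightarrow> vinner v \<xi> = 0" and uv: "vinner u v = 0"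
  shows False
proof -
  define p where "p i z = of_real (sqrt (b 1)) * (if i = 0 then vinner z u else vinner z v)"
    for i :: nat and z
  have poly: "polynomial_fn (p i)" for i
    unfolding p_def by (cases "i = 0") (auto intro: polynomial_fn_intros)
  have le: "(\<Sum>i<2. (nm (P (\<lambda>z. p i z * one z)))\<^sup>2) \<le> 1"
  proof (rule column_poly[OF poly _ _ one_in_K])
    fix f :: "nat \<Rightarrow> 'a fn" assume "\<And>j. j < 2 \<Longrightarrow> f j \<in> V"
    thus "nm (\<lambda>z. \<Sum>j<2. p j z * f j z) \<le> sqrt (\<Sum>j<2. (nm (f j))\<^sup>2)"
      unfolding p_def using row_orthonormal[OF u(1) v(1) uv, of f] by blast
  qed simp
  have *: "(nm (P (\<lambda>z. (of_real (sqrt (b 1)) * vinner z w) * one z)))\<^sup>2 = 1"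
    if w: "vinner w w = 1" "\<And>\<xi>. \<xi> \<in> S \<Longrightarrow> vinner w \<xi> = 0" for w
  proof -
    have K: "pf 1 w \<in> K" by (rule linear_form_in_K[OF w(2)])
    have "P (\<lambda>z. (of_real (sqrt (b 1)) * vinner z w) * one z) = (\<lambda>z. of_real (sqrt (b 1)) * pf 1 w z)"
      using vinner_power_one[of "of_real (sqrt (b 1))" w 1] P_ident[OF K.scale_mem[OF K]] by simp
    hence "(nm (P (\<lambda>z. (of_real (sqrt (b 1)) * vinner z w) * one z)))\<^sup>2 = b 1 * (1 / a 1)"
      using b_nonneg[of 0] nm_pf[OF w(1), of 1] by (simp add: nm_scale power_mult_distrib)
    thus ?thesis using b_1 a_pos[of 1] by simp
  qed
  show False using le *[OF u] *[OF v] by (simp add: p_def numeral_2_eq_2)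
qed

text \<open>If all linear forms acted as zero, every member of \<open>K\<close> would have only its
  degree zero part, and \<open>K\<close> would consist of constants.\<close>

lemma S_not_UNIV: "S \<noteq> UNIV"
proof
  assume S: "S = UNIV"
  have const: "f w = f 0 * one w" if f: "f \<in> K" for f w
  proof (cases "w \<in> ball 0 1")
    case True
    have "ip f (pf (Suc n) w) = 0" for n
    proof -
      have "pf (Suc n) w = (\<lambda>z. vinner z w * pf n w z)" by (auto simp: pf_def on_ball_def)
      moreover have "ip (\<lambda>z. vinner z w * pf n w z) f = 0" using S f pf_mem by (auto simp: S_def)
      ultimately show ?thesis using ip_cnj[OF pf_mem K_V[OF f], of "Suc n" w] by simp
    qed
    hence "(\<lambda>n. of_real (a n) * ip f (pf n w)) = (\<lambda>n. if n = 0 then ip f one else 0)"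
      by (auto simp: fun_eq_iff gr0_conv_Suc pf_0 a_0)
    hence "(\<lambda>n. if n = 0 then ip f one else 0) sums f w" using expand[OF K_V[OF f] True] by simp
    moreover have "(\<lambda>n. if n = 0 then ip f one else 0) sums ip f one"
      using sums_single[of 0 "\<lambda>_. ip f one"] by simp
    ultimately have "f w = ip f one" by (rule sums_unique2)
    thus ?thesis using ip_one[OF K_V[OF f]] True by (simp add: one_def on_ball_def)
  next
    case False
    thus ?thesis using supported[OF K_V[OF f] False] by (simp add: one_def on_ball_def)
  qed
  obtain f g where fg: "f \<in> K" "g \<in> K"
    and ind: "\<And>c d. (\<lambda>z. c * f z + d * g z) = (\<lambda>z. 0) \<Longrightarrow> c = 0 \<and> d = 0"
    using dim unfolding dim_gt_one_def by blast
  \<comment> \<open>The linear dependence between two constant functions; independence yields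
    \<open>f 0 = 0\<close>, so \<open>f\<close> vanishes.\<close>
  have "g 0 * f z + - f 0 * g z = 0" for z
    using const[OF fg(1), of z] const[OF fg(2), of z] by simp
  hence f0: "f 0 = 0" using ind[of "g 0" "- f 0"] by simp
  have "f w = 0" for w using const[OF fg(1), of w] f0 by simp
  thus False using ind[of 1 0] by simp
qed

lemma normalized:
  assumes "z \<noteq> 0" shows "vinner (of_real (1 / norm z) *s z) (of_real (1 / norm z) *s z) = 1"
  using assms by (simp add: vinner_self_unit norm_vec_scale norm_divide)

text \<open>The orthogonal complement of \<open>S\<close> is nonzero, and a second direction in it
  would give the forbidden orthonormal pair. So it is the line of \<zeta>.\<close>

lemma exists_axis:
  obtains \<zeta> where "vinner \<zeta> \<zeta> = 1" "\<And>\<xi>. \<xi> \<in> S \<Longrightarrow> vinner \<zeta> \<xi> = 0" "\<And>\<xi>. vinner \<xi> \<zeta> = 0 \<Longrightarrow> \<xi> \<in> S"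
proof -
  obtain x where x: "x \<notin> S" using S_not_UNIV by blast
  obtain y z where yz: "y \<in> S" "\<And>\<xi>. \<xi> \<in> S \<Longrightarrow> vinner z \<xi> = 0" "x = y + z"
    using S_decomp[of x] by blast
  have z0: "z \<noteq> 0" using x yz by auto
  define \<zeta> where "\<zeta> = of_real (1 / norm z) *s z"
  have u: "vinner \<zeta> \<zeta> = 1" unfolding \<zeta>_def by (rule normalized[OF z0])
  have S: "vinner \<zeta> \<xi> = 0" if "\<xi> \<in> S" for \<xi> using yz(2)[OF that] by (simp add: \<zeta>_def vinner_scale_left)
  have "\<xi> \<in> S" if \<xi>: "vinner \<xi> \<zeta> = 0" for \<xi>
  proof -
    obtain y' z' where yz': "y' \<in> S" "\<And>\<xi>. \<xi> \<in> S \<Longrightarrow> vinner z' \<xi> = 0" "\<xi> = y' + z'"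
      using S_decomp[of \<xi>] by blast
    have "z' = 0"
    proof (rule ccontr)
      assume z': "z' \<noteq> 0"
      have "vinner y' \<zeta> = 0" using S[OF yz'(1)] cnj_vinner[of \<zeta> y'] by simp
      hence "vinner z' \<zeta> = 0" using \<xi> yz'(3) by (simp add: vinner_add_left)
      thus False
        using no_orthonormal_pair[OF normalized[OF z'] _ u S] yz'(2) by (simp add: vinner_scale_left)
    qed
    thus ?thesis using yz' by simp
  qed
  thus ?thesis using that u S by blast
qed

lemma C_S:
  assumes "\<xi> \<in> S" "f \<in> K" shows "C (\<lambda>z. vinner z \<xi>) f = (\<lambda>z. 0)"
  unfolding C_apply[OF assms(2)]
proof (rule P_eqI[OF vinner_mult_mem[OF K_V[OF assms(2)]] K.zero_mem])
  fix h assume h: "h \<in> K"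
  have "ip (\<lambda>z. vinner z \<xi> * f z) h = 0"
    using assms(1) h K_V[OF assms(2)] unfolding S_def by blast
  thus "ip (\<lambda>z. vinner z \<xi> * f z) h = ip (\<lambda>z. 0) h" using K_V[OF h] by simp
qed

end

section \<open>The disc algebra\<close>

lemma norm_scale_unit: "vinner u u = 1 \<Longrightarrow> norm (c *s u) = cmod c"
  by (simp add: norm_vec_scale vinner_self_unit)

locale axis_quotient = proper_gelfand_quotient H k a b I G
  for H :: "('n::finite) fn_space" and k a b I G +
  fixes \<zeta> :: "complex ^ 'n"
  assumes maximal: "maximal_cnp b"
    and unit: "vinner \<zeta> \<zeta> = 1"
    and orth_S: "\<And>\<xi>. \<xi> \<in> S \<Longrightarrow> vinner \<zeta> \<xi> = 0"
    and S_orth: "\<And>\<xi>. vinner \<xi> \<zeta> = 0 \<Longrightarrow> \<xi> \<in> S"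
begin

definition u :: "'n fn_op" where "u = C (\<lambda>z. vinner z \<zeta>)"

lemma u_in_A: "u \<in> acarrier A"
  unfolding u_def by (intro C_in_A polynomial_fn_intros)

text \<open>The part of a coordinate vector orthogonal to \<zeta> lies in \<open>S\<close> and acts
  as zero; what remains of the coordinate function is a multiple of
  \<open>vinner z \<zeta>\<close>.\<close>

lemma C_coord: "C (\<lambda>z. z $ i) = (\<lambda>f\<in>K. \<lambda>z. \<zeta> $ i * u f z)"
proof (rule C_eqI)
  fix f assume f: "f \<in> K"
  define \<xi> where "\<xi> = axis i 1 - vinner (axis i 1) \<zeta> *s \<zeta>"
  have "vinner \<xi> \<zeta> = 0"
    unfolding \<xi>_def using unit by (simp add: vinner_diff_left vinner_scale_left)
  hence \<xi>: "\<xi> \<in> S" by (rule S_orth)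
  have "z $ i = \<zeta> $ i * vinner z \<zeta> + vinner z \<xi>" for z :: "complex ^ 'n"
    using vinner_axis[of z i] vinner_axis[of \<zeta> i] cnj_vinner[of "axis i 1" \<zeta>]
    by (simp add: \<xi>_def vinner_diff_right vinner_scale_right)
  hence eq: "C (\<lambda>z. z $ i) = C (\<lambda>z. \<zeta> $ i * vinner z \<zeta> + vinner z \<xi>)"
    by (intro arg_cong[where f = C] ext)
  have p: "polynomial_fn (\<lambda>z. \<zeta> $ i * vinner z \<zeta>)" "polynomial_fn (\<lambda>z. vinner z \<zeta>)" "polynomial_fn (\<lambda>z. vinner z \<xi>)"
    by (intro polynomial_fn_intros)+
  show "C (\<lambda>z. z $ i) f = (\<lambda>z. \<zeta> $ i * u f z)"
    unfolding eq C_add[OF p(1,3)] C_scale[OF p(2)] u_def using C_S[OF \<xi> f] f by simp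
qed

lemma char_poly_axis:
  assumes \<tau>: "\<tau> \<in> character_space A" and p: "polynomial_fn p"
  shows "\<tau> (C p) = p (\<tau> u *s \<zeta>)"
proof -
  have "\<tau> (C (\<lambda>z. z $ i)) = \<zeta> $ i * \<tau> u" for i
    unfolding C_coord by (rule charD(2)[OF \<tau> u_in_A])
  hence "(\<chi> i. \<tau> (C (\<lambda>z. z $ i))) = \<tau> u *s \<zeta>" by (simp add: vec_eq_iff mult.commute)
  thus ?thesis using char_poly[OF \<tau> p] by simp
qed

text \<open>Otherwise \<open>u\<close> would be nilpotent, hence \<open>0\<close> by the Gelfand isometry.\<close>

lemma generators_vanish:
  assumes g: "g \<in> G" shows "g \<zeta> = 0"
proof (rule ccontr)
  assume neq: "g \<zeta> \<noteq> 0"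
  obtain m where m: "\<And>t z. g (t *s z) = t ^ m * g z" using homogeneous_fn_cases[OF G[OF g]] by metis
  have poly: "polynomial_fn g" by (rule homogeneous_fn_polynomial[OF G[OF g]])
  have Cg: "C g = (\<lambda>f\<in>K. \<lambda>z. 0)"
  proof (rule C_eqI)
    fix f assume f: "f \<in> K"
    show "C g f = (\<lambda>z. 0)"
      unfolding C_apply[OF f]
    proof (rule P_eqI[OF poly_mult_mem[OF poly K_V[OF f]] K.zero_mem])
      fix h assume h: "h \<in> K"
      have "ip h (\<lambda>z. g z * f z) = 0" by (rule K_orthogonal_generator[OF h g K_V[OF f]])
      thus "ip (\<lambda>z. g z * f z) h = ip (\<lambda>z. 0) h"
        using ip_cnj[OF K_V[OF h] poly_mult_mem[OF poly K_V[OF f]]] K_V[OF h] by simp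
    qed
  qed
  \<comment> \<open>Homogeneity turns \<open>\<tau> (C g) = 0\<close> into
    \<open>\<tau> u ^ m * g \<zeta> = 0\<close>, and \<open>g \<zeta>\<close> was assumed
    nonzero.\<close>
  have "cmod (\<tau> u) \<le> 0" if \<tau>: "\<tau> \<in> character_space A" for \<tau>
  proof -
    have "0 = \<tau> (C g)" unfolding Cg by (rule char_zero[OF \<tau>, symmetric])
    also have "\<dots> = \<tau> u ^ m * g \<zeta>" unfolding char_poly_axis[OF \<tau> poly] by (rule m)
    finally show ?thesis using neq by simp
  qed
  hence "nm (u one) \<le> 0 * nm one" by (rule norm_bound[OF u_in_A _ one_in_K])
  moreover have "u one = pf 1 \<zeta>"
    using vinner_power_one[of 1 \<zeta> 1] P_ident[OF linear_form_in_K[OF orth_S]]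
    by (simp add: u_def C_apply[OF one_in_K])
  ultimately have "nm (pf 1 \<zeta>) \<le> 0" by simp
  hence "(nm (pf 1 \<zeta>))\<^sup>2 = 0" using antisym[OF _ nm_nonneg[OF pf_mem]] by fastforce
  thus False using nm_pf[OF unit, of 1] a_pos[of 1] by simp
qed

lemma generators_vanish_scaled: "g \<in> G \<Longrightarrow> g (\<mu> *s \<zeta>) = 0"
  using homogeneous_fn_cases[OF G] generators_vanish by (metis mult_zero_right)

text \<open>Pairing with \<open>pf n \<zeta>\<close> reads off a coefficient of the product along
  the line of \<zeta>, on which every generator vanishes.\<close>

lemma pf_in_K: "pf n \<zeta> \<in> K"
proof (rule K_I[OF pf_mem])
  fix g h assume g: "g \<in> G" and h: "h \<in> V"
  obtain m where m: "\<And>t z. g (t *s z) = t ^ m * g z" using homogeneous_fn_cases[OF G[OF g]] by metis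
  have "(\<lambda>z. g z * h z) \<in> V" by (intro poly_mult_mem homogeneous_fn_polynomial G g h)
  hence "of_real (a n) * ip (\<lambda>z. g z * h z) (pf n \<zeta>) = 0"
    using ip_homogeneous_mult[of g \<zeta> m h n, OF m h] generators_vanish[OF g] by simp
  thus "ip (\<lambda>z. g z * h z) (pf n \<zeta>) = 0" using a_pos[of n] by simp
qed

lemma scaled_in_ball: "cmod \<mu> < 1 \<Longrightarrow> \<mu> *s \<zeta> \<in> ball 0 1"
  using norm_scale_unit[OF unit] by simp

text \<open>A common zero of the generators puts its kernel function into the quotient; this is
  where the disc enters.\<close>

lemma kf_in_K:
  assumes "cmod \<mu> < 1" shows "kf (\<mu> *s \<zeta>) \<in> K"
proof (rule K_I)
  note w = scaled_in_ball[OF assms]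
  show "kf (\<mu> *s \<zeta>) \<in> V" by (rule kf_mem[OF w])
  fix g h assume g: "g \<in> G" and h: "h \<in> V"
  have "(\<lambda>z. g z * h z) \<in> V" by (intro poly_mult_mem homogeneous_fn_polynomial G g h)
  thus "ip (\<lambda>z. g z * h z) (kf (\<mu> *s \<zeta>)) = 0"
    using ip_kf[OF w] generators_vanish_scaled[OF g] by simp
qed

text \<open>The column inequality applied to the constant function \<open>1\<close> reads
  \<open>(\<Sum>n=1..N. b n / a n) \<le> 1\<close>, and the first term is already \<open>1\<close>.\<close>

lemma b_vanish:
  assumes "i \<ge> 1" shows "b (Suc i) = 0"
proof -
  define p where "p i z = of_real (sqrt (b (Suc i))) * vinner z \<zeta> ^ Suc i" for i z
  have poly: "polynomial_fn (p i)" for i unfolding p_def by (intro polynomial_fn_intros)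
  have "(\<Sum>i<Suc i. (nm (P (\<lambda>z. p i z * one z)))\<^sup>2) \<le> 1"
  proof (rule column_poly[OF poly _ _ one_in_K])
    fix f :: "nat \<Rightarrow> 'n fn" assume "\<And>j. j < Suc i \<Longrightarrow> f j \<in> V"
    thus "nm (\<lambda>z. \<Sum>j<Suc i. p j z * f j z) \<le> sqrt (\<Sum>j<Suc i. (nm (f j))\<^sup>2)"
      unfolding p_def using row_powers[OF unit, of "Suc i" f] by blast
  qed simp
  moreover have "(nm (P (\<lambda>z. p i z * one z)))\<^sup>2 = b (Suc i) / a (Suc i)" for i
  proof -
    have "P (\<lambda>z. p i z * one z) = (\<lambda>z. of_real (sqrt (b (Suc i))) * pf (Suc i) \<zeta> z)"
      unfolding p_def vinner_power_one by (rule P_ident[OF K.scale_mem[OF pf_in_K]])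
    thus ?thesis
      using b_nonneg[of i] nm_pf[OF unit, of "Suc i"] by (simp add: nm_scale power_mult_distrib)
  qed
  ultimately have "(\<Sum>i<Suc i. b (Suc i) / a (Suc i)) \<le> 1" by simp
  \<comment> \<open>Index 0 stands for exponent 1; it differs from \<open>i\<close> because
    \<open>i \<ge> 1\<close>, so both terms count.\<close>
  moreover have "(\<Sum>i\<in>{0, i}. b (Suc i) / a (Suc i)) \<le> (\<Sum>i<Suc i. b (Suc i) / a (Suc i))"
    using b_nonneg a_pos assms by (intro sum_mono2) (auto simp: less_imp_le)
  moreover have "b (Suc 0) / a (Suc 0) = 1" using b_1 a_pos[of 1] by simp
  ultimately have "b (Suc i) / a (Suc i) \<le> 0" using assms by simp
  thus ?thesis using b_nonneg[of i] a_pos[of "Suc i"] by (simp add: divide_le_0_iff)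
qed

lemma b_1_eq: "b (Suc 0) = 1"
proof -
  have "(\<lambda>n. b (Suc n)) = (\<lambda>n. if n = 0 then b (Suc 0) else 0)"
    using b_vanish by (auto simp: fun_eq_iff)
  moreover have "(\<lambda>n. if n = 0 then b (Suc 0) else 0) sums b (Suc 0)"
    using sums_single[of 0 "\<lambda>_. b (Suc 0)"] by simp
  ultimately show ?thesis using maximal sums_unique2 unfolding maximal_cnp_def by metis
qed

text \<open>A row of length one is contractive with weight \<open>sqrt (b 1)\<close>, and the weight
  is now 1.\<close>

lemma nm_u: "f \<in> K \<Longrightarrow> nm (u f) \<le> nm f"
proof -
  assume f: "f \<in> K"
  have "nm (\<lambda>z. vinner z \<zeta> * f z) \<le> nm f"
    using row_powers[OF unit, of 1 "\<lambda>_. f"] K_V[OF f] b_1_eq by simp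
  moreover have "nm (u f) \<le> nm (\<lambda>z. vinner z \<zeta> * f z)"
    unfolding u_def C_apply[OF f] by (intro nm_P vinner_mult_mem K_V f)
  ultimately show ?thesis by simp
qed

lemma char_u: "\<tau> \<in> character_space A \<Longrightarrow> cmod (\<tau> u) \<le> 1"
  by (rule char_bound[OF _ u_in_A]) (use nm_u in auto)

text \<open>The kernel function at such a point lies in \<open>K\<close>, so evaluating there does
  not notice the projection.\<close>

lemma C_value:
  assumes p: "polynomial_fn p" and f: "f \<in> K" and l: "cmod \<mu> < 1"
  shows "C p f (\<mu> *s \<zeta>) = p (\<mu> *s \<zeta>) * f (\<mu> *s \<zeta>)"
proof -
  note w = scaled_in_ball[OF l]
  have pf: "(\<lambda>z. p z * f z) \<in> V" by (intro poly_mult_mem p K_V f)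
  have "C p f (\<mu> *s \<zeta>) = ip (P (\<lambda>z. p z * f z)) (kf (\<mu> *s \<zeta>))"
    unfolding C_apply[OF f] by (rule ip_kf[OF w K_V[OF P_mem[OF pf]], symmetric])
  also have "\<dots> = ip (\<lambda>z. p z * f z) (kf (\<mu> *s \<zeta>))" by (rule ip_P[OF pf kf_in_K[OF l]])
  also have "\<dots> = p (\<mu> *s \<zeta>) * f (\<mu> *s \<zeta>)" by (rule ip_kf[OF w pf])
  finally show ?thesis .
qed

section \<open>Symbols of operators on the disc\<close>

definition approx :: "'n fn_op \<Rightarrow> real \<Rightarrow> 'n fn \<Rightarrow> bool" where
  "approx T e p \<longleftrightarrow> polynomial_fn p \<and> (\<forall>f\<in>K. nm (\<lambda>z. T f z - C p f z) \<le> e * nm f)"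

lemma approx_exists: "T \<in> acarrier A \<Longrightarrow> e > 0 \<Longrightarrow> \<exists>p. approx T e p"
  unfolding A_iff approx_def by blast

lemma A_of_approx: "T \<in> bounded_ops Q \<Longrightarrow> (\<And>e. e > 0 \<Longrightarrow> \<exists>p. approx T e p) \<Longrightarrow> T \<in> acarrier A"
  unfolding A_iff approx_def by blast

text \<open>The symbol of \<open>T\<close>: for \<open>T = C p\<close> and
  \<open>cmod \<mu> < 1\<close> it is \<open>p (\<mu> *s \<zeta>)\<close>, since \<open>one\<close>
  has value 1 in the ball.\<close>

definition ev :: "'n fn_op \<Rightarrow> complex \<Rightarrow> complex" where "ev T \<mu> = T one (\<mu> *s \<zeta>)"

lemma kf_pos: "w \<in> ball 0 1 \<Longrightarrow> 0 < nm (kf w)"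
proof -
  assume w: "w \<in> ball 0 1"
  have "ip one (kf w) = 1" using ip_kf[OF w one_mem] w by (simp add: one_def on_ball_def)
  moreover have "cmod (ip one (kf w)) \<le> nm one * nm (kf w)" by (rule cauchy_schwarz[OF one_mem kf_mem[OF w]])
  ultimately show ?thesis by (simp add: nm_one)
qed

lemma value_le: "f \<in> V \<Longrightarrow> w \<in> ball 0 1 \<Longrightarrow> cmod (f w) \<le> nm f * nm (kf w)"
  using cauchy_schwarz[OF _ kf_mem, of f w] ip_kf[of w f] by simp

text \<open>The operators of the algebra have the functions \<open>kf (\<mu> *s \<zeta>)\<close> as common eigenvectors of their
  adjoints; \<open>cnj (ev T \<mu>)\<close> is the eigenvalue.\<close>

lemma T_value:
  assumes T: "T \<in> acarrier A" and f: "f \<in> K" and l: "cmod \<mu> < 1"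
  shows "T f (\<mu> *s \<zeta>) = ev T \<mu> * f (\<mu> *s \<zeta>)"
proof -
  note w = scaled_in_ball[OF l]
  let ?w = "\<mu> *s \<zeta>"
  define M where "M = (nm f + cmod (f ?w)) * nm (kf ?w)"
  have TV: "T f \<in> V" if "f \<in> K" for f by (rule K_V[OF K.bounded_opsD(1)[OF A_bounded[OF T] that]])
  have bound: "cmod (T f ?w - ev T \<mu> * f ?w) \<le> e * M" if e: "e > 0" for e
  proof -
    obtain p where "approx T e p" using approx_exists[OF T e] by blast
    hence p: "polynomial_fn p" "\<And>f. f \<in> K \<Longrightarrow> nm (\<lambda>z. T f z - C p f z) \<le> e * nm f"
      by (auto simp: approx_def)
    have CV: "C p f \<in> V" if "f \<in> K" for f by (rule K_V[OF K.bounded_opsD(1)[OF C_bounded[OF p(1)] that]])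
    have *: "cmod (T f ?w - p ?w * f ?w) \<le> e * nm f * nm (kf ?w)" if f: "f \<in> K" for f
    proof -
      have "cmod (T f ?w - C p f ?w) \<le> nm (\<lambda>z. T f z - C p f z) * nm (kf ?w)"
        using value_le[OF diff_mem[OF TV[OF f] CV[OF f]] w] .
      also have "\<dots> \<le> e * nm f * nm (kf ?w)"
        using p(2)[OF f] kf_pos[OF w] by (intro mult_right_mono) auto
      finally show ?thesis unfolding C_value[OF p(1) f l] .
    qed
    have "cmod (ev T \<mu> - p ?w) \<le> e * nm (kf ?w)"
      using *[OF one_in_K] w by (simp add: ev_def nm_one) (simp add: one_def on_ball_def)
    hence "cmod ((ev T \<mu> - p ?w) * f ?w) \<le> e * nm (kf ?w) * cmod (f ?w)"
      unfolding norm_mult by (rule mult_right_mono) simp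
    moreover have "T f ?w - ev T \<mu> * f ?w = (T f ?w - p ?w * f ?w) - (ev T \<mu> - p ?w) * f ?w"
      by (simp add: algebra_simps)
    ultimately show ?thesis
      using *[OF f] norm_triangle_ineq4[of "T f ?w - p ?w * f ?w" "(ev T \<mu> - p ?w) * f ?w"]
      by (simp add: M_def algebra_simps)
  qed
  hence "T f ?w - ev T \<mu> * f ?w = 0" by (rule eq_0_of_small_multiples)
  thus ?thesis by simp
qed

text \<open>The estimate is tested on the eigenvector \<open>kf (\<mu> *s \<zeta>)\<close>, where
  both sides carry the factor \<open>(nm ?k)\<^sup>2\<close>. It cancels and leaves a bound uniform
  in \<mu>; testing on \<open>one\<close> would leave a factor \<open>nm ?k\<close>.\<close>

lemma ev_approx:
  assumes T: "T \<in> acarrier A" and p: "approx T e p" and l: "cmod \<mu> < 1"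
  shows "cmod (ev T \<mu> - p (\<mu> *s \<zeta>)) \<le> e"
proof -
  note w = scaled_in_ball[OF l]
  let ?w = "\<mu> *s \<zeta>" let ?k = "kf ?w"
  have pp: "polynomial_fn p" "nm (\<lambda>z. T ?k z - C p ?k z) \<le> e * nm ?k"
    using p kf_in_K[OF l] by (auto simp: approx_def)
  have V: "T ?k \<in> V" "C p ?k \<in> V"
    using K.bounded_opsD(1)[OF A_bounded[OF T] kf_in_K[OF l]]
      K.bounded_opsD(1)[OF C_bounded[OF pp(1)] kf_in_K[OF l]] by (auto intro: K_V)
  have "cmod (T ?k ?w - C p ?k ?w) \<le> nm (\<lambda>z. T ?k z - C p ?k z) * nm ?k"
    by (rule value_le[OF diff_mem[OF V] w])
  also have "\<dots> \<le> (e * nm ?k) * nm ?k" using pp(2) kf_pos[OF w] by (intro mult_right_mono) auto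
  also have "T ?k ?w - C p ?k ?w = (ev T \<mu> - p ?w) * ?k ?w"
    unfolding T_value[OF T kf_in_K[OF l] l] C_value[OF pp(1) kf_in_K[OF l] l]
    by (simp add: algebra_simps)
  also have "?k ?w = of_real ((nm ?k)\<^sup>2)"
    using ip_kf[OF w kf_mem[OF w]] ip_self[OF kf_mem[OF w]] by simp
  finally have "cmod (ev T \<mu> - p ?w) * (nm ?k)\<^sup>2 \<le> e * (nm ?k)\<^sup>2"
    by (simp add: norm_mult norm_power power2_eq_square mult.assoc)
  thus ?thesis using kf_pos[OF w] by simp
qed

lemma poly_line_holomorphic:
  assumes "polynomial_fn p" shows "(\<lambda>\<mu>. p (\<mu> *s \<zeta>)) holomorphic_on X"
  using assms by (induction p rule: polynomial_fn_induct) (auto intro!: holomorphic_intros)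

lemma poly_line_continuous: "polynomial_fn p \<Longrightarrow> continuous_on X (\<lambda>\<mu>. p (\<mu> *s \<zeta>))"
  by (intro holomorphic_on_imp_continuous_on poly_line_holomorphic)

abbreviation "D \<equiv> acarrier disc_algebra"

lemma D_iff: "F \<in> D \<longleftrightarrow> continuous_on (cball 0 1) F \<and> F holomorphic_on ball 0 1 \<and>
    (\<forall>z. z \<notin> cball 0 1 \<longrightarrow> F z = 0)"
  by (simp add: disc_algebra_def)

lemma cball_norm_le:
  fixes F :: "complex \<Rightarrow> complex"
  assumes "continuous_on (cball 0 1) F" "\<And>z. cmod z < 1 \<Longrightarrow> cmod (F z) \<le> B" "cmod z \<le> 1"
  shows "cmod (F z) \<le> B"
  using continuous_on_closure_norm_le[of "ball 0 1" F B z] assms by simp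

lemma D_eqI:
  assumes F: "F \<in> D" and F': "F' \<in> D" and eq: "\<And>z. cmod z < 1 \<Longrightarrow> F z = F' z"
  shows "F = F'"
proof
  fix z
  show "F z = F' z"
  proof (cases "cmod z \<le> 1")
    case True
    have "cmod (F z - F' z) \<le> 0"
      by (rule cball_norm_le[OF _ _ True]) (use F F' eq in \<open>auto simp: D_iff intro!: continuous_intros\<close>)
    thus ?thesis by simp
  qed (use F F' in \<open>auto simp: D_iff\<close>)
qed

text \<open>Polynomial symbols approximate \<open>ev T\<close> uniformly on the open disc, and by
  continuity they are uniformly Cauchy on the closed disc. The limit supplies the boundary values
  that \<open>ev T\<close> itself does not give.\<close>

lemma disc_function_exists:
  assumes T: "T \<in> acarrier A"
  shows "\<exists>F\<in>D. \<forall>z. cmod z < 1 \<longrightarrow> F z = ev T z"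
proof -
  have "\<exists>p. approx T (1 / real (Suc n)) p" for n by (rule approx_exists[OF T]) simp
  then obtain p where p: "\<And>n. approx T (1 / real (Suc n)) (p n)" by metis
  define q where "q n z = p n (z *s \<zeta>)" for n z
  have poly: "polynomial_fn (p n)" for n using p[of n] by (simp add: approx_def)
  have cont: "continuous_on X (q n)" and hol: "q n holomorphic_on X" for n X
    unfolding q_def by (intro poly_line_continuous poly_line_holomorphic poly)+
  have near: "cmod (ev T z - q n z) \<le> 1 / real (Suc n)" if "cmod z < 1" for z n
    unfolding q_def by (rule ev_approx[OF T p that])
  have diff: "cmod (q m z - q n z) \<le> 1 / real (Suc m) + 1 / real (Suc n)" if "cmod z \<le> 1" for m n z
  proof (rule cball_norm_le[OF _ _ that])
    show "continuous_on (cball 0 1) (\<lambda>z. q m z - q n z)" by (intro continuous_intros cont)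
    fix z :: complex assume z: "cmod z < 1"
    show "cmod (q m z - q n z) \<le> 1 / real (Suc m) + 1 / real (Suc n)"
      using near[OF z, of m] near[OF z, of n] norm_triangle_ineq4[of "ev T z - q n z" "ev T z - q m z"]
      by (simp add: algebra_simps)
  qed
  have "uniformly_Cauchy_on (cball 0 1) q"
  proof (rule uniformly_Cauchy_onI)
    fix e :: real assume "e > 0"
    then obtain M where M: "1 / real (Suc M) < e / 2"
      using reals_Archimedean[of "e / 2"] by (auto simp: inverse_eq_divide)
    have le: "1 / real (Suc n) \<le> 1 / real (Suc M)" if "n \<ge> M" for n
      using that by (auto simp: field_simps)
    have "dist (q m z) (q n z) < e" if "z \<in> cball 0 1" "m \<ge> M" "n \<ge> M" for z m n
      using diff[of z m n] le[OF that(2)] le[OF that(3)] M that(1) unfolding dist_norm by simp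
    thus "\<exists>M. \<forall>z\<in>cball 0 1. \<forall>m\<ge>M. \<forall>n\<ge>M. dist (q m z) (q n z) < e" by blast
  qed
  then obtain l where l: "uniform_limit (cball 0 1) q l sequentially"
    using Cauchy_uniformly_convergent unfolding uniformly_convergent_on_def by blast
  have lc: "continuous_on (cball 0 1) l" and lh: "l holomorphic_on ball 0 1"
    using holomorphic_uniform_limit[OF _ l] cont hol by auto
  have lev: "l z = ev T z" if z: "cmod z < 1" for z
  proof (rule LIMSEQ_unique)
    show "(\<lambda>n. q n z) \<longlonglongrightarrow> l z" by (rule tendsto_uniform_limitI[OF l]) (use z in simp)
    have "(\<lambda>n. q n z - ev T z) \<longlonglongrightarrow> 0"
      by (rule Lim_null_comparison[OF _ LIMSEQ_inverse_real_of_nat])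
        (use near[OF z] in \<open>auto simp: norm_minus_commute inverse_eq_divide\<close>)
    thus "(\<lambda>n. q n z) \<longlonglongrightarrow> ev T z" by (simp add: LIM_zero_iff)
  qed
  define F where "F z = (if z \<in> cball 0 1 then l z else 0)" for z
  have "continuous_on (cball 0 1) F" using lc by (rule continuous_on_eq) (simp add: F_def)
  moreover have "F holomorphic_on ball 0 1" using lh by (rule holomorphic_transform) (simp add: F_def)
  ultimately have "F \<in> D" by (auto simp: D_iff F_def)
  moreover have "\<forall>z. cmod z < 1 \<longrightarrow> F z = ev T z" using lev by (simp add: F_def)
  ultimately show ?thesis by blast
qed

text \<open>The choice is unique by \<open>D_eqI\<close>. By \<open>char_\<Phi>\<close> this is the
  Gelfand transform, with a character \<tau> read as the point \<open>\<tau> u\<close>.\<close>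

definition \<Phi> :: "'n fn_op \<Rightarrow> complex \<Rightarrow> complex" where
  "\<Phi> T = (SOME F. F \<in> D \<and> (\<forall>z. cmod z < 1 \<longrightarrow> F z = ev T z))"

lemma \<Phi>_D: "T \<in> acarrier A \<Longrightarrow> \<Phi> T \<in> D"
  and \<Phi>_ev: "T \<in> acarrier A \<Longrightarrow> cmod z < 1 \<Longrightarrow> \<Phi> T z = ev T z"
  unfolding \<Phi>_def using someI_ex[of "\<lambda>F. F \<in> D \<and> (\<forall>z. cmod z < 1 \<longrightarrow> F z = ev T z)"] disc_function_exists
  by blast+

lemma \<Phi>_eqI: "T \<in> acarrier A \<Longrightarrow> F \<in> D \<Longrightarrow> (\<And>z. cmod z < 1 \<Longrightarrow> ev T z = F z) \<Longrightarrow> \<Phi> T = F"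
  by (rule D_eqI) (auto simp: \<Phi>_D \<Phi>_ev)

lemma \<Phi>_approx:
  assumes T: "T \<in> acarrier A" and p: "approx T e p" and z: "cmod z \<le> 1"
  shows "cmod (\<Phi> T z - p (z *s \<zeta>)) \<le> e"
proof (rule cball_norm_le[OF _ _ z])
  have "polynomial_fn p" using p by (simp add: approx_def)
  thus "continuous_on (cball 0 1) (\<lambda>z. \<Phi> T z - p (z *s \<zeta>))"
    using \<Phi>_D[OF T] by (intro continuous_on_diff poly_line_continuous) (auto simp: D_iff)
  show "cmod (\<Phi> T z - p (z *s \<zeta>)) \<le> e" if "cmod z < 1" for z
    unfolding \<Phi>_ev[OF T that] by (rule ev_approx[OF T p that])
qed

section \<open>Compatibility of the symbol map with the algebra operations and norms\<close>

lemma A_nm: "T \<in> acarrier A \<Longrightarrow> \<exists>C\<ge>0. \<forall>f\<in>K. nm (T f) \<le> C * nm f"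
  using K.bounded_opsD(5)[OF A_bounded] by simp

lemmas A_mem = K.bounded_opsD(1)[OF A_bounded]

lemma A_add:
  assumes T: "T \<in> acarrier A" and U: "U \<in> acarrier A"
  shows "(\<lambda>f\<in>K. \<lambda>z. T f z + U f z) \<in> acarrier A" (is "?W \<in> _")
proof (rule A_of_approx)
  obtain C1 where C1: "\<And>f. f \<in> K \<Longrightarrow> nm (T f) \<le> C1 * nm f" using A_nm[OF T] by blast
  obtain C2 where C2: "\<And>f. f \<in> K \<Longrightarrow> nm (U f) \<le> C2 * nm f" using A_nm[OF U] by blast
  show "?W \<in> bounded_ops Q"
  proof (rule K.bounded_opsI[of _ "C1 + C2", unfolded Q_simps])
    fix f assume f: "f \<in> K"
    show "?W f \<in> K" using A_mem[OF T f] A_mem[OF U f] f by simp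
    show "nm (?W f) \<le> (C1 + C2) * nm f"
      using K.nm_triangle[OF A_mem[OF T f] A_mem[OF U f]] C1[OF f] C2[OF f] f by (simp add: distrib_right)
    show "?W (\<lambda>z. c * f z) = (\<lambda>z. c * ?W f z)" for c
      using f K.bounded_opsD(4)[OF A_bounded[OF T] f] K.bounded_opsD(4)[OF A_bounded[OF U] f]
      by (simp add: distrib_left)
    show "?W (\<lambda>z. f z + g z) = (\<lambda>z. ?W f z + ?W g z)" if g: "g \<in> K" for g
      using f g K.bounded_opsD(3)[OF A_bounded[OF T] f g] K.bounded_opsD(3)[OF A_bounded[OF U] f g]
      by (simp add: algebra_simps)
  qed simp
  fix e :: real assume e: "e > 0"
  obtain p where p: "approx T (e / 2) p" using approx_exists[OF T, of "e / 2"] e by auto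
  obtain q where q: "approx U (e / 2) q" using approx_exists[OF U, of "e / 2"] e by auto
  have pq: "polynomial_fn p" "polynomial_fn q" using p q by (auto simp: approx_def)
  have "nm (\<lambda>z. ?W f z - C (\<lambda>z. p z + q z) f z) \<le> e * nm f" if f: "f \<in> K" for f
  proof -
    let ?x = "\<lambda>z. T f z - C p f z" and ?y = "\<lambda>z. U f z - C q f z"
    have "?x \<in> K" "?y \<in> K" using A_mem[OF T f] A_mem[OF U f] A_mem[OF C_in_A f] pq by auto
    hence "nm (\<lambda>z. ?x z + ?y z) \<le> nm ?x + nm ?y" by (rule K.nm_triangle)
    also have "\<dots> \<le> (e / 2) * nm f + (e / 2) * nm f"
      using p q f unfolding approx_def by (intro add_mono) blast+
    also have "\<dots> = e * nm f" by simp
    finally show ?thesis using f unfolding C_add[OF pq] by (simp add: algebra_simps)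
  qed
  thus "\<exists>p. approx ?W e p"
    using pq by (intro exI[of _ "\<lambda>z. p z + q z"]) (auto simp: approx_def intro: polynomial_fn_intros)
qed

lemma A_mult:
  assumes T: "T \<in> acarrier A" and U: "U \<in> acarrier A"
  shows "(\<lambda>f\<in>K. T (U f)) \<in> acarrier A" (is "?W \<in> _")
proof (rule A_of_approx)
  obtain C1 where C1: "C1 \<ge> 0" "\<And>f. f \<in> K \<Longrightarrow> nm (T f) \<le> C1 * nm f" using A_nm[OF T] by blast
  obtain C2 where C2: "C2 \<ge> 0" "\<And>f. f \<in> K \<Longrightarrow> nm (U f) \<le> C2 * nm f" using A_nm[OF U] by blast
  show "?W \<in> bounded_ops Q"
  proof (rule K.bounded_opsI[of _ "C1 * C2", unfolded Q_simps])
    fix f assume f: "f \<in> K"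
    show "?W f \<in> K" using A_mem[OF T A_mem[OF U f]] f by simp
    have "nm (T (U f)) \<le> C1 * (C2 * nm f)"
      using C1(2)[OF A_mem[OF U f]] mult_left_mono[OF C2(2)[OF f] C1(1)] by linarith
    thus "nm (?W f) \<le> C1 * C2 * nm f" using f by (simp add: mult.assoc)
    show "?W (\<lambda>z. c * f z) = (\<lambda>z. c * ?W f z)" for c
      using f K.bounded_opsD(4)[OF A_bounded[OF U] f] K.bounded_opsD(4)[OF A_bounded[OF T] A_mem[OF U f]]
      by simp
    show "?W (\<lambda>z. f z + g z) = (\<lambda>z. ?W f z + ?W g z)" if g: "g \<in> K" for g
      using f g K.bounded_opsD(3)[OF A_bounded[OF U] f g]
        K.bounded_opsD(3)[OF A_bounded[OF T] A_mem[OF U f] A_mem[OF U g]] by simp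
  qed simp
  fix e :: real assume e: "e > 0"
  \<comment> \<open>The product error splits as \<open>(T - C p) U + C p (U - C q)\<close>. The
    second tolerance \<open>e2\<close> depends on a bound for \<open>C p\<close> and can be fixed
    only after \<open>p\<close>; adding 1 avoids division by zero.\<close>
  define e1 where "e1 = e / (2 * (C2 + 1))"
  have e1: "e1 > 0" "e1 * C2 \<le> e / 2" using e C2(1) by (auto simp: e1_def field_simps)
  obtain p where p: "approx T e1 p" using approx_exists[OF T e1(1)] by blast
  hence pp: "polynomial_fn p" by (simp add: approx_def)
  obtain C3 where C3: "C3 \<ge> 0" "\<And>f. f \<in> K \<Longrightarrow> nm (C p f) \<le> C3 * nm f"
    using A_nm[OF C_in_A[OF pp]] by blast
  define e2 where "e2 = e / (2 * (C3 + 1))"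
  have e2: "e2 > 0" "C3 * e2 \<le> e / 2" using e C3(1) by (auto simp: e2_def field_simps)
  obtain q where q: "approx U e2 q" using approx_exists[OF U e2(1)] by blast
  hence qq: "polynomial_fn q" by (simp add: approx_def)
  have "nm (\<lambda>z. ?W f z - C (\<lambda>z. p z * q z) f z) \<le> e * nm f" if f: "f \<in> K" for f
  proof -
    note Uf = A_mem[OF U f] and qf = A_mem[OF C_in_A[OF qq] f]
    let ?x = "\<lambda>z. T (U f) z - C p (U f) z" and ?d = "\<lambda>z. U f z - C q f z"
    have d: "?d \<in> K" using Uf qf by auto
    have x: "?x \<in> K" using A_mem[OF T Uf] A_mem[OF C_in_A[OF pp] Uf] by auto
    have "nm ?x \<le> e1 * nm (U f)" using p Uf by (simp add: approx_def)
    also have "\<dots> \<le> e1 * (C2 * nm f)" using C2(2)[OF f] e1 by (intro mult_left_mono) auto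
    also have "\<dots> = (e1 * C2) * nm f" by simp
    also have "\<dots> \<le> (e / 2) * nm f" using e1(2) K_V[OF f] by (intro mult_right_mono) auto
    finally have 1: "nm ?x \<le> (e / 2) * nm f" .
    have "nm (C p ?d) \<le> C3 * nm ?d" by (rule C3(2)[OF d])
    also have "\<dots> \<le> C3 * (e2 * nm f)" using q f C3(1) by (intro mult_left_mono) (auto simp: approx_def)
    also have "\<dots> = (C3 * e2) * nm f" by simp
    also have "\<dots> \<le> (e / 2) * nm f" using e2(2) K_V[OF f] by (intro mult_right_mono) auto
    finally have 2: "nm (C p ?d) \<le> (e / 2) * nm f" .
    have "C p ?d = (\<lambda>z. C p (U f) z - C p (C q f) z)"
      by (rule K.bounded_ops_diff[OF C_bounded[OF pp] Uf qf])
    hence "(\<lambda>z. ?W f z - C (\<lambda>z. p z * q z) f z) = (\<lambda>z. ?x z + C p ?d z)"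
      using f C_mult[OF pp qq f] by (simp add: fun_eq_iff)
    moreover have "nm (\<lambda>z. ?x z + C p ?d z) \<le> nm ?x + nm (C p ?d)"
      by (rule K.nm_triangle[OF x A_mem[OF C_in_A[OF pp] d]])
    ultimately show ?thesis using 1 2 by (simp add: field_simps)
  qed
  thus "\<exists>p. approx ?W e p"
    using pp qq by (intro exI[of _ "\<lambda>z. p z * q z"]) (auto simp: approx_def intro: polynomial_fn_intros)
qed

lemma A_scale:
  assumes T: "T \<in> acarrier A"
  shows "(\<lambda>f\<in>K. \<lambda>z. c * T f z) \<in> acarrier A"
proof -
  have "(\<lambda>f\<in>K. \<lambda>z. c * T f z) = (\<lambda>f\<in>K. C (\<lambda>z. c) (T f))"
    using A_mem[OF T] by (auto simp: C_const fun_eq_iff)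
  thus ?thesis using A_mult[OF C_in_A[OF polynomial_fn_const] T, of c] by simp
qed

lemma A_diff:
  assumes T: "T \<in> acarrier A" and U: "U \<in> acarrier A"
  shows "(\<lambda>f\<in>K. \<lambda>z. T f z - U f z) \<in> acarrier A"
    and "\<tau> \<in> character_space A \<Longrightarrow> \<tau> (\<lambda>f\<in>K. \<lambda>z. T f z - U f z) = \<tau> T - \<tau> U"
proof -
  have eq: "(\<lambda>f\<in>K. \<lambda>z. T f z - U f z) = (\<lambda>f\<in>K. \<lambda>z. T f z + (\<lambda>f\<in>K. \<lambda>z. - 1 * U f z) f z)"
    by (auto simp: fun_eq_iff)
  show "(\<lambda>f\<in>K. \<lambda>z. T f z - U f z) \<in> acarrier A"
    unfolding eq by (intro A_add A_scale T U)
  show "\<tau> (\<lambda>f\<in>K. \<lambda>z. T f z - U f z) = \<tau> T - \<tau> U" if \<tau>: "\<tau> \<in> character_space A"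
    unfolding eq charD(1)[OF \<tau> T A_scale[OF U]] charD(2)[OF \<tau> U] by simp
qed

lemma \<Phi>_add: "T \<in> acarrier A \<Longrightarrow> U \<in> acarrier A \<Longrightarrow>
    \<Phi> (\<lambda>f\<in>K. \<lambda>z. T f z + U f z) = (\<lambda>z. \<Phi> T z + \<Phi> U z)"
  using \<Phi>_D[of T] \<Phi>_D[of U] one_in_K
  by (intro \<Phi>_eqI A_add)
    (auto simp: D_iff \<Phi>_ev ev_def intro!: continuous_intros holomorphic_intros)

lemma \<Phi>_scale: "T \<in> acarrier A \<Longrightarrow> \<Phi> (\<lambda>f\<in>K. \<lambda>z. c * T f z) = (\<lambda>z. c * \<Phi> T z)"
  using \<Phi>_D[of T] one_in_K
  by (intro \<Phi>_eqI A_scale)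
    (auto simp: D_iff \<Phi>_ev ev_def intro!: continuous_intros holomorphic_intros)

text \<open>\<open>T_value\<close> applied to the vector \<open>U one\<close> gives multiplicativity
  of the symbol on the open disc.\<close>

lemma \<Phi>_mult:
  assumes T: "T \<in> acarrier A" and U: "U \<in> acarrier A"
  shows "\<Phi> (\<lambda>f\<in>K. T (U f)) = (\<lambda>z. \<Phi> T z * \<Phi> U z)"
proof (rule \<Phi>_eqI[OF A_mult[OF T U]])
  show "(\<lambda>z. \<Phi> T z * \<Phi> U z) \<in> D"
    using \<Phi>_D[OF T] \<Phi>_D[OF U] by (auto simp: D_iff intro!: continuous_intros holomorphic_intros)
  show "ev (\<lambda>f\<in>K. T (U f)) z = \<Phi> T z * \<Phi> U z" if "cmod z < 1" for z
    using T_value[OF T A_mem[OF U one_in_K] that] one_in_K \<Phi>_ev[OF T that] \<Phi>_ev[OF U that]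
    by (simp add: ev_def)
qed

lemma \<Phi>_one: "\<Phi> (\<lambda>f\<in>K. f) = (\<lambda>z. if z \<in> cball 0 1 then 1 else 0)"
proof (rule \<Phi>_eqI[OF one_op_in_A])
  have "continuous_on (cball 0 1) (\<lambda>z::complex. if z \<in> cball 0 1 then 1 else 0 :: complex)"
    by (rule continuous_on_eq[of _ "\<lambda>_. 1"]) auto
  moreover have "(\<lambda>z::complex. if z \<in> cball 0 1 then 1 else 0) holomorphic_on ball 0 1"
    by (rule holomorphic_transform[of "\<lambda>_. 1"]) auto
  ultimately show "(\<lambda>z. if z \<in> cball 0 1 then 1 else 0) \<in> D" by (simp add: D_iff)
  show "ev (\<lambda>f\<in>K. f) z = (if z \<in> cball 0 1 then 1 else 0)" if "cmod z < 1" for z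
    using scaled_in_ball[OF that] one_in_K that by (simp add: ev_def) (simp add: one_def on_ball_def)
qed

text \<open>Both sides are the same on compressed polynomials, and both change by at most the
  approximation error; contractivity of \<open>u\<close> places \<open>\<tau> u\<close> in the
  closed disc.\<close>

lemma char_\<Phi>:
  assumes \<tau>: "\<tau> \<in> character_space A" and T: "T \<in> acarrier A"
  shows "\<tau> T = \<Phi> T (\<tau> u)"
proof -
  have "\<tau> T - \<Phi> T (\<tau> u) = 0"
  proof (rule eq_0_of_small_multiples)
    fix e :: real assume e: "e > 0"
    obtain p where p: "approx T (e / 2) p" using approx_exists[OF T, of "e / 2"] e by auto
    hence pp: "polynomial_fn p" by (simp add: approx_def)
    have "cmod (\<tau> T - \<tau> (C p)) \<le> e / 2"
      unfolding A_diff(2)[OF T C_in_A[OF pp] \<tau>, symmetric]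
      by (rule char_bound[OF \<tau> A_diff(1)[OF T C_in_A[OF pp]]]) (use p e in \<open>auto simp: approx_def\<close>)
    moreover have "cmod (\<Phi> T (\<tau> u) - \<tau> (C p)) \<le> e / 2"
      unfolding char_poly_axis[OF \<tau> pp] by (rule \<Phi>_approx[OF T p char_u[OF \<tau>]])
    ultimately show "cmod (\<tau> T - \<Phi> T (\<tau> u)) \<le> e * 1"
      using norm_triangle_ineq4[of "\<tau> T - \<tau> (C p)" "\<Phi> T (\<tau> u) - \<tau> (C p)"] by simp
  qed
  thus ?thesis by simp
qed

lemma \<Phi>_char:
  assumes "cmod z \<le> 1"
  shows "(\<lambda>T\<in>acarrier A. \<Phi> T z) \<in> character_space A"
  unfolding character_space_def A_simps(2-5)
  using A_add A_scale A_mult one_op_in_A assms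
  by (auto simp: \<Phi>_add \<Phi>_scale \<Phi>_mult \<Phi>_one)

text \<open>The norm is attained at a character, that is at a point of the closed disc by
  \<open>char_\<Phi>\<close>; all other points give characters by \<open>\<Phi>_char\<close> and
  cannot exceed it.\<close>

lemma \<Phi>_norm:
  assumes n: "n \<ge> 1" and X: "X \<in> mat_carrier A n"
  shows "amat_norm disc_algebra n (\<lambda>i j. \<Phi> (X i j)) = amat_norm A n X"
proof -
  have XA: "X i j \<in> acarrier A" if "i < n" "j < n" for i j using X that by (simp add: mat_carrier_def)
  have cong: "cmat_norm n M = cmat_norm n M'" if "\<And>i j. i < n \<Longrightarrow> j < n \<Longrightarrow> M i j = M' i j" for M M'
  proof -
    have "(\<Sum>i<n. (cmod (\<Sum>j<n. M i j * v j))\<^sup>2) = (\<Sum>i<n. (cmod (\<Sum>j<n. M' i j * v j))\<^sup>2)" for v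
      using that by (intro sum.cong refl arg_cong[where f = "\<lambda>x. (cmod x)\<^sup>2"]) auto
    thus ?thesis unfolding cmat_norm_def by simp
  qed
  obtain \<tau> where \<tau>: "\<tau> \<in> character_space A" "cmat_norm n (\<lambda>i j. \<tau> (X i j)) = op_mat_norm Q n X"
    by (rule char_attained[OF n XA])
  have "cmat_norm n (\<lambda>i j. \<Phi> (X i j) (\<tau> u)) = op_mat_norm Q n X"
    unfolding \<tau>(2)[symmetric] by (rule cong) (simp add: char_\<Phi>[OF \<tau>(1) XA])
  moreover have "\<tau> u \<in> cball 0 1" using char_u[OF \<tau>(1)] by simp
  ultimately have 1: "op_mat_norm Q n X \<in> (\<lambda>z. cmat_norm n (\<lambda>i j. \<Phi> (X i j) z)) ` cball 0 1"
    by (metis image_eqI)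
  have 2: "cmat_norm n (\<lambda>i j. \<Phi> (X i j) z) \<le> op_mat_norm Q n X" if "z \<in> cball 0 1" for z
  proof -
    have z: "cmod z \<le> 1" using that by simp
    have "cmat_norm n (\<lambda>i j. \<Phi> (X i j) z) = cmat_norm n (\<lambda>i j. (\<lambda>T\<in>acarrier A. \<Phi> T z) (X i j))"
      by (rule cong) (simp add: XA)
    also have "\<dots> \<le> op_mat_norm Q n X" by (rule char_le[OF \<Phi>_char[OF z] n XA])
    finally show ?thesis .
  qed
  have "amat_norm disc_algebra n (\<lambda>i j. \<Phi> (X i j)) = (SUP z\<in>cball 0 1. cmat_norm n (\<lambda>i j. \<Phi> (X i j) z))"
    by (simp add: disc_algebra_def)
  also have "\<dots> = op_mat_norm Q n X" by (rule cSup_eq_maximum[OF 1]) (use 2 in blast)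
  finally show ?thesis by (simp add: A_simps)
qed

lemma \<Phi>_inj:
  assumes T: "T \<in> acarrier A" and U: "U \<in> acarrier A" and eq: "\<Phi> T = \<Phi> U"
  shows "T = U"
proof (rule K.bounded_ops_eqI[OF A_bounded[OF T] A_bounded[OF U]])
  fix f assume f: "f \<in> K"
  have "nm ((\<lambda>f\<in>K. \<lambda>z. T f z - U f z) f) \<le> 0 * nm f"
  proof (rule norm_bound[OF A_diff(1)[OF T U] _ f])
    show "cmod (\<tau> (\<lambda>f\<in>K. \<lambda>z. T f z - U f z)) \<le> 0" if "\<tau> \<in> character_space A" for \<tau>
      using A_diff(2)[OF T U that] char_\<Phi>[OF that T] char_\<Phi>[OF that U] eq by simp
  qed
  moreover have d: "(\<lambda>z. T f z - U f z) \<in> V" using A_mem[OF T f] A_mem[OF U f] by (intro diff_mem K_V)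
  ultimately have "nm (\<lambda>z. T f z - U f z) = 0" using f nm_nonneg[OF d] by simp
  thus "T f = U f" using nm_eq_0[OF d] by (auto simp: fun_eq_iff)
qed

end

text \<open>The dilate \<open>F (r z)\<close> is close to \<open>F\<close> by uniform continuity,
  and the Taylor polynomials of \<open>F\<close> converge uniformly on the smaller disc of radius
  \<open>r\<close>.\<close>

lemma disc_algebra_poly_approx:
  assumes F: "F \<in> acarrier disc_algebra" and e: "e > 0"
  obtains N c where "\<And>z. cmod z \<le> 1 \<Longrightarrow> cmod (F z - (\<Sum>i<(N::nat). c i * z ^ i)) \<le> e"
proof -
  have cont: "continuous_on (cball 0 1) F" and hol: "F holomorphic_on ball 0 1"
    using F by (auto simp: disc_algebra_def)
  have "uniformly_continuous_on (cball 0 1) F"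
    using cont by (rule compact_uniformly_continuous) simp
  then obtain d where d: "d > 0" "\<And>x y. cmod x \<le> 1 \<Longrightarrow> cmod y \<le> 1 \<Longrightarrow> dist y x < d \<Longrightarrow> dist (F y) (F x) < e / 2"
    using e unfolding uniformly_continuous_on_def by (metis half_gt_zero mem_cball_0)
  \<comment> \<open>The maximum with \<open>1 / 2\<close> keeps \<open>r\<close> positive when
    \<open>d\<close> is large, while \<open>1 - r\<close> is at most \<open>d / 2\<close>.\<close>
  define r where "r = max (1 - d / 2) (1 / 2)"
  have r: "0 < r" "r < 1" "1 - r < d" using d(1) by (auto simp: r_def)
  define c where "c n = (deriv ^^ n) F 0 / fact n" for n
  have sums: "(\<lambda>n. c n * w ^ n) sums F w" if "cmod w < 1" for w
    using holomorphic_power_series[OF hol, of w] that by (simp add: c_def)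
  have "conv_radius c \<ge> ereal 1"
  proof (rule conv_radius_geI_ex')
    fix r :: real assume "0 < r" "ereal r < ereal 1"
    thus "summable (\<lambda>n. c n * of_real r ^ n)" by (intro sums_summable[OF sums]) simp
  qed
  hence "ereal r < conv_radius c" using r(2) by (meson less_ereal.simps(1) less_le_trans)
  hence "uniform_limit (cball 0 r) (\<lambda>n x. \<Sum>i<n. c i * (x - 0) ^ i) (\<lambda>x. suminf (\<lambda>i. c i * (x - 0) ^ i)) sequentially"
    by (rule powser_uniform_limit)
  hence "\<forall>\<^sub>F n in sequentially. \<forall>x\<in>cball 0 r. dist (\<Sum>i<n. c i * x ^ i) (suminf (\<lambda>i. c i * x ^ i)) < e / 2"
    using half_gt_zero[OF e] unfolding uniform_limit_iff diff_0_right by blast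
  then obtain N where N: "\<And>x. cmod x \<le> r \<Longrightarrow> dist (\<Sum>i<N. c i * x ^ i) (suminf (\<lambda>i. c i * x ^ i)) < e / 2"
    unfolding eventually_sequentially by (metis mem_cball_0 order_refl)
  show ?thesis
  proof (rule that[of "\<lambda>i. c i * of_real r ^ i" N])
    fix z :: complex assume z: "cmod z \<le> 1"
    let ?w = "of_real r * z"
    have w: "cmod ?w \<le> r" using z r by (simp add: norm_mult mult_left_le)
    have "dist ?w z = (1 - r) * cmod z"
    proof -
      have eq: "?w - z = of_real (r - 1) * z" by (simp add: algebra_simps)
      show ?thesis unfolding dist_norm eq norm_mult norm_of_real using r by simp
    qed
    also have "\<dots> \<le> (1 - r) * 1" using z r by (intro mult_left_mono) auto
    finally have "dist (F ?w) (F z) < e / 2" using d(2)[OF z, of ?w] w r by simp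
    moreover have "dist (\<Sum>i<N. c i * ?w ^ i) (F ?w) < e / 2"
      using N[OF w] sums_unique[OF sums[of ?w]] w r by simp
    ultimately have "dist (\<Sum>i<N. c i * ?w ^ i) (F z) < e"
      using dist_triangle[of "\<Sum>i<N. c i * ?w ^ i" "F z" "F ?w"] by simp
    thus "cmod (F z - (\<Sum>i<N. c i * of_real r ^ i * z ^ i)) \<le> e"
      by (simp add: dist_norm norm_minus_commute power_mult_distrib mult.assoc)
  qed
qed

context axis_quotient
begin

text \<open>Completeness of the algebra for sequences with an explicit rate; the rate survives in
  the limit, so \<open>p n\<close> itself approximates \<open>T\<close>.\<close>

lemma limit_in_A:
  assumes p: "\<And>n. polynomial_fn (p n)"
    and cauchy: "\<And>m n f. f \<in> K \<Longrightarrow>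
      nm (\<lambda>z. C (p m) f z - C (p n) f z) \<le> (1 / real (Suc m) + 1 / real (Suc n)) * nm f"
  obtains T where "T \<in> acarrier A" "\<And>n. approx T (1 / real (Suc n)) (p n)"
proof -
  have Cm: "C (p n) f \<in> K" if "f \<in> K" for n f by (rule A_mem[OF C_in_A[OF p] that])
  have ex: "\<exists>g\<in>K. (\<lambda>n. nm (\<lambda>z. C (p n) f z - g z)) \<longlonglongrightarrow> 0" if f: "f \<in> K" for f
  proof -
    have "\<exists>N. \<forall>m\<ge>N. \<forall>n\<ge>N. nm (\<lambda>z. C (p m) f z - C (p n) f z) < e" if e: "e > 0" for e
    proof -
      have nf: "nm f \<ge> 0" using K_V[OF f] by simp
      define d where "d = e / (nm f + 1)"
      have d: "d > 0" using e nf by (simp add: d_def)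
      obtain N where N: "1 / real (Suc N) < d / 2"
        using reals_Archimedean[of "d / 2"] d by (auto simp: inverse_eq_divide)
      have "nm (\<lambda>z. C (p m) f z - C (p n) f z) < e" if mn: "m \<ge> N" "n \<ge> N" for m n
      proof -
        have le: "1 / real (Suc n) \<le> 1 / real (Suc N)" if "n \<ge> N" for n
          using that by (auto simp: field_simps)
        have "nm (\<lambda>z. C (p m) f z - C (p n) f z) \<le> (1 / real (Suc m) + 1 / real (Suc n)) * nm f"
          by (rule cauchy[OF f])
        also have "\<dots> \<le> d * nm f"
        proof (rule mult_right_mono[OF _ nf])
          show "1 / real (Suc m) + 1 / real (Suc n) \<le> d"
            using le[OF mn(1)] le[OF mn(2)] N by linarith
        qed
        also have "\<dots> < e" using e nf by (simp add: d_def field_simps)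
        finally show ?thesis .
      qed
      thus ?thesis by blast
    qed
    then obtain g where "g \<in> K" "(\<lambda>n. nm (\<lambda>z. C (p n) f z - g z)) \<longlonglongrightarrow> 0"
      using K.complete[of "\<lambda>n. C (p n) f", OF Cm[OF f]] by blast
    thus ?thesis by blast
  qed
  define T where "T = (\<lambda>f\<in>K. SOME g. g \<in> K \<and> (\<lambda>n. nm (\<lambda>z. C (p n) f z - g z)) \<longlonglongrightarrow> 0)"
  have T: "T f \<in> K" "(\<lambda>n. nm (\<lambda>z. C (p n) f z - T f z)) \<longlonglongrightarrow> 0" if f: "f \<in> K" for f
    using someI_ex[of "\<lambda>g. g \<in> K \<and> (\<lambda>n. nm (\<lambda>z. C (p n) f z - g z)) \<longlonglongrightarrow> 0"] ex[OF f] f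
    unfolding T_def by auto
  \<comment> \<open>Norm convergence implies convergence of values, so linearity of \<open>T\<close>
    can be checked pointwise.\<close>
  have point: "(\<lambda>n. C (p n) f w) \<longlonglongrightarrow> T f w" if f: "f \<in> K" for f w
  proof (cases "w \<in> ball 0 1")
    case True
    show ?thesis
      using ip_tendsto[OF K_V[OF Cm[OF f]] K_V[OF T(1)[OF f]] kf_mem[OF True] T(2)[OF f]]
        ip_kf[OF True K_V[OF Cm[OF f]]] ip_kf[OF True K_V[OF T(1)[OF f]]] by simp
  next
    case False
    thus ?thesis using supported[OF K_V[OF Cm[OF f]] False] supported[OF K_V[OF T(1)[OF f]] False] by simp
  qed
  have near: "nm (\<lambda>z. T f z - C (p n) f z) \<le> 1 / real (Suc n) * nm f" if f: "f \<in> K" for n f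
  proof -
    \<comment> \<open>\<open>n\<close> is fixed and \<open>m\<close> tends to infinity in the Cauchy
      estimate.\<close>
    have "(\<lambda>m. nm (\<lambda>z. C (p m) f z - T f z) + (1 / real (Suc m) + 1 / real (Suc n)) * nm f)
        \<longlonglongrightarrow> 0 + (0 + 1 / real (Suc n)) * nm f"
      using LIMSEQ_inverse_real_of_nat
      by (intro tendsto_add tendsto_mult tendsto_const T f) (simp add: inverse_eq_divide)
    moreover have "nm (\<lambda>z. T f z - C (p n) f z) \<le>
        nm (\<lambda>z. C (p m) f z - T f z) + (1 / real (Suc m) + 1 / real (Suc n)) * nm f" for m
      using K.nm_triangle3[OF T(1)[OF f] Cm[OF f, of m] Cm[OF f, of n]] cauchy[OF f, of m n]
        K.nm_diff_sym[OF T(1)[OF f] Cm[OF f, of m]] by simp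
    ultimately have "nm (\<lambda>z. T f z - C (p n) f z) \<le> 0 + (0 + 1 / real (Suc n)) * nm f"
      by (intro LIMSEQ_le_const) auto
    thus ?thesis by simp
  qed
  obtain C0 where C0: "\<And>f. f \<in> K \<Longrightarrow> nm (C (p 0) f) \<le> C0 * nm f" using A_nm[OF C_in_A[OF p]] by blast
  have "T \<in> bounded_ops Q"
  proof (rule K.bounded_opsI[of _ "1 + C0", unfolded Q_simps])
    fix f assume f: "f \<in> K"
    show "T f \<in> K" by (rule T(1)[OF f])
    show "nm (T f) \<le> (1 + C0) * nm f"
      using K.nm_triangle[OF K.diff_mem[OF T(1)[OF f] Cm[OF f, of 0]] Cm[OF f, of 0]] near[OF f, of 0] C0[OF f]
      by (simp add: algebra_simps)
    show "T (\<lambda>z. c * f z) = (\<lambda>z. c * T f z)" for c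
    proof
      fix w
      have "(\<lambda>n. c * C (p n) f w) \<longlonglongrightarrow> c * T f w" by (intro tendsto_intros point f)
      moreover have "c * C (p n) f w = C (p n) (\<lambda>z. c * f z) w" for n
        using K.bounded_opsD(4)[OF C_bounded[OF p] f] by simp
      ultimately show "T (\<lambda>z. c * f z) w = c * T f w"
        using point[OF K.scale_mem[OF f], of c w] LIMSEQ_unique by simp
    qed
    show "T (\<lambda>z. f z + g z) = (\<lambda>z. T f z + T g z)" if g: "g \<in> K" for g
    proof
      fix w
      have "(\<lambda>n. C (p n) f w + C (p n) g w) \<longlonglongrightarrow> T f w + T g w" by (intro tendsto_intros point f g)
      moreover have "C (p n) f w + C (p n) g w = C (p n) (\<lambda>z. f z + g z) w" for n
        using K.bounded_opsD(3)[OF C_bounded[OF p] f g] by simp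
      ultimately show "T (\<lambda>z. f z + g z) w = T f w + T g w"
        using point[OF K.add_mem[OF f g], of w] LIMSEQ_unique by simp
    qed
  qed (simp add: T_def)
  moreover have approx: "approx T (1 / real (Suc n)) (p n)" for n
    using p near by (simp add: approx_def)
  have "\<exists>p. approx T e p" if e: "e > 0" for e
  proof -
    obtain n where n: "1 / real (Suc n) < e"
      using reals_Archimedean[OF e] by (auto simp: inverse_eq_divide)
    have "nm (\<lambda>z. T f z - C (p n) f z) \<le> e * nm f" if f: "f \<in> K" for f
      using near[OF f, of n] mult_right_mono[of "1 / real (Suc n)" e "nm f"] n K_V[OF f] by simp
    thus ?thesis using p by (auto simp: approx_def)
  qed
  ultimately have "T \<in> acarrier A" by (intro A_of_approx)
  thus ?thesis using that approx by blast
qed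

text \<open>Characters are evaluations at points of the closed disc, so \<open>norm_bound\<close>
  turns uniform closeness of polynomials there into operator norm closeness of their compressions.
  Polynomials tending to \<open>F\<close> thus give a Cauchy sequence of operators, whose limit has
  symbol \<open>F\<close>.\<close>

lemma \<Phi>_surj:
  assumes F: "F \<in> D" shows "\<exists>T\<in>acarrier A. \<Phi> T = F"
proof -
  have "\<exists>N c. \<forall>z. cmod z \<le> 1 \<longrightarrow> cmod (F z - (\<Sum>i<(N::nat). c i * z ^ i)) \<le> 1 / real (Suc n)" for n
  proof -
    obtain N c where "\<And>z. cmod z \<le> 1 \<Longrightarrow> cmod (F z - (\<Sum>i<(N::nat). c i * z ^ i)) \<le> 1 / real (Suc n)"
      by (rule disc_algebra_poly_approx[OF F, of "1 / real (Suc n)"]) auto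
    thus ?thesis by blast
  qed
  then obtain N c where Nc: "\<And>n z. cmod z \<le> 1 \<Longrightarrow> cmod (F z - (\<Sum>i<(N n::nat). c n i * z ^ i)) \<le> 1 / real (Suc n)"
    by metis
  define p where "p n z = (\<Sum>i<N n. c n i * vinner z \<zeta> ^ i)" for n z
  have p: "polynomial_fn (p n)" for n unfolding p_def by (intro polynomial_fn_intros)
  have line: "p n (z *s \<zeta>) = (\<Sum>i<N n. c n i * z ^ i)" for n z
    using unit by (simp add: p_def vinner_scale_left)
  have near: "cmod (F z - p n (z *s \<zeta>)) \<le> 1 / real (Suc n)" if "cmod z \<le> 1" for z n
    unfolding line by (rule Nc[OF that])
  have cauchy: "nm (\<lambda>z. C (p m) f z - C (p n) f z) \<le> (1 / real (Suc m) + 1 / real (Suc n)) * nm f"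
    if f: "f \<in> K" for m n f
  proof -
    let ?D = "\<lambda>f\<in>K. \<lambda>z. C (p m) f z - C (p n) f z"
    have "nm (?D f) \<le> (1 / real (Suc m) + 1 / real (Suc n)) * nm f"
    proof (rule norm_bound[OF A_diff(1)[OF C_in_A[OF p] C_in_A[OF p]] _ f])
      fix \<tau> assume \<tau>: "\<tau> \<in> character_space A"
      have "\<tau> ?D = p m (\<tau> u *s \<zeta>) - p n (\<tau> u *s \<zeta>)"
        using A_diff(2)[OF C_in_A[OF p] C_in_A[OF p] \<tau>] char_poly_axis[OF \<tau> p] by simp
      thus "cmod (\<tau> ?D) \<le> 1 / real (Suc m) + 1 / real (Suc n)"
        using near[OF char_u[OF \<tau>], of m] near[OF char_u[OF \<tau>], of n]
          norm_triangle_ineq4[of "F (\<tau> u) - p n (\<tau> u *s \<zeta>)" "F (\<tau> u) - p m (\<tau> u *s \<zeta>)"]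
        by simp
    qed
    thus ?thesis using f by simp
  qed
  obtain T where T: "T \<in> acarrier A" "\<And>n. approx T (1 / real (Suc n)) (p n)"
    using limit_in_A[OF p cauchy] by blast
  have "ev T z = F z" if z: "cmod z < 1" for z
  proof -
    have "ev T z - F z = 0"
    proof (rule eq_0_of_small_multiples)
      fix e :: real assume e: "e > 0"
      obtain n where n: "1 / real (Suc n) < e / 2"
        using reals_Archimedean[of "e / 2"] e by (auto simp: inverse_eq_divide)
      have "cmod (ev T z - F z) \<le> 1 / real (Suc n) + 1 / real (Suc n)"
        using ev_approx[OF T(1) T(2) z, of n] near[of z n] z
          norm_triangle_ineq4[of "ev T z - p n (z *s \<zeta>)" "F z - p n (z *s \<zeta>)"] by simp
      thus "cmod (ev T z - F z) \<le> e * 1" using n by simp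
    qed
    thus ?thesis by simp
  qed
  thus ?thesis using \<Phi>_eqI[OF T(1) F] T(1) by blast
qed

theorem isomorphic_disc_algebra: "completely_isometrically_isomorphic A disc_algebra"
  unfolding completely_isometrically_isomorphic_def
proof (intro exI[of _ \<Phi>] conjI ballI allI impI)
  show "bij_betw \<Phi> (acarrier A) D"
    unfolding bij_betw_def
  proof
    show "inj_on \<Phi> (acarrier A)" by (intro inj_onI \<Phi>_inj)
    show "\<Phi> ` acarrier A = D"
    proof (intro equalityI subsetI)
      fix F assume "F \<in> D"
      then obtain T where "T \<in> acarrier A" "\<Phi> T = F" using \<Phi>_surj by blast
      thus "F \<in> \<Phi> ` acarrier A" by blast
    qed (auto intro: \<Phi>_D)
  qed
  show "\<Phi> (aone A) = aone disc_algebra"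
    unfolding A_simps(5) \<Phi>_one by (simp add: disc_algebra_def)
  show "amat_norm disc_algebra n (\<lambda>i j. \<Phi> (X i j)) = amat_norm A n X"
    if "1 \<le> n" "X \<in> mat_carrier A n" for n X by (rule \<Phi>_norm[OF that])
  fix T c assume T: "T \<in> acarrier A"
  show "\<Phi> (ascale A c T) = ascale disc_algebra c (\<Phi> T)"
    unfolding A_simps(3) \<Phi>_scale[OF T] by (simp add: disc_algebra_def)
  fix U assume U: "U \<in> acarrier A"
  show "\<Phi> (aplus A T U) = aplus disc_algebra (\<Phi> T) (\<Phi> U)"
    unfolding A_simps(2) \<Phi>_add[OF T U] by (simp add: disc_algebra_def)
  show "\<Phi> (atimes A T U) = atimes disc_algebra (\<Phi> T) (\<Phi> U)"
    unfolding A_simps(4) \<Phi>_mult[OF T U] by (simp add: disc_algebra_def)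
qed

end

theorem theorem5p1:
  fixes H :: "('n::finite) fn_space"
    and k :: "complex ^ 'n \<Rightarrow> complex ^ 'n \<Rightarrow> complex"
    and a b :: "nat \<Rightarrow> real"
    and I :: "'n fn set"
  assumes "regular_ui_cnp_space H k a b"
    and "maximal_cnp b"
    and "weak_star_closed_ideal H I"
    and "homogeneous_ideal H I"
    and "I \<noteq> multipliers H"
    and "dim_gt_one (quotient_space H I)"
    and "\<not> completely_isometrically_isomorphic (quotient_alg H I) disc_algebra"
  shows "\<not> gelfand_completely_isometric (quotient_alg H I)"
proof
  assume gci: "gelfand_completely_isometric (quotient_alg H I)"
  obtain G where G: "\<forall>g\<in>G. homogeneous_fn g" "I = mult_weak_star H closure_of (on_ball ` polynomial_ideal G)"
    using assms(4) unfolding homogeneous_ideal_def by blast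
  interpret proper_gelfand_quotient H k a b I G
    using assms gci G by unfold_locales (auto simp: weak_star_closed_ideal_def)
  obtain \<zeta> where "vinner \<zeta> \<zeta> = 1" "\<And>\<xi>. \<xi> \<in> S \<Longrightarrow> vinner \<zeta> \<xi> = 0" "\<And>\<xi>. vinner \<xi> \<zeta> = 0 \<Longrightarrow> \<xi> \<in> S"
    using exists_axis by blast
  then interpret axis_quotient H k a b I G \<zeta>
    using assms(2) by unfold_locales auto
  show False using isomorphic_disc_algebra assms(7) by simp
qed

end
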